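(* Let $n\geq 2$ and $r$ be integers with $r\geq 1+\binom{n-2}{\left\lfloor \frac{n-2}{2}\right\rfloor}$. Let $K$ be a field, let $S=K[x_1,\ldots,x_{n+r-1}]$ and let $I_{n,r}=x_1x_2\cdots x_{r-1}(x_r,x_{r+1},\ldots,x_{r+n-1})\subset S$. Then $$\operatorname{hdepth}(S/I_{n,r})=n+r-3.$$
   Context: $S$ carries the standard grading. For a finitely generated graded $S$-module $M$, the Hilbert depth $\operatorname{hdepth}(M)$ is the maximal depth of a finitely generated graded $S$-module $U$ having the same Hilbert series as $M$. The ideal $I_{n,r}$ is the squarefree monomial ideal generated by the $n$ monomials $x_1\cdots x_{r-1}x_{i}$, $r\leq i\leq r+n-1$. *)

theory Defs
  imports
    "HOL-Algebra.QuotRing"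
    "HOL-Library.Poly_Mapping"
    "HOL-Library.Extended_Nat"
    "HOL-Computational_Algebra.Formal_Laurent_Series"
    "Jordan_Normal_Form.Missing_VectorSpace"
begin

hide_const (open) Modules.module Multiset.mult Polynomial.smult

section \<open>The polynomial ring with its standard grading\<close>

text \<open>A monomial is a finitely supported exponent vector. The type has the variables
  \<open>x\<^sub>0, x\<^sub>1, \<dots>\<close>; \<open>K[x\<^sub>1,\<dots>,x\<^sub>N]\<close> is a carrier inside it.\<close>

type_synonym 'k mpoly = "(nat \<Rightarrow>\<^sub>0 nat) \<Rightarrow>\<^sub>0 'k"

definition field_ring :: "'k::field ring" where
  "field_ring = \<lparr>carrier = UNIV, mult = (*), one = 1, zero = 0, add = (+)\<rparr>"

definition poly_ring :: "nat \<Rightarrow> 'k::field mpoly ring" where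
  "poly_ring N = \<lparr>carrier = {p. \<forall>m\<in>Poly_Mapping.keys p. Poly_Mapping.keys m \<subseteq> {1..N}},
     mult = (*), one = 1, zero = 0, add = (+)\<rparr>"

definition Var :: "nat \<Rightarrow> 'k::field mpoly" where
  "Var i = Poly_Mapping.single (Poly_Mapping.single i 1) 1"

definition Const :: "'k::field \<Rightarrow> 'k mpoly" where
  "Const c = Poly_Mapping.single 0 c"

definition mono_deg :: "(nat \<Rightarrow>\<^sub>0 nat) \<Rightarrow> nat" where
  "mono_deg m = (\<Sum>i\<in>Poly_Mapping.keys m. Poly_Mapping.lookup m i)"

definition homog_part :: "nat \<Rightarrow> int \<Rightarrow> 'k::field mpoly set" where
  "homog_part N d =
     {p \<in> carrier (poly_ring N). \<forall>m\<in>Poly_Mapping.keys p. int (mono_deg m) = d}"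

definition max_ideal :: "nat \<Rightarrow> 'k::field mpoly set" where
  "max_ideal N = Idl\<^bsub>poly_ring N\<^esub> (Var ` {1..N})"


section \<open>Finitely generated graded modules and their Hilbert series\<close>

text \<open>A grading is the family of its homogeneous components, indexed by the integers; every
  element is a sum of a unique finitely supported family of homogeneous elements.\<close>

definition graded_module ::
  "nat \<Rightarrow> ('k::field mpoly, 'u) module \<Rightarrow> (int \<Rightarrow> 'u set) \<Rightarrow> bool" where
  "graded_module N U G \<longleftrightarrow>
     module (poly_ring N) U \<and>
     (\<forall>i. subgroup (G i) (add_monoid U)) \<and>
     (\<forall>d i. \<forall>s\<in>homog_part N d. \<forall>u\<in>G i. s \<odot>\<^bsub>U\<^esub> u \<in> G (d + i)) \<and>
     (\<forall>u\<in>carrier U. \<exists>!f. (\<forall>i. f i \<in> G i) \<and> finite {i. f i \<noteq> \<zero>\<^bsub>U\<^esub>} \<and>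
        u = (\<Oplus>\<^bsub>U\<^esub> i\<in>{i. f i \<noteq> \<zero>\<^bsub>U\<^esub>}. f i))"

definition fin_gen :: "nat \<Rightarrow> ('k::field mpoly, 'u) module \<Rightarrow> bool" where
  "fin_gen N U \<longleftrightarrow>
     (\<exists>A. finite A \<and> A \<subseteq> carrier U \<and>
        LinearCombinations.module.span (poly_ring N) U A = carrier U)"

text \<open>The \<open>K\<close>-vector space on a homogeneous component, by restricting scalars along
  \<open>K \<rightarrow> S\<close>.\<close>

definition component_space :: "('k::field mpoly, 'u) module \<Rightarrow> 'u set \<Rightarrow> ('k, 'u) module" where
  "component_space U V =
     \<lparr>carrier = V, mult = mult U, one = one U, zero = zero U, add = add U,
      smult = (\<lambda>c. smult U (Const c))\<rparr>"

text \<open>The components of a finitely generated graded module are finite-dimensional and vanish in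
  all sufficiently small degrees, so its Hilbert series is a formal Laurent series.\<close>

definition hilbert_series ::
  "('k::field mpoly, 'u) module \<Rightarrow> (int \<Rightarrow> 'u set) \<Rightarrow> int fls" where
  "hilbert_series U G =
     Abs_fls (\<lambda>i. int (VectorSpace.vectorspace.dim field_ring (component_space U (G i))))"


section \<open>Depth and Hilbert depth\<close>

definition ideal_times ::
  "nat \<Rightarrow> 'k::field mpoly set \<Rightarrow> ('k mpoly, 'u) module \<Rightarrow> 'u set" where
  "ideal_times N F U =
     LinearCombinations.module.span (poly_ring N) U {f \<odot>\<^bsub>U\<^esub> u | f u. f \<in> F \<and> u \<in> carrier U}"

text \<open>\<open>fs ! i\<close> is a nonzerodivisor on \<open>U/(f\<^sub>0,\<dots>,f\<^sub>i\<^sub>-\<^sub>1)U\<close> for every \<open>i\<close>, and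
  \<open>U/(fs)U\<close> is nonzero.\<close>

definition regular_sequence ::
  "nat \<Rightarrow> ('k::field mpoly, 'u) module \<Rightarrow> 'k mpoly list \<Rightarrow> bool" where
  "regular_sequence N U fs \<longleftrightarrow>
     set fs \<subseteq> carrier (poly_ring N) \<and>
     (\<forall>i<length fs. \<forall>u\<in>carrier U.
        fs ! i \<odot>\<^bsub>U\<^esub> u \<in> ideal_times N (set (take i fs)) U \<longrightarrow>
        u \<in> ideal_times N (set (take i fs)) U) \<and>
     ideal_times N (set fs) U \<noteq> carrier U"

text \<open>The zero module has no regular sequence at all, so it gets depth \<open>0\<close> here.\<close>

definition depth :: "nat \<Rightarrow> ('k::field mpoly, 'u) module \<Rightarrow> enat" where
  "depth N U =
     Sup {enat (length fs) | fs. set fs \<subseteq> max_ideal N \<and> regular_sequence N U fs}"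

text \<open>A definition cannot quantify over all types, so \<open>U\<close> ranges over the modules with carrier
  in one fixed type, in which the quotients of the free modules \<open>S\<^sup>k\<close> live with cosets as
  elements. This loses nothing, see \<open>depth_le_hdepth\<close> below. A finite supremum of a nonempty
  set in \<^typ>\<open>enat\<close> is attained, hence a maximum.\<close>

definition hdepth ::
  "nat \<Rightarrow> ('k::field mpoly, 'm) module \<Rightarrow> (int \<Rightarrow> 'm set) \<Rightarrow> enat" where
  "hdepth N M H =
     Sup {depth N U | (U :: ('k mpoly, (nat \<Rightarrow> 'k mpoly) set) module) G.
        graded_module N U G \<and> fin_gen N U \<and> hilbert_series U G = hilbert_series M H}"


section \<open>The carrier type in the definition of Hilbert depth is no restriction\<close>

text \<open>Every finitely generated graded module, over whatever type, has an isomorphic copy in that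
  type, so its depth is bounded by the Hilbert depth.\<close>

lemma cring_poly_ring: "cring (poly_ring N :: 'k::field mpoly ring)"
proof -
  have add: "Poly_Mapping.keys (p + q) \<subseteq> Poly_Mapping.keys p \<union> Poly_Mapping.keys q" for p q :: "'k mpoly"
    by (rule Poly_Mapping.keys_add)
  show ?thesis
  proof (rule cringI)
    show "abelian_group (poly_ring N :: 'k mpoly ring)"
    proof (rule abelian_groupI)
      fix x y :: "'k mpoly" assume "x \<in> carrier (poly_ring N)" "y \<in> carrier (poly_ring N)"
      then show "x \<oplus>\<^bsub>poly_ring N\<^esub> y \<in> carrier (poly_ring N)"
        using add[of x y] by (auto simp: poly_ring_def)
    next
      fix x :: "'k mpoly" assume x: "x \<in> carrier (poly_ring N)"
      show "\<exists>y\<in>carrier (poly_ring N). y \<oplus>\<^bsub>poly_ring N\<^esub> x = \<zero>\<^bsub>poly_ring N\<^esub>"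
        by (rule bexI[of _ "-x"]) (use x in \<open>auto simp: poly_ring_def\<close>)
    qed (auto simp: poly_ring_def)
    show "comm_monoid (poly_ring N :: 'k mpoly ring)"
    proof (rule comm_monoidI)
      fix x y :: "'k mpoly" assume x: "x \<in> carrier (poly_ring N)" and y: "y \<in> carrier (poly_ring N)"
      have "Poly_Mapping.keys m \<subseteq> {1..N}" if mk: "m \<in> Poly_Mapping.keys (x * y)" for m
      proof -
        obtain a b where ab: "a \<in> Poly_Mapping.keys x" "b \<in> Poly_Mapping.keys y" "m = a + b"
          using subsetD[OF Poly_Mapping.keys_mult[of x y] mk] by (elim CollectE exE conjE)
        have "Poly_Mapping.keys a \<subseteq> {1..N}" "Poly_Mapping.keys b \<subseteq> {1..N}"
          using x y ab(1,2) by (simp_all add: poly_ring_def)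
        then show ?thesis
          unfolding ab(3) using Poly_Mapping.keys_add[of a b] by blast
      qed
      then show "x \<otimes>\<^bsub>poly_ring N\<^esub> y \<in> carrier (poly_ring N)"
        by (simp add: poly_ring_def)
    qed (simp_all add: poly_ring_def mult_ac)
    fix x y z :: "'k mpoly"
    show "(x \<oplus>\<^bsub>poly_ring N\<^esub> y) \<otimes>\<^bsub>poly_ring N\<^esub> z =
       x \<otimes>\<^bsub>poly_ring N\<^esub> z \<oplus>\<^bsub>poly_ring N\<^esub> y \<otimes>\<^bsub>poly_ring N\<^esub> z"
      by (simp add: poly_ring_def distrib_right)
  qed
qed

lemma cring_field_ring: "cring (field_ring :: 'k::field ring)"
proof (rule cringI)
  show "abelian_group (field_ring :: 'k ring)"
  proof (rule abelian_groupI)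
    fix x :: 'k
    show "\<exists>y\<in>carrier field_ring. y \<oplus>\<^bsub>field_ring\<^esub> x = \<zero>\<^bsub>field_ring\<^esub>"
      by (rule bexI[of _ "- x"]) (auto simp: field_ring_def)
  qed (auto simp: field_ring_def ac_simps)
  show "comm_monoid (field_ring :: 'k ring)"
    by (rule comm_monoidI) (auto simp: field_ring_def mult_ac)
qed (auto simp: field_ring_def distrib_right)

lemma field_field_ring: "field (field_ring :: 'k::field ring)"
proof -
  have "\<exists>y. y * x = 1 \<and> x * y = 1" if "x \<noteq> 0" for x :: 'k
    using that by (intro exI[of _ "inverse x"]) simp
  then show ?thesis
    by (intro cring.cring_fieldI[OF cring_field_ring]) (auto simp: field_ring_def Units_def)
qed

lemma module_component_space:
  assumes "module (poly_ring N) U" "subgroup V (add_monoid U)"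
    and "\<And>c v. v \<in> V \<Longrightarrow> Const c \<odot>\<^bsub>U\<^esub> v \<in> V"
  shows "module field_ring (component_space U V)"
proof -
  interpret M: module "poly_ring N" U by fact
  interpret V: subgroup V "add_monoid U" by fact
  have C: "Const c \<in> carrier (poly_ring N)" for c :: 'a
    by (auto simp: Const_def poly_ring_def)
  have sub: "v \<in> V \<Longrightarrow> v \<in> carrier U" for v using V.subset by auto
  have ad: "Const (a + b) = Const a \<oplus>\<^bsub>poly_ring N\<^esub> Const b" for a b :: 'a
    by (simp add: Const_def poly_ring_def single_add)
  have mu: "Const (a * b) = Const a \<otimes>\<^bsub>poly_ring N\<^esub> Const b" for a b :: 'a
    by (simp add: Const_def poly_ring_def mult_single)
  have on: "Const (1::'a) = \<one>\<^bsub>poly_ring N\<^esub>"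
    by (simp add: Const_def poly_ring_def)
  have vc: "a \<oplus>\<^bsub>U\<^esub> b \<in> V" if "a \<in> V" "b \<in> V" for a b using V.m_closed[of a b] that by simp
  have vz: "\<zero>\<^bsub>U\<^esub> \<in> V" using V.one_closed by simp
  have vi: "\<exists>y\<in>V. y \<oplus>\<^bsub>U\<^esub> x = \<zero>\<^bsub>U\<^esub>" if "x \<in> V" for x
    using V.m_inv_closed[OF that] M.l_neg[OF sub[OF that]] unfolding a_inv_def by auto
  show ?thesis
  proof (rule moduleI[OF cring_field_ring])
    show "abelian_group (component_space U V)"
    proof (rule abelian_groupI)
      fix x assume "x \<in> carrier (component_space U V)"
      then show "\<exists>y\<in>carrier (component_space U V). y \<oplus>\<^bsub>component_space U V\<^esub> x = \<zero>\<^bsub>component_space U V\<^esub>"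
        using vi by (simp add: component_space_def)
    qed (auto simp: component_space_def vc vz M.a_ac sub)
  qed (auto simp: component_space_def field_ring_def assms(3) ad mu on C sub
         M.smult_l_distr M.smult_r_distr M.smult_assoc1 simp del: One_nat_def)
qed

lemma mod_hom_finsum:
  assumes "mod_hom R M N h" "finite A" "g \<in> A \<rightarrow> carrier M"
  shows "h (finsum M g A) = finsum N (\<lambda>i. h (g i)) A"
proof -
  interpret mod_hom R M N h by fact
  show ?thesis using assms(2,3)
  proof (induction A rule: finite_induct)
    case empty then show ?case by simp
  next
    case (insert x F)
    then have "g \<in> F \<rightarrow> carrier M" "g x \<in> carrier M" by auto
    moreover from this have "(\<lambda>i. h (g i)) \<in> F \<rightarrow> carrier N" "h (g x) \<in> carrier N" by auto
    ultimately show ?case using insert by simp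
  qed
qed

lemma mod_hom_span:
  assumes h: "mod_hom R M N h" and i: "inj_on h (carrier M)" and A: "A \<subseteq> carrier M"
  shows "h ` LinearCombinations.module.span R M A = LinearCombinations.module.span R N (h ` A)"
proof -
  interpret mod_hom R M N h by fact
  have Nm: "abelian_monoid N" using h unfolding mod_hom_def module_def abelian_group_def by blast
  have key: "h (M.lincomb a B) = N.lincomb (\<lambda>v. a (inv_into (carrier M) h v)) (h ` B)"
    if "finite B" "B \<subseteq> A" "a \<in> B \<rightarrow> carrier R" for a B
  proof -
    have B: "B \<subseteq> carrier M" using that A by auto
    have inj: "inj_on h B" using i B inj_on_subset by blast
    have cl: "(\<lambda>v. a v \<odot>\<^bsub>M\<^esub> v) \<in> B \<rightarrow> carrier M" using that B by auto
    have "h (M.lincomb a B) = (\<Oplus>\<^bsub>N\<^esub> v\<in>B. h (a v \<odot>\<^bsub>M\<^esub> v))"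
      unfolding M.lincomb_def by (rule mod_hom_finsum[OF h that(1) cl])
    also have "\<dots> = (\<Oplus>\<^bsub>N\<^esub> v\<in>B. a (inv_into (carrier M) h (h v)) \<odot>\<^bsub>N\<^esub> h v)"
      using that B by (intro abelian_monoid.finsum_cong'[OF Nm]) (auto simp: inv_into_f_f[OF i] subset_iff Pi_def)
    also have "\<dots> = N.lincomb (\<lambda>v. a (inv_into (carrier M) h v)) (h ` B)"
      unfolding N.lincomb_def
      by (rule abelian_monoid.finsum_reindex[OF Nm _ inj, symmetric])
         (use that B in \<open>auto simp: inv_into_f_f[OF i] subset_iff Pi_def\<close>)
    finally show ?thesis .
  qed
  show ?thesis
  proof (intro equalityI subsetI)
    fix y assume "y \<in> h ` M.span A"
    then obtain a B where B: "finite B" "B \<subseteq> A" "a \<in> B \<rightarrow> carrier R" and y: "y = h (M.lincomb a B)"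
      unfolding M.span_def by auto
    have "y = N.lincomb (\<lambda>v. a (inv_into (carrier M) h v)) (h ` B)" using key[OF B] y by simp
    moreover have "(\<lambda>v. a (inv_into (carrier M) h v)) \<in> h ` B \<rightarrow> carrier R"
      using B A by (auto simp: inv_into_f_f[OF i] subset_iff Pi_def)
    ultimately show "y \<in> N.span (h ` A)"
      unfolding N.span_def using B by blast
  next
    fix y assume "y \<in> N.span (h ` A)"
    then obtain b C where C: "finite C" "C \<subseteq> h ` A" "b \<in> C \<rightarrow> carrier R" and y: "y = N.lincomb b C"
      unfolding N.span_def by auto
    define B where "B = {v\<in>A. h v \<in> C}"
    have hB: "h ` B = C" using C by (auto simp: B_def)
    have BA: "B \<subseteq> A" by (auto simp: B_def)
    have fin: "finite B"
      using C(1) hB finite_image_iff[of h B] inj_on_subset[OF i] BA A by auto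
    have a: "(\<lambda>v. b (h v)) \<in> B \<rightarrow> carrier R" using C by (auto simp: B_def)
    have "h (M.lincomb (\<lambda>v. b (h v)) B) = N.lincomb (\<lambda>v. b (h (inv_into (carrier M) h v))) C"
      using key[OF fin BA a] hB by simp
    also have "\<dots> = N.lincomb b C"
      unfolding N.lincomb_def
    proof (rule abelian_monoid.finsum_cong'[OF Nm])
      fix v assume "v \<in> C"
      then obtain w where "w \<in> A" "v = h w" using C by auto
      then show "b (h (inv_into (carrier M) h v)) \<odot>\<^bsub>N\<^esub> v = b v \<odot>\<^bsub>N\<^esub> v"
        using A by (auto simp: inv_into_f_f[OF i] subset_iff)
    qed (use C A in \<open>auto simp: Pi_def subset_iff\<close>)
    finally have "y = h (M.lincomb (\<lambda>v. b (h v)) B)" using y by simp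
    then show "y \<in> h ` M.span A" unfolding M.span_def using fin BA a by blast
  qed
qed


definition transport :: "('u \<Rightarrow> 'v) \<Rightarrow> ('a, 'u) module \<Rightarrow> ('a, 'v) module" where
  "transport h U =
     (let g = inv_into (carrier U) h in
      \<lparr>carrier = h ` carrier U, mult = (\<lambda>x y. h (g x \<otimes>\<^bsub>U\<^esub> g y)), one = h \<one>\<^bsub>U\<^esub>, zero = h \<zero>\<^bsub>U\<^esub>,
       add = (\<lambda>x y. h (g x \<oplus>\<^bsub>U\<^esub> g y)), smult = (\<lambda>c x. h (c \<odot>\<^bsub>U\<^esub> g x))\<rparr>)"

lemma transport_mod_hom:
  assumes U: "module R U" and i: "inj_on h (carrier U)"
  shows "mod_hom R U (transport h U) h"
proof -
  interpret U: module R U by fact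
  note inv = inv_into_f_f[OF i]
  have "module R (transport h U)"
  proof (rule moduleI[OF U.R.is_cring])
    show "abelian_group (transport h U)"
    proof (rule abelian_groupI)
      fix x assume "x \<in> carrier (transport h U)"
      then obtain u where u: "u \<in> carrier U" "x = h u" by (auto simp: transport_def Let_def)
      show "\<exists>y\<in>carrier (transport h U). y \<oplus>\<^bsub>transport h U\<^esub> x = \<zero>\<^bsub>transport h U\<^esub>"
        using u U.l_neg[OF u(1)]
        by (intro bexI[of _ "h (\<ominus>\<^bsub>U\<^esub> u)"]) (auto simp: transport_def Let_def inv)
    qed (auto simp: transport_def Let_def inv U.a_ac)
  qed (auto simp: transport_def Let_def inv U.smult_l_distr U.smult_r_distr U.smult_assoc1)
  moreover have "h \<in> module_hom R U (transport h U)"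
    by (auto simp: module_hom_def transport_def Let_def inv)
  ultimately show ?thesis using U by (intro mod_hom.intro mod_hom_axioms.intro)
qed

lemma carrier_transport [simp]: "carrier (transport h U) = h ` carrier U"
  by (simp add: transport_def Let_def)

lemma dim_iso:
  assumes f: "field R" and h: "mod_hom R M N h" and i: "inj_on h (carrier M)" and s: "h ` carrier M = carrier N"
  shows "VectorSpace.vectorspace.dim R M = VectorSpace.vectorspace.dim R N"
proof -
  have m: "module R M" "module R N" using h by (auto simp: mod_hom_def)
  have v: "vectorspace R M" "vectorspace R N" using m f by (auto simp: vectorspace_def)
  have "(\<exists>A. finite A \<and> card A = n \<and> A \<subseteq> carrier M \<and> LinearCombinations.module.span R M A = carrier M) \<longleftrightarrow>
     (\<exists>A. finite A \<and> card A = n \<and> A \<subseteq> carrier N \<and> LinearCombinations.module.span R N A = carrier N)" 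
    (is "?L \<longleftrightarrow> ?R") for n
  proof
    assume ?L
    then obtain A where A: "finite A" "card A = n" "A \<subseteq> carrier M"
      "LinearCombinations.module.span R M A = carrier M" by auto
    have "card (h ` A) = n" using A card_image inj_on_subset[OF i A(3)] by blast
    moreover have "LinearCombinations.module.span R N (h ` A) = carrier N"
      using mod_hom_span[OF h i A(3)] A(4) s by simp
    moreover have "h ` A \<subseteq> carrier N" using A(3) s by blast
    ultimately show ?R using A(1) by blast
  next
    assume ?R
    then obtain B where B: "finite B" "card B = n" "B \<subseteq> carrier N"
      "LinearCombinations.module.span R N B = carrier N" by auto
    obtain A where A: "A \<subseteq> carrier M" "B = h ` A" using B(3) s by (metis subset_image_iff)
    have iA: "inj_on h A" using inj_on_subset[OF i A(1)] .
    have "h ` LinearCombinations.module.span R M A = h ` carrier M"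
      using mod_hom_span[OF h i A(1)] B(4) A(2) s by simp
    moreover have "LinearCombinations.module.span R M A \<subseteq> carrier M"
      using m(1) A(1) module.span_is_subset2 by blast
    ultimately have "LinearCombinations.module.span R M A = carrier M"
      using i by (meson inj_on_image_eq_iff order_refl)
    moreover have "finite A" "card A = n" using B(1,2) finite_image_iff[OF iA] card_image[OF iA] unfolding A(2) by metis+
    ultimately show ?L using A by blast
  qed
  then show ?thesis
    by (simp add: VectorSpace.vectorspace.dim_def[OF v(1)] VectorSpace.vectorspace.dim_def[OF v(2)])
qed

lemma graded_transport:
  assumes g: "graded_module N U G" and i: "inj_on h (carrier U)"
  shows "graded_module N (transport h U) (\<lambda>i. h ` G i)"
proof -
  let ?V = "transport h U"
  have m: "module (poly_ring N) U" and sub: "\<And>i. subgroup (G i) (add_monoid U)"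
    and sm: "\<And>d i s u. s \<in> homog_part N d \<Longrightarrow> u \<in> G i \<Longrightarrow> s \<odot>\<^bsub>U\<^esub> u \<in> G (d + i)"
    and ex: "\<And>u. u \<in> carrier U \<Longrightarrow> \<exists>!f. (\<forall>i. f i \<in> G i) \<and> finite {i. f i \<noteq> \<zero>\<^bsub>U\<^esub>} \<and>
        u = (\<Oplus>\<^bsub>U\<^esub> i\<in>{i. f i \<noteq> \<zero>\<^bsub>U\<^esub>}. f i)"
    using g by (auto simp: graded_module_def)
  have mh: "mod_hom (poly_ring N) U ?V h" by (rule transport_mod_hom[OF m i])
  interpret mod_hom "poly_ring N" U ?V h by (rule mh)
  have Um: "abelian_monoid U" using m unfolding module_def abelian_group_def by blast
  have GU: "u \<in> carrier U" if "u \<in> G i" for u i using subgroup.subset[OF sub[of i]] that by auto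
  have hp: "s \<in> carrier (poly_ring N)" if "s \<in> homog_part N d" for s d
    using that by (simp add: homog_part_def)
  have hz: "h u = \<zero>\<^bsub>?V\<^esub> \<longleftrightarrow> u = \<zero>\<^bsub>U\<^esub>" if "u \<in> carrier U" for u
    using inj_onD[OF i, of u "\<zero>\<^bsub>U\<^esub>"] that by auto
  have "subgroup (h ` G j) (add_monoid ?V)" for j
  proof
    interpret S: subgroup "G j" "add_monoid U" by (rule sub)
    show "h ` G j \<subseteq> carrier (add_monoid ?V)" using GU by auto
    show "\<one>\<^bsub>add_monoid ?V\<^esub> \<in> h ` G j" using S.one_closed f0_is_0 by (auto intro: image_eqI[of _ _ "\<zero>\<^bsub>U\<^esub>"])
    show "x \<otimes>\<^bsub>add_monoid ?V\<^esub> y \<in> h ` G j" if "x \<in> h ` G j" "y \<in> h ` G j" for x y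
    proof -
      obtain u w where "u \<in> G j" "w \<in> G j" "x = h u" "y = h w" using \<open>x \<in> h ` G j\<close> \<open>y \<in> h ` G j\<close> by auto
      then show ?thesis using S.m_closed[of u w] GU f_add[of u w] by (auto intro: image_eqI[of _ _ "u \<oplus>\<^bsub>U\<^esub> w"])
    qed
    show "inv\<^bsub>add_monoid ?V\<^esub> x \<in> h ` G j" if "x \<in> h ` G j" for x
    proof -
      obtain u where u: "u \<in> G j" "x = h u" using \<open>x \<in> h ` G j\<close> by auto
      then have "\<ominus>\<^bsub>U\<^esub> u \<in> G j" using S.m_inv_closed[of u] by (simp add: a_inv_def)
      moreover have "h (\<ominus>\<^bsub>U\<^esub> u) = \<ominus>\<^bsub>?V\<^esub> x" using f_neg[OF GU[OF u(1)]] u by simp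
      ultimately show ?thesis unfolding a_inv_def[symmetric] by force
    qed
  qed
  moreover have "s \<odot>\<^bsub>?V\<^esub> v \<in> h ` G (d + j)" if "s \<in> homog_part N d" "v \<in> h ` G j" for s v d j
  proof -
    obtain u where u: "u \<in> G j" "v = h u" using \<open>v \<in> h ` G j\<close> by auto
    have "s \<odot>\<^bsub>?V\<^esub> v = h (s \<odot>\<^bsub>U\<^esub> u)" using f_smult[OF hp[OF \<open>s \<in> homog_part N d\<close>] GU[OF u(1)]] u by simp
    then show ?thesis using sm[OF \<open>s \<in> homog_part N d\<close> u(1)] by simp
  qed
  moreover have "\<exists>!f. (\<forall>i. f i \<in> h ` G i) \<and> finite {i. f i \<noteq> \<zero>\<^bsub>?V\<^esub>} \<and>
        v = (\<Oplus>\<^bsub>?V\<^esub> i\<in>{i. f i \<noteq> \<zero>\<^bsub>?V\<^esub>}. f i)" if "v \<in> carrier ?V" for v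
  proof -
    obtain u where u: "u \<in> carrier U" "v = h u" using \<open>v \<in> carrier ?V\<close> by auto
    have tr: "{i. h (f i) \<noteq> \<zero>\<^bsub>?V\<^esub>} = {i. f i \<noteq> \<zero>\<^bsub>U\<^esub>}" if "\<forall>i. f i \<in> G i" for f
      using that hz GU by blast
    have su: "h (\<Oplus>\<^bsub>U\<^esub> i\<in>{i. f i \<noteq> \<zero>\<^bsub>U\<^esub>}. f i) = (\<Oplus>\<^bsub>?V\<^esub> i\<in>{i. f i \<noteq> \<zero>\<^bsub>U\<^esub>}. h (f i))"
      if "\<forall>i. f i \<in> G i" "finite {i. f i \<noteq> \<zero>\<^bsub>U\<^esub>}" for f :: "int \<Rightarrow> _"
      by (rule mod_hom_finsum[OF mh that(2)]) (use that GU in auto)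
    obtain f where f: "\<forall>i. f i \<in> G i" "finite {i. f i \<noteq> \<zero>\<^bsub>U\<^esub>}"
        "u = (\<Oplus>\<^bsub>U\<^esub> i\<in>{i. f i \<noteq> \<zero>\<^bsub>U\<^esub>}. f i)"
      using ex[OF u(1)] by blast
    show ?thesis
    proof (rule ex1I[of _ "\<lambda>i. h (f i)"])
      show "(\<forall>i. h (f i) \<in> h ` G i) \<and> finite {i. h (f i) \<noteq> \<zero>\<^bsub>?V\<^esub>} \<and>
        v = (\<Oplus>\<^bsub>?V\<^esub> i\<in>{i. h (f i) \<noteq> \<zero>\<^bsub>?V\<^esub>}. h (f i))"
      proof (intro conjI)
        show "\<forall>i. h (f i) \<in> h ` G i" using f(1) by blast
        show "finite {i. h (f i) \<noteq> \<zero>\<^bsub>?V\<^esub>}" by (subst tr[OF f(1)]) (rule f(2))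
        have "h u = h (\<Oplus>\<^bsub>U\<^esub> i\<in>{i. f i \<noteq> \<zero>\<^bsub>U\<^esub>}. f i)" by (rule arg_cong[OF f(3)])
        then show "v = (\<Oplus>\<^bsub>?V\<^esub> i\<in>{i. h (f i) \<noteq> \<zero>\<^bsub>?V\<^esub>}. h (f i))"
          unfolding tr[OF f(1)] su[OF f(1,2)] u(2) .
      qed
    next
      fix f' assume f': "(\<forall>i. f' i \<in> h ` G i) \<and> finite {i. f' i \<noteq> \<zero>\<^bsub>?V\<^esub>} \<and>
        v = (\<Oplus>\<^bsub>?V\<^esub> i\<in>{i. f' i \<noteq> \<zero>\<^bsub>?V\<^esub>}. f' i)"
      then have "\<forall>i. \<exists>x. x \<in> G i \<and> f' i = h x" by blast
      then obtain e where e: "\<And>i. e i \<in> G i" "\<And>i. f' i = h (e i)" by metis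
      have fe: "f' = (\<lambda>i. h (e i))" using e(2) by blast
      have eG: "\<forall>i. e i \<in> G i" using e(1) by blast
      have fin: "finite {i. e i \<noteq> \<zero>\<^bsub>U\<^esub>}" using f' unfolding fe tr[OF eG] by blast
      have "h u = h (\<Oplus>\<^bsub>U\<^esub> i\<in>{i. e i \<noteq> \<zero>\<^bsub>U\<^esub>}. e i)"
        using f' unfolding fe tr[OF eG] su[OF eG fin] u(2) by blast
      moreover have "(\<Oplus>\<^bsub>U\<^esub> i\<in>{i. e i \<noteq> \<zero>\<^bsub>U\<^esub>}. e i) \<in> carrier U"
        by (rule abelian_monoid.finsum_closed[OF Um]) (use e GU in auto)
      ultimately have "u = (\<Oplus>\<^bsub>U\<^esub> i\<in>{i. e i \<noteq> \<zero>\<^bsub>U\<^esub>}. e i)" 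
        by (rule inj_onD[OF i _ u(1)])
      then have "e = f" using ex1E[OF ex[OF u(1)]] eG fin f by metis
      then show "f' = (\<lambda>i. h (f i))" using fe by simp
    qed
  qed
  moreover have "module (poly_ring N) ?V" by (rule N.module_axioms)
  ultimately show ?thesis unfolding graded_module_def by blast
qed

lemma fin_gen_transport:
  assumes m: "module (poly_ring N) U" and g: "fin_gen N U" and i: "inj_on h (carrier U)"
  shows "fin_gen N (transport h U)"
proof -
  obtain A where A: "finite A" "A \<subseteq> carrier U" "LinearCombinations.module.span (poly_ring N) U A = carrier U"
    using g by (auto simp: fin_gen_def)
  then show ?thesis
    unfolding fin_gen_def
    using mod_hom_span[OF transport_mod_hom[OF m i] i A(2)] by (intro exI[of _ "h ` A"]) auto
qed

lemma Const_homog: "Const c \<in> homog_part N 0"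
  by (auto simp: homog_part_def poly_ring_def Const_def mono_deg_def)

lemma hilbert_transport:
  assumes g: "graded_module N U G" and i: "inj_on h (carrier U)"
  shows "hilbert_series (transport h U) (\<lambda>i. h ` G i) = hilbert_series U G"
proof -
  let ?V = "transport h U"
  have m: "module (poly_ring N) U" and sub: "\<And>i. subgroup (G i) (add_monoid U)"
    and sm: "\<And>d i s u. s \<in> homog_part N d \<Longrightarrow> u \<in> G i \<Longrightarrow> s \<odot>\<^bsub>U\<^esub> u \<in> G (d + i)"
    using g by (auto simp: graded_module_def)
  have g': "graded_module N ?V (\<lambda>i. h ` G i)" by (rule graded_transport[OF g i])
  have m': "module (poly_ring N) ?V" and sub': "\<And>i. subgroup (h ` G i) (add_monoid ?V)"
    and sm': "\<And>d i s u. s \<in> homog_part N d \<Longrightarrow> u \<in> h ` G i \<Longrightarrow> s \<odot>\<^bsub>?V\<^esub> u \<in> h ` G (d + i)"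
    using g' unfolding graded_module_def by blast+
  interpret mod_hom "poly_ring N" U ?V h by (rule transport_mod_hom[OF m i])
  have GU: "G j \<subseteq> carrier U" for j using subgroup.subset[OF sub[of j]] by auto
  have C: "Const c \<in> carrier (poly_ring N)" for c using Const_homog[of c N] by (simp add: homog_part_def)
  have "VectorSpace.vectorspace.dim field_ring (component_space U (G j)) =
        VectorSpace.vectorspace.dim field_ring (component_space ?V (h ` G j))" for j
  proof (rule dim_iso[OF field_field_ring])
    have "module field_ring (component_space U (G j))"
      using module_component_space[OF m sub] sm[OF Const_homog, of _ j] by simp
    moreover have "module field_ring (component_space ?V (h ` G j))"
      using module_component_space[OF m' sub'] sm'[OF Const_homog, of _ j] by simp
    moreover have "h \<in> module_hom field_ring (component_space U (G j)) (component_space ?V (h ` G j))"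
      using GU[of j] f_smult[OF C] by (auto simp: module_hom_def component_space_def subset_iff)
    ultimately show "mod_hom field_ring (component_space U (G j)) (component_space ?V (h ` G j)) h"
      by (intro mod_hom.intro mod_hom_axioms.intro)
    show "inj_on h (carrier (component_space U (G j)))"
      using inj_on_subset[OF i GU] by (simp add: component_space_def)
  qed (simp add: component_space_def)
  then show ?thesis by (simp add: hilbert_series_def)
qed

lemma ideal_times_transport:
  assumes m: "module (poly_ring N) U" and i: "inj_on h (carrier U)" and F: "F \<subseteq> carrier (poly_ring N)"
  shows "ideal_times N F (transport h U) = h ` ideal_times N F U"
proof -
  interpret mod_hom "poly_ring N" U "transport h U" h by (rule transport_mod_hom[OF m i])
  have "{f \<odot>\<^bsub>transport h U\<^esub> v |f v. f \<in> F \<and> v \<in> carrier (transport h U)}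
      = h ` {f \<odot>\<^bsub>U\<^esub> u |f u. f \<in> F \<and> u \<in> carrier U}" (is "?A = ?B")
  proof (intro equalityI subsetI)
    fix x assume "x \<in> ?A"
    then obtain f u where "f \<in> F" "u \<in> carrier U" "x = f \<odot>\<^bsub>transport h U\<^esub> h u" by auto
    then show "x \<in> ?B" using f_smult[of f u] F by (auto intro!: image_eqI[of _ _ "f \<odot>\<^bsub>U\<^esub> u"])
  next
    fix x assume "x \<in> ?B"
    then obtain f u where "f \<in> F" "u \<in> carrier U" "x = h (f \<odot>\<^bsub>U\<^esub> u)" by auto
    moreover from this have "x = f \<odot>\<^bsub>transport h U\<^esub> h u" using f_smult[of f u] F by blast
    ultimately show "x \<in> ?A" by force
  qed
  moreover have "{f \<odot>\<^bsub>U\<^esub> u |f u. f \<in> F \<and> u \<in> carrier U} \<subseteq> carrier U" using F by auto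
  ultimately show ?thesis
    unfolding ideal_times_def using mod_hom_span[OF transport_mod_hom[OF m i] i] by simp
qed

lemma ideal_times_subset:
  assumes m: "module (poly_ring N) U" and F: "F \<subseteq> carrier (poly_ring N)"
  shows "ideal_times N F U \<subseteq> carrier U"
proof -
  interpret module "poly_ring N" U by fact
  show ?thesis unfolding ideal_times_def by (rule span_is_subset2) (use F in auto)
qed

lemma depth_transport:
  assumes m: "module (poly_ring N) U" and i: "inj_on h (carrier U)"
  shows "depth N (transport h U) = depth N U"
proof -
  interpret mod_hom "poly_ring N" U "transport h U" h by (rule transport_mod_hom[OF m i])
  have "regular_sequence N (transport h U) fs \<longleftrightarrow> regular_sequence N U fs" for fs
  proof (cases "set fs \<subseteq> carrier (poly_ring N)")
    case True
    have tk: "set (take k fs) \<subseteq> carrier (poly_ring N)" for k using True set_take_subset[of k fs] by blast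
    have mem: "h u \<in> ideal_times N (set (take k fs)) (transport h U) \<longleftrightarrow> u \<in> ideal_times N (set (take k fs)) U"
      if "u \<in> carrier U" for u k
      using ideal_times_transport[OF m i tk] inj_on_image_mem_iff[OF i that ideal_times_subset[OF m tk]] by simp
    have nc: "fs ! k \<in> carrier (poly_ring N)" if "k < length fs" for k
      using subsetD[OF True nth_mem[OF that]] .
    have sm: "fs ! k \<odot>\<^bsub>transport h U\<^esub> h u = h (fs ! k \<odot>\<^bsub>U\<^esub> u)" if "u \<in> carrier U" "k < length fs" for k u
      using f_smult[OF nc[OF that(2)] that(1)] by simp
    have cl: "fs ! k \<odot>\<^bsub>U\<^esub> u \<in> carrier U" if "u \<in> carrier U" "k < length fs" for k u
      using M.smult_closed[OF nc[OF that(2)] that(1)] .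
    have "ideal_times N (set fs) (transport h U) = carrier (transport h U) \<longleftrightarrow>
       ideal_times N (set fs) U = carrier U"
      using ideal_times_transport[OF m i True] inj_on_image_eq_iff[OF i ideal_times_subset[OF m True] order_refl]
      by simp
    then show ?thesis
      unfolding regular_sequence_def using True by (simp add: mem sm cl)
  next
    case False then show ?thesis by (simp add: regular_sequence_def)
  qed
  then show ?thesis by (simp add: depth_def)
qed

lemma fin_gen_inj:
  fixes U :: "('k::field mpoly, 'u) module"
  assumes m: "module (poly_ring N) U" and g: "fin_gen N U"
  shows "\<exists>h :: 'u \<Rightarrow> (nat \<Rightarrow> 'k mpoly) set. inj_on h (carrier U)"
proof -
  interpret module "poly_ring N" U by fact
  obtain A where A: "finite A" "A \<subseteq> carrier U" "span A = carrier U"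
    using g by (auto simp: fin_gen_def)
  obtain e :: "'u \<Rightarrow> nat" where e: "inj_on e A" 
    using finite_imp_inj_to_nat_seg[OF A(1)] by (elim exE conjE)
  define P where "P x c \<longleftrightarrow> x = lincomb (\<lambda>v. c (e v)) A" for x c
  have ex: "\<exists>c. P x c" if xU: "x \<in> carrier U" for x
  proof -
    obtain a where a: "a \<in> A \<rightarrow> carrier (poly_ring N)" "lincomb a A = x"
      using finite_in_span[OF A(1,2) xU[folded A(3)]] by (elim exE conjE)
    have "lincomb (\<lambda>v. a (inv_into A e (e v))) A = lincomb a A"
      unfolding lincomb_def
    proof (rule M.finsum_cong')
      show "(\<lambda>v. a v \<odot>\<^bsub>U\<^esub> v) \<in> A \<rightarrow> carrier U" using a(1) A(2) by auto
      show "a (inv_into A e (e v)) \<odot>\<^bsub>U\<^esub> v = a v \<odot>\<^bsub>U\<^esub> v" if "v \<in> A" for v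
        by (simp only: inv_into_f_f[OF e that])
    qed (rule refl)
    then have "P x (\<lambda>i. a (inv_into A e i))" unfolding P_def a(2) by (rule sym)
    then show ?thesis by (rule exI[of "P x"])
  qed
  have "inj_on (\<lambda>x. {SOME c. P x c}) (carrier U)"
  proof (rule inj_onI)
    fix x y assume x: "x \<in> carrier U" and y: "y \<in> carrier U" and "{SOME c. P x c} = {SOME c. P y c}"
    then have eq: "(SOME c. P x c) = (SOME c. P y c)" by simp
    have "P x (SOME c. P x c)" by (rule someI_ex[OF ex[OF x]])
    moreover have "P y (SOME c. P x c)" unfolding eq by (rule someI_ex[OF ex[OF y]])
    ultimately show "x = y" unfolding P_def by (rule trans[OF _ sym])
  qed
  then show ?thesis by blast
qed

theorem depth_le_hdepth:
  fixes U :: "('k::field mpoly, 'u) module" and M :: "('k mpoly, 'm) module"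
  assumes g: "graded_module N U G" and f: "fin_gen N U"
    and H: "hilbert_series U G = hilbert_series M H"
  shows "depth N U \<le> hdepth N M H"
proof -
  have m: "module (poly_ring N) U" using g by (simp add: graded_module_def)
  obtain h :: "'u \<Rightarrow> (nat \<Rightarrow> 'k mpoly) set" where i: "inj_on h (carrier U)"
    using fin_gen_inj[OF m f] by blast
  have "graded_module N (transport h U) (\<lambda>i. h ` G i) \<and> fin_gen N (transport h U) \<and>
      hilbert_series (transport h U) (\<lambda>i. h ` G i) = hilbert_series M H"
    using graded_transport[OF g i] fin_gen_transport[OF m f i] hilbert_transport[OF g i] H by simp
  then have "depth N (transport h U) \<le> hdepth N M H"
    unfolding hdepth_def
    by (intro Sup_upper CollectI exI[of _ "transport h U"] exI[of _ "\<lambda>i. h ` G i"] conjI[OF refl])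
  then show ?thesis by (simp add: depth_transport[OF m i])
qed


section \<open>The module \<open>S/I\<close> and the ideal \<open>I\<^sub>n\<^sub>,\<^sub>r\<close>\<close>

definition quotient_module ::
  "nat \<Rightarrow> 'k::field mpoly set \<Rightarrow> ('k mpoly, 'k mpoly set) module" where
  "quotient_module N I =
     (let Q = poly_ring N Quot I in
      \<lparr>carrier = carrier Q, mult = mult Q, one = one Q, zero = zero Q, add = add Q,
       smult = (\<lambda>s X. (I +>\<^bsub>poly_ring N\<^esub> s) \<otimes>\<^bsub>Q\<^esub> X)\<rparr>)"

definition quotient_grading ::
  "nat \<Rightarrow> 'k::field mpoly set \<Rightarrow> int \<Rightarrow> 'k mpoly set set" where
  "quotient_grading N I d = (\<lambda>s. I +>\<^bsub>poly_ring N\<^esub> s) ` homog_part N d"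

definition I_nr :: "nat \<Rightarrow> nat \<Rightarrow> 'k::field mpoly set" where
  "I_nr n r = Idl\<^bsub>poly_ring (n + r - 1)\<^esub>
     ((\<lambda>i. (\<Prod>j\<in>{1..r - 1}. Var j) * Var i) ` {r..r + n - 1})"

end

theory Submission
  imports Defs "HOL-Library.Function_Algebras"
begin

text \<open>Write \<open>N = n + r - 1\<close>. The Hilbert series of \<open>S/I\<close> is
  \<open>(1 - t\<^sup>r\<^sup>-\<^sup>1 + t\<^sup>r\<^sup>-\<^sup>1 (1 - t)\<^sup>n) / (1 - t)\<^sup>N\<close>.

  Lower bound: the hypothesis on \<open>r\<close> says that its product with \<open>(1 - t)\<^sup>N\<^sup>-\<^sup>2\<close> has nonnegative
  coefficients, which are eventually constant. So it is the Hilbert series of a direct sum of shifted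
  copies of \<open>K[x\<^sub>1,\<dots>,x\<^sub>N\<^sub>-\<^sub>2]\<close> and \<open>K[x\<^sub>1,\<dots>,x\<^sub>N\<^sub>-\<^sub>1]\<close>, on which
  \<open>x\<^sub>1,\<dots>,x\<^sub>N\<^sub>-\<^sub>2\<close> is regular.

  Upper bound: let \<open>U\<close> have the same Hilbert series and a regular sequence of length \<open>N - 1\<close>, not
  necessarily homogeneous. Write \<open>U = F/Z\<close> with \<open>F\<close> free. An element of the maximal ideal acts
  null-homotopically on the Koszul complex of \<open>x\<^sub>1,\<dots>,x\<^sub>N\<close>, so each element of a regular sequence
  kills one Koszul homology group from the top, leaving \<open>H\<^sub>2(U) = 0\<close>; hence \<open>H\<^sub>1(Z) = 0\<close>
  and \<open>Z\<close> is free. The generators of \<open>Z\<close> of degree at most \<open>r\<close> are then independent in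
  the part of \<open>F\<close> generated in degrees at most \<open>r\<close>, so there are no more of them than
  generators of \<open>F\<close>: the coefficient of \<open>t\<^sup>r\<close> in \<open>(1 - t)\<^sup>N\<^sup>-\<^sup>1\<close> times the Hilbert
  series is nonnegative. But it equals \<open>1 - n\<close>.\<close>

text \<open>The bound on \<open>r\<close> controls signs. In degrees \<open>s\<close> to
  \<open>s + m\<close> the coefficients of the lower bound are \<open>s\<close> plus signed
  binomials of \<open>m\<close>; the central binomial is the largest, so \<open>s = r - 1\<close>
  dominating it keeps them all nonnegative. The extra variable of the last summands comes from the
  constant tail: \<open>s t^k + s t^(k+1) + ...\<close> is \<open>s t^k / (1 - t)\<close>. The
  obstacle in the upper bound is that a regular sequence need not be homogeneous, so the Hilbert
  series cannot be divided by \<open>1 - t\<close> one element at a time. Koszul homology of the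
  variables uses the sequence only to force vanishing and leaves the gradings of \<open>F\<close>
  and \<open>Z\<close> alone. Up to degree \<open>r\<close>, the series times
  \<open>(1 - t)^N\<close> is then the difference of the generating polynomials of the degrees of
  the generators of \<open>F\<close> and of \<open>Z\<close>, and one division by
  \<open>1 - t\<close> turns it into a difference of two numbers of generators. Degree
  \<open>r\<close> is the first one to give a contradiction: in
  \<open>(1 - t^(r-1)) / (1 - t) + t^(r-1) (1 - t)^(n-1)\<close> the first summand has no term of
  degree \<open>r\<close>, and the second contributes its linear coefficient
  \<open>1 - n\<close>.\<close>

declare One_nat_def [simp del]

abbreviation "keys \<equiv> Poly_Mapping.keys"
abbreviation "lookup \<equiv> Poly_Mapping.lookup"
abbreviation "single \<equiv> Poly_Mapping.single"
abbreviation "polys N \<equiv> carrier (poly_ring N)"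
abbreviation "comp_dim U V \<equiv> VectorSpace.vectorspace.dim field_ring (component_space U V)"

section \<open>Monomials and polynomials\<close>

text \<open>The degree is an integer so that shifted degrees \<open>k - \<delta> i\<close> can be
  inserted without case distinctions; negative ones give the empty set.\<close>

definition mons :: "nat \<Rightarrow> int \<Rightarrow> (nat \<Rightarrow>\<^sub>0 nat) set" where
  "mons N k = {m. keys m \<subseteq> {1..N} \<and> int (mono_deg m) = k}"

lemma keys_add_nat: "keys (a + b) = keys a \<union> keys b"
  for a b :: "nat \<Rightarrow>\<^sub>0 nat"
  by (auto simp: in_keys_iff lookup_add)

lemma mono_deg_superset:
  assumes "finite A" "keys m \<subseteq> A"
  shows "mono_deg m = (\<Sum>i\<in>A. lookup m i)"
  unfolding mono_deg_def using assms
  by (intro sum.mono_neutral_left) (auto simp: in_keys_iff)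

lemma mono_deg_add [simp]: "mono_deg (a + b) = mono_deg a + mono_deg b"
proof -
  let ?A = "keys a \<union> keys b"
  have "mono_deg (a + b) = (\<Sum>i\<in>?A. lookup (a + b) i)"
    by (rule mono_deg_superset) (auto simp: keys_add_nat)
  also have "\<dots> = mono_deg a + mono_deg b"
    using mono_deg_superset[of ?A a] mono_deg_superset[of ?A b]
    by (simp add: lookup_add sum.distrib)
  finally show ?thesis .
qed

lemma mono_deg_zero [simp]: "mono_deg 0 = 0"
  by (simp add: mono_deg_def)

lemma mono_deg_single [simp]: "mono_deg (single j k) = k"
  by (simp add: mono_deg_def)

lemma mono_deg_eq_0: "mono_deg m = 0 \<longleftrightarrow> m = 0"
  unfolding mono_deg_def
  by (auto simp: poly_mapping_eq_iff fun_eq_iff in_keys_iff)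

lemma single_add_diff:
  fixes m :: "nat \<Rightarrow>\<^sub>0 nat"
  assumes "j \<in> keys m"
  shows "single j 1 + (m - single j 1) = m"
  using assms
  by (intro poly_mapping_eqI) (auto simp: lookup_add lookup_minus lookup_single in_keys_iff when_def)

lemma mons_neg: "k < 0 \<Longrightarrow> mons N k = {}"
  by (auto simp: mons_def)

lemma mons_0: "mons N 0 = {0}"
  by (auto simp: mons_def mono_deg_eq_0)

lemma mons_0_left: "mons 0 k = (if k = 0 then {0} else {})"
  by (auto simp: mons_def)

text \<open>Monomials are sorted by whether the last variable occurs, in which case it is divided
  out. Counting both classes is what multiplication of the series by \<open>1 - t\<close>
  expresses.\<close>

lemma mons_Suc: "mons (Suc N) k = mons N k \<union> (+) (single (Suc N) 1) ` mons (Suc N) (k - 1)"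
proof (intro equalityI subsetI)
  fix m assume m: "m \<in> mons (Suc N) k"
  show "m \<in> mons N k \<union> (+) (single (Suc N) 1) ` mons (Suc N) (k - 1)"
  proof (cases "Suc N \<in> keys m")
    case True
    have eq: "m = single (Suc N) 1 + (m - single (Suc N) 1)"
      by (simp only: single_add_diff[OF True])
    then have "keys (m - single (Suc N) 1) \<subseteq> keys m"
      "mono_deg m = 1 + mono_deg (m - single (Suc N) 1)"
      by (metis keys_add_nat Un_upper2, metis mono_deg_add mono_deg_single)
    then have "m - single (Suc N) 1 \<in> mons (Suc N) (k - 1)"
      using m by (auto simp: mons_def)
    then show ?thesis using eq by blast
  next
    case False
    then show ?thesis using m by (fastforce simp: mons_def atLeastAtMostSuc_conv)
  qed
qed (force simp: mons_def keys_add_nat)+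

lemma mons_Suc_disjoint: "mons N k \<inter> (+) (single (Suc N) 1) ` A = {}"
  by (fastforce simp: mons_def keys_add_nat)

lemma finite_mons [simp]: "finite (mons N k)"
proof (induction N arbitrary: k)
  case (Suc N)
  note IH = Suc.IH
  have "finite (mons (Suc N) (int j))" for j
  proof (induction j)
    case (Suc j)
    then show ?case using IH by (subst mons_Suc) simp
  qed (simp add: mons_0)
  then show ?case using mons_neg[of k "Suc N"] by (cases k) (auto simp: mons_neg)
qed (simp add: mons_0_left)

lemma card_mons_Suc: "card (mons (Suc N) k) = card (mons N k) + card (mons (Suc N) (k - 1))"
proof -
  have "card (mons (Suc N) k) =
      card (mons N k) + card ((+) (single (Suc N) 1) ` mons (Suc N) (k - 1))"
    by (subst mons_Suc, rule card_Un_disjoint) (rule finite_mons finite_imageI mons_Suc_disjoint)+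
  then show ?thesis by (simp add: card_image)
qed

text \<open>This is \<open>1 / (1 - t)^N\<close>, the Hilbert series of a polynomial ring in
  \<open>N\<close> variables. It is handled without inverses: factors \<open>1 - t\<close> lower the
  number of variables.\<close>

definition mons_fps :: "nat \<Rightarrow> int fps" where
  "mons_fps N = Abs_fps (\<lambda>k. int (card (mons N (int k))))"

lemma mons_fps_nth [simp]: "fps_nth (mons_fps N) k = int (card (mons N (int k)))"
  by (simp add: mons_fps_def)

lemma mons_fps_Suc: "mons_fps (Suc N) * (1 - fps_X) = mons_fps N"
proof (rule fps_ext)
  fix k
  show "fps_nth (mons_fps (Suc N) * (1 - fps_X)) k = fps_nth (mons_fps N) k"
    using card_mons_Suc[of N "int k"]
    by (cases k) (simp_all add: algebra_simps mons_neg)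
qed

lemma mons_fps_power: "mons_fps (N + j) * (1 - fps_X) ^ j = mons_fps N"
  by (induction j arbitrary: N)
     (simp_all, metis (no_types, opaque_lifting) add_Suc mons_fps_Suc mult.assoc mult.commute)

lemma mons_fps_0: "mons_fps 0 = 1"
  by (rule fps_ext) (simp add: mons_0_left)

lemma card_mons_le: "card (mons N (int k)) \<le> (k + 1) ^ N"
proof (induction N arbitrary: k)
  case (Suc N)
  note IH = Suc.IH
  \<comment> \<open>With \<open>k\<close> fixed, each of the \<open>j + 1\<close> steps of the
    recursion on the degree adds a count in \<open>N\<close> variables, at most
    \<open>(k + 1) ^ N\<close>.\<close>
  have "card (mons (Suc N) (int j)) \<le> (j + 1) * (k + 1) ^ N" if "j \<le> k" for j
    using that
  proof (induction j)
    case (Suc j)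
    have "card (mons N (int (Suc j))) \<le> (Suc j + 1) ^ N" by (rule IH)
    also have "\<dots> \<le> (k + 1) ^ N" using Suc.prems by (intro power_mono) auto
    finally have "card (mons N (int (Suc j))) \<le> (k + 1) ^ N" .
    then show ?case using Suc.IH Suc.prems card_mons_Suc[of N "int (Suc j)"] by simp
  qed (use mons_0[of "Suc N"] in simp)
  from this[of k] show ?case by simp
qed (simp add: mons_0_left)

section \<open>Polynomial rings as carriers, and restriction of a polynomial to a set of
  monomials\<close>

lemma poly_ring_simps [simp]:
  "mult (poly_ring N) = (*)" "add (poly_ring N) = (+)" "one (poly_ring N) = 1" "zero (poly_ring N) = 0"
  by (simp_all add: poly_ring_def)

lemma field_ring_simps [simp]:
  "mult field_ring = (*)" "add field_ring = (+)" "one field_ring = 1" "zero field_ring = 0"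
  "carrier field_ring = UNIV"
  by (simp_all add: field_ring_def)

lemma mem_poly_ring:
  "p \<in> polys N \<longleftrightarrow> (\<forall>m\<in>keys p. keys m \<subseteq> {1..N})"
  by (simp add: poly_ring_def)

lemma poly_ring_closed [simp, intro]:
  "p \<in> polys N \<Longrightarrow> q \<in> polys N \<Longrightarrow> p + q \<in> polys N"
  "p \<in> polys N \<Longrightarrow> q \<in> polys N \<Longrightarrow> p * q \<in> polys N"
  "0 \<in> polys N" "1 \<in> polys N"
  "p \<in> polys N \<Longrightarrow> - p \<in> polys N"
  "Const c \<in> polys N"
  for p q :: "'k::field mpoly"
proof -
  interpret cring "poly_ring N :: 'k mpoly ring" by (rule cring_poly_ring)
  show "p \<in> polys N \<Longrightarrow> q \<in> polys N \<Longrightarrow> p + q \<in> polys N"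
    using add.m_closed[of p q] by simp
  show "p \<in> polys N \<Longrightarrow> q \<in> polys N \<Longrightarrow> p * q \<in> polys N"
    using m_closed[of p q] by simp
qed (auto simp: mem_poly_ring Const_def)

lemma Var_in_poly_ring [simp]: "1 \<le> j \<Longrightarrow> j \<le> N \<Longrightarrow> Var j \<in> polys N"
  by (simp add: mem_poly_ring Var_def)

lemma poly_ring_mono: "p \<in> polys N \<Longrightarrow> N \<le> M \<Longrightarrow> p \<in> polys M"
  by (fastforce simp: mem_poly_ring)

lemma poly_ring_sum [intro]:
  "(\<And>i. i \<in> A \<Longrightarrow> f i \<in> polys N) \<Longrightarrow> (\<Sum>i\<in>A. f i) \<in> polys N"
  by (induction A rule: infinite_finite_induct) auto

lemma poly_sum_monomials:
  "p = (\<Sum>m\<in>keys p. single m (lookup p m))"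
  by (rule poly_mapping_eqI) (auto simp: lookup_sum lookup_single in_keys_iff when_def)

lemma lookup_single_mult_add:
  "lookup (single t c * p) (t + m) = c * lookup p m"
  for p :: "'k::field mpoly"
  by (simp add: lookup_mult lookup_single when_mult)

lemma lookup_single_mult_other:
  fixes p :: "'k::field mpoly"
  assumes "\<And>m. s \<noteq> t + m"
  shows "lookup (single t c * p) s = 0"
  using assms by (simp add: lookup_mult lookup_single when_mult)

lemma lookup_Const_mult [simp]:
  "lookup (Const c * p) m = c * lookup p m"
  using lookup_single_mult_add[of 0 c p m] by (simp add: Const_def)

lemma keys_single_mult:
  "keys (single t c * p) \<subseteq> (+) t ` keys p"
  for p :: "'k::field mpoly"
  using keys_mult[of "single t c" p] by (auto split: if_splits)

lemma Const_add: "Const (a + b) = Const a + Const b"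
  by (simp add: Const_def single_add)

lemma Const_mult: "Const (a * b) = Const a * Const b"
  by (simp add: Const_def mult_single)

lemma Const_1 [simp]: "Const 1 = 1"
  by (simp add: Const_def)

lemma Const_0 [simp]: "Const 0 = 0"
  by (simp add: Const_def)

lemma Const_uminus: "Const (- a) = - Const a"
  by (simp add: Const_def single_uminus)

text \<open>One operation covers homogeneous parts, reduction modulo variables, and splitting off
  the terms divisible by a given variable, depending on \<open>P\<close>.\<close>

definition restr :: "('a \<Rightarrow> bool) \<Rightarrow> ('a \<Rightarrow>\<^sub>0 'b::zero) \<Rightarrow> ('a \<Rightarrow>\<^sub>0 'b)" where
  "restr P p = Poly_Mapping.mapp (\<lambda>m c. if P m then c else 0) p"

lemma lookup_restr [simp]:
  "lookup (restr P p) m = (if P m then lookup p m else 0)"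
  by (auto simp: restr_def lookup_mapp when_def in_keys_iff)

lemma keys_restr [simp]: "keys (restr P p) = {m \<in> keys p. P m}"
  by (auto simp: in_keys_iff split: if_splits)

lemma restr_add: "restr P (p + q) = restr P p + restr P q" for p :: "'a \<Rightarrow>\<^sub>0 'b::monoid_add"
  by (rule poly_mapping_eqI) (simp add: lookup_add)

lemma restr_0 [simp]: "restr P 0 = 0"
  by (rule poly_mapping_eqI) simp

lemma restr_sum: "restr P (\<Sum>i\<in>A. f i) = (\<Sum>i\<in>A. restr P (f i))"
  for f :: "_ \<Rightarrow> 'a \<Rightarrow>\<^sub>0 'b::comm_monoid_add"
  by (induction A rule: infinite_finite_induct) (auto simp: restr_add)

lemma restr_idem: "(\<And>m. m \<in> keys p \<Longrightarrow> P m) \<Longrightarrow> restr P p = p"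
  by (rule poly_mapping_eqI) (auto simp: in_keys_iff)

lemma restr_single: "restr P (single t c) = (if P t then single t c else 0)"
  by (rule poly_mapping_eqI) (simp add: lookup_single when_def)

lemma restr_split: "p = restr P p + restr (\<lambda>m. \<not> P m) p" for p :: "'a \<Rightarrow>\<^sub>0 'b::monoid_add"
  by (rule poly_mapping_eqI) (simp add: lookup_add)

lemma restr_single_mult:
  "restr P (single t c * p) = single t c * restr (\<lambda>m. P (t + m)) p"
  for p :: "'k::field mpoly"
proof (rule poly_mapping_eqI)
  fix s
  show "lookup (restr P (single t c * p)) s =
      lookup (single t c * restr (\<lambda>m. P (t + m)) p) s"
    by (cases "\<exists>m. s = t + m") (auto simp: lookup_single_mult_add lookup_single_mult_other)
qed

text \<open>Such a restriction is the projection of the polynomial ring modulo some of the variables.\<close>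

lemma restr_mult:
  fixes p q :: "'k::field mpoly"
  assumes P: "\<And>a b. P (a + b) \<longleftrightarrow> P a \<and> P b"
  shows "restr P (p * q) = restr P p * restr P q"
proof -
  have s: "restr P (single t c * q) = restr P (single t c) * restr P q" for t c
    by (cases "P t") (auto simp: restr_single_mult restr_single P intro!: poly_mapping_eqI)
  have "p * q = (\<Sum>m\<in>keys p. single m (lookup p m) * q)"
    using arg_cong[OF poly_sum_monomials, of "\<lambda>p. p * q" p] by (simp add: sum_distrib_right)
  then have "restr P (p * q) =
      restr P (\<Sum>m\<in>keys p. single m (lookup p m)) * restr P q"
    by (simp add: restr_sum s sum_distrib_right)
  then show ?thesis by (simp add: poly_sum_monomials[symmetric])
qed

text \<open>The second property transfers support conditions from \<open>p\<close> to the quotient,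
  for instance which variables may occur.\<close>

lemma divide_Var:
  fixes p :: "'k::field mpoly"
  assumes "\<And>m. m \<in> keys p \<Longrightarrow> j \<in> keys m"
  obtains q where "p = Var j * q"
    "\<And>m. m \<in> keys q \<Longrightarrow> single j 1 + m \<in> keys p"
proof -
  let ?x = "single j (1::nat)"
  define q where "q = (\<Sum>m\<in>keys p. single (m - ?x) (lookup p m))"
  have "Var j * q = (\<Sum>m\<in>keys p. single m (lookup p m))"
    unfolding q_def sum_distrib_left
    by (intro sum.cong refl)
      (simp only: Var_def mult_single mult_1 single_add_diff[OF assms])
  then have p: "p = Var j * q" by (simp add: poly_sum_monomials[symmetric])
  have "?x + m \<in> keys p" if "m \<in> keys q" for m
    using that lookup_single_mult_add[of ?x 1 q m] by (simp add: p Var_def in_keys_iff)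
  then show ?thesis using that p by blast
qed

section \<open>Koszul homology\<close>

text \<open>Terms are cancelled in pairs, by induction on the index set. Deducing the claim from the
  sum being its own negative would fail in characteristic 2.\<close>

lemma sum_antisymmetric_eq_0:
  fixes T :: "'i \<Rightarrow> 'i \<Rightarrow> 'b::ab_group_add"
  assumes "finite S" "\<And>j l. j \<in> S \<Longrightarrow> l \<in> S \<Longrightarrow> j \<noteq> l \<Longrightarrow> T j l = - T l j"
  shows "(\<Sum>j\<in>S. \<Sum>l\<in>S - {j}. T j l) = 0"
  using assms
proof (induction S rule: finite_induct)
  case (insert a S)
  have 1: "(\<Sum>l\<in>insert a S - {j}. T j l) = T j a + (\<Sum>l\<in>S - {j}. T j l)" if "j \<in> S" for j
  proof -
    have "insert a S - {j} = insert a (S - {j})" using that insert.hyps by auto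
    then show ?thesis using insert.hyps by simp
  qed
  have "(\<Sum>j\<in>insert a S. \<Sum>l\<in>insert a S - {j}. T j l) =
      (\<Sum>l\<in>S. T a l) + ((\<Sum>j\<in>S. T j a) + (\<Sum>j\<in>S. \<Sum>l\<in>S - {j}. T j l))"
    using insert.hyps by (simp add: 1 sum.distrib cong: sum.cong)
  also have "(\<Sum>j\<in>S. \<Sum>l\<in>S - {j}. T j l) = 0"
    using insert.prems by (intro insert.IH) (blast intro: insertI2)
  also have "(\<Sum>j\<in>S. T j a) = (\<Sum>j\<in>S. - T a j)"
    using insert.hyps by (intro sum.cong refl insert.prems) auto
  finally show ?case by (simp add: sum_negf)
qed simp

text \<open>The sign picked up when the basis vector of \<open>j\<close> is moved from the front of
  an exterior product to its place among those of \<open>A\<close>.\<close>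

definition koszul_sign :: "nat \<Rightarrow> nat set \<Rightarrow> 'a::comm_ring_1" where
  "koszul_sign j A = (-1) ^ card {a \<in> A. a < j}"

lemma koszul_sign_insert:
  assumes "finite A" "l \<notin> A"
  shows "koszul_sign j (insert l A) = (if l < j then - koszul_sign j A else koszul_sign j A)"
proof -
  have "{a \<in> insert l A. a < j} = (if l < j then insert l {a \<in> A. a < j} else {a \<in> A. a < j})"
    by auto
  then show ?thesis using assms by (simp add: koszul_sign_def)
qed

lemma koszul_sign_remove:
  assumes "finite A" "l \<in> A"
  shows "(koszul_sign j (A - {l}) :: 'a::comm_ring_1) = (if l < j then - koszul_sign j A else koszul_sign j A)"
  using koszul_sign_insert[of "A - {l}" l j, where ?'a = 'a] assms by (simp add: insert_absorb)

lemma koszul_sign_square: "koszul_sign j A * koszul_sign j A = 1"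
  by (simp add: koszul_sign_def flip: power_mult_distrib)

text \<open>Chains of the Koszul complex on \<open>x\<^sub>1, \<dots>, x\<^sub>N\<close> are functions on the subsets of
  \<open>{1..N}\<close>; those of homological degree \<open>i\<close> are only looked at on sets of size \<open>i\<close>.\<close>

locale koszul = Modules.module scale
  for scale :: "'a::comm_ring_1 \<Rightarrow> 'b::ab_group_add \<Rightarrow> 'b" +
  fixes x :: "nat \<Rightarrow> 'a" and N :: nat and R :: "'a set"
  assumes R_mult: "a \<in> R \<Longrightarrow> b \<in> R \<Longrightarrow> a * b \<in> R"
    and R_one: "1 \<in> R" and R_uminus: "a \<in> R \<Longrightarrow> - a \<in> R"
    and x_R: "j \<in> {1..N} \<Longrightarrow> x j \<in> R"
begin

definition boundary :: "(nat set \<Rightarrow> 'b) \<Rightarrow> nat set \<Rightarrow> 'b" where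
  "boundary c A = (\<Sum>j\<in>{1..N} - A. scale (koszul_sign j A * x j) (c (insert j A)))"

text \<open>Exterior multiplication by the sum of the \<open>g j e_j\<close>, when
  \<open>c A\<close> is read as the coefficient of the basis element of \<open>A\<close>;
  \<open>boundary\<close> is then contraction with the \<open>x j\<close>.\<close>

definition homotopy :: "(nat \<Rightarrow> 'a) \<Rightarrow> (nat set \<Rightarrow> 'b) \<Rightarrow> nat set \<Rightarrow> 'b" where
  "homotopy g c A = (\<Sum>j\<in>A. scale (koszul_sign j A * g j) (c (A - {j})))"

text \<open>Scalars come from the subring \<open>R\<close> only: the scalar type holds polynomials
  in infinitely many variables, while submodules over \<open>K[x_1,...,x_N]\<close> are
  wanted.\<close>

definition submod :: "'b set \<Rightarrow> bool" where
  "submod D \<longleftrightarrow> 0 \<in> D \<and> (\<forall>u\<in>D. \<forall>v\<in>D. u + v \<in> D) \<and> (\<forall>s\<in>R. \<forall>u\<in>D. scale s u \<in> D)"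

lemma submodI:
  assumes "0 \<in> D" "\<And>u v. u \<in> D \<Longrightarrow> v \<in> D \<Longrightarrow> u + v \<in> D" "\<And>s u. s \<in> R \<Longrightarrow> u \<in> D \<Longrightarrow> scale s u \<in> D"
  shows "submod D"
  using assms by (auto simp: submod_def)

lemma submod_closed:
  assumes "submod D"
  shows "0 \<in> D" "u \<in> D \<Longrightarrow> v \<in> D \<Longrightarrow> u + v \<in> D" "s \<in> R \<Longrightarrow> u \<in> D \<Longrightarrow> scale s u \<in> D"
    "u \<in> D \<Longrightarrow> - u \<in> D" "u \<in> D \<Longrightarrow> v \<in> D \<Longrightarrow> u - v \<in> D"
proof -
  show n: "- u \<in> D" if "u \<in> D" for u
    using assms that R_uminus[OF R_one] unfolding submod_def by (metis scale_minus_left scale_one)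
  show "u - v \<in> D" if "u \<in> D" "v \<in> D"
    using assms that n[of v] unfolding submod_def by (metis diff_conv_add_uminus)
qed (use assms in \<open>auto simp: submod_def\<close>)

lemma submod_sum: "submod D \<Longrightarrow> (\<And>i. i \<in> I \<Longrightarrow> f i \<in> D) \<Longrightarrow> (\<Sum>i\<in>I. f i) \<in> D"
  by (induction I rule: infinite_finite_induct) (auto simp: submod_closed)

lemma koszul_sign_R: "koszul_sign j A \<in> R"
proof -
  have "(-1) ^ k \<in> R" for k
    by (induction k) (use R_one R_uminus R_mult in auto)
  then show ?thesis by (simp add: koszul_sign_def)
qed

lemma boundary_in:
  assumes "submod D" "\<And>j. j \<in> {1..N} - A \<Longrightarrow> c (insert j A) \<in> D"
  shows "boundary c A \<in> D"
  unfolding boundary_def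
  by (intro submod_sum submod_closed(3) R_mult koszul_sign_R x_R assms) auto

lemma homotopy_in:
  assumes "submod D" "\<And>j. j \<in> A \<Longrightarrow> c (A - {j}) \<in> D" "\<And>j. j \<in> A \<Longrightarrow> g j \<in> R"
  shows "homotopy g c A \<in> D"
  unfolding homotopy_def
  by (intro submod_sum submod_closed(3) R_mult koszul_sign_R assms) auto

text \<open>Adding \<open>j\<close> and then \<open>l\<close> reaches the same set as adding
  \<open>l\<close> and then \<open>j\<close>, with opposite sign, because inserting the smaller
  index flips the sign of the larger one.\<close>

lemma boundary_boundary:
  assumes A: "finite A"
  shows "boundary (boundary c) A = 0"
proof -
  define T where "T j l = scale (koszul_sign j A * x j * (koszul_sign l (insert j A) * x l))
    (c (insert l (insert j A)))" for j l
  have "boundary (boundary c) A = (\<Sum>j\<in>{1..N} - A. \<Sum>l\<in>({1..N} - A) - {j}. T j l)"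
    unfolding boundary_def scale_sum_right T_def scale_scale
    by (intro sum.cong) auto
  also have "\<dots> = 0"
  proof (rule sum_antisymmetric_eq_0)
    fix j l assume jl: "j \<in> {1..N} - A" "l \<in> {1..N} - A" "j \<noteq> l"
    have "koszul_sign j A * x j * (koszul_sign l (insert j A) * x l) =
        - (koszul_sign l A * x l * (koszul_sign j (insert l A) * x j))"
      using jl A by (auto simp: koszul_sign_insert mult_ac)
    then show "T j l = - T l j"
      by (simp add: T_def insert_commute)
  qed simp
  finally show ?thesis .
qed

text \<open>The terms that remove \<open>l\<close> and add a different \<open>j\<close> occur in
  both summands with opposite signs. What remains are the terms that return to \<open>A\<close>:
  they give \<open>g j * x j\<close> for \<open>j\<close> outside \<open>A\<close> in the first
  summand and for \<open>j\<close> in \<open>A\<close> in the second.\<close>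

lemma boundary_homotopy:
  assumes A: "A \<subseteq> {1..N}"
  shows "boundary (homotopy g c) A + homotopy g (boundary c) A = scale (\<Sum>j\<in>{1..N}. g j * x j) (c A)"
proof -
  have fA: "finite A" using A finite_subset by blast
  define P where "P j l = scale (koszul_sign j A * x j * (koszul_sign l (insert j A) * g l)) (c (insert j A - {l}))" for j l
  define Q where "Q l j = scale (koszul_sign l A * g l * (koszul_sign j (A - {l}) * x j)) (c (insert j (A - {l})))" for j l
  have P1: "(\<Sum>l\<in>insert j A. P j l) = scale (g j * x j) (c A) + (\<Sum>l\<in>A. P j l)" if "j \<in> {1..N} - A" for j
  proof -
    have "P j j = scale (koszul_sign j A * koszul_sign j A * (g j * x j)) (c A)"
      using that fA by (simp add: P_def koszul_sign_insert mult_ac)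
    then show ?thesis using that fA by (simp add: koszul_sign_square)
  qed
  have Q1: "(\<Sum>j\<in>{1..N} - (A - {l}). Q l j) = scale (g l * x l) (c A) + (\<Sum>j\<in>{1..N} - A. Q l j)" if "l \<in> A" for l
  proof -
    have "{1..N} - (A - {l}) = insert l ({1..N} - A)" using that A by auto
    moreover have "Q l l = scale (koszul_sign l A * koszul_sign l A * (g l * x l)) (c A)"
      using that fA by (simp add: Q_def koszul_sign_remove insert_absorb mult_ac)
    ultimately show ?thesis using that by (simp add: koszul_sign_square)
  qed
  have PQ: "P j l = - Q l j" if "j \<in> {1..N} - A" "l \<in> A" for j l
  proof -
    have "insert j A - {l} = insert j (A - {l})" using that by auto
    moreover have "koszul_sign j A * x j * (koszul_sign l (insert j A) * g l) =
        - (koszul_sign l A * g l * (koszul_sign j (A - {l}) * x j))"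
      using that fA by (auto simp: koszul_sign_insert koszul_sign_remove mult_ac)
    ultimately show ?thesis by (simp add: P_def Q_def)
  qed
  have "boundary (homotopy g c) A = (\<Sum>j\<in>{1..N} - A. \<Sum>l\<in>insert j A. P j l)"
    by (simp add: boundary_def homotopy_def scale_sum_right P_def)
  also have "\<dots> = (\<Sum>j\<in>{1..N} - A. scale (g j * x j) (c A)) + (\<Sum>j\<in>{1..N} - A. \<Sum>l\<in>A. P j l)"
    unfolding sum.distrib[symmetric] by (intro sum.cong refl P1)
  also have "(\<Sum>j\<in>{1..N} - A. \<Sum>l\<in>A. P j l) = - (\<Sum>l\<in>A. \<Sum>j\<in>{1..N} - A. Q l j)"
    unfolding sum.swap[of _ A] sum_negf[symmetric] by (intro sum.cong refl PQ)
  finally have b: "boundary (homotopy g c) A =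
      (\<Sum>j\<in>{1..N} - A. scale (g j * x j) (c A)) - (\<Sum>l\<in>A. \<Sum>j\<in>{1..N} - A. Q l j)"
    by simp
  have "homotopy g (boundary c) A = (\<Sum>l\<in>A. \<Sum>j\<in>{1..N} - (A - {l}). Q l j)"
    by (simp add: boundary_def homotopy_def scale_sum_right Q_def)
  also have "\<dots> = (\<Sum>l\<in>A. scale (g l * x l) (c A)) + (\<Sum>l\<in>A. \<Sum>j\<in>{1..N} - A. Q l j)"
    unfolding sum.distrib[symmetric] by (intro sum.cong refl Q1)
  finally have "boundary (homotopy g c) A + homotopy g (boundary c) A =
      (\<Sum>j\<in>{1..N} - A. scale (g j * x j) (c A)) + (\<Sum>j\<in>A. scale (g j * x j) (c A))"
    by (simp add: b)
  also have "\<dots> = (\<Sum>j\<in>{1..N}. scale (g j * x j) (c A))"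
    using sum.subset_diff[OF A, of "\<lambda>j. scale (g j * x j) (c A)"] by simp
  finally show ?thesis by (simp add: scale_sum_left)
qed

lemma boundary_cong: "(\<And>j. j \<in> {1..N} - A \<Longrightarrow> c (insert j A) = d (insert j A)) \<Longrightarrow> boundary c A = boundary d A"
  by (simp add: boundary_def)

lemma boundary_add: "boundary (\<lambda>A. c A + d A) A = boundary c A + boundary d A"
  by (simp add: boundary_def scale_right_distrib sum.distrib)

lemma boundary_diff: "boundary (\<lambda>A. c A - d A) A = boundary c A - boundary d A"
  by (simp add: boundary_def scale_right_diff_distrib sum_subtractf)

lemma boundary_scale: "boundary (\<lambda>A. scale s (c A)) A = scale s (boundary c A)"
  by (simp add: boundary_def scale_sum_right mult_ac)

text \<open>Vanishing of the Koszul homology of \<open>C/W\<close> in degree \<open>i\<close>.\<close>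

definition exact_at :: "'b set \<Rightarrow> 'b set \<Rightarrow> nat \<Rightarrow> bool" where
  "exact_at C W i \<longleftrightarrow> (\<forall>c. (\<forall>A. c A \<in> C) \<longrightarrow>
     (\<forall>A\<subseteq>{1..N}. card A + 1 = i \<longrightarrow> boundary c A \<in> W) \<longrightarrow>
     (\<exists>e. (\<forall>A. e A \<in> C) \<and> (\<forall>A\<subseteq>{1..N}. card A = i \<longrightarrow> c A - boundary e A \<in> W)))"

lemma exact_atD:
  assumes "exact_at C W i" "\<forall>A. c A \<in> C"
    and "\<forall>A\<subseteq>{1..N}. card A + 1 = i \<longrightarrow> boundary c A \<in> W"
  shows "\<exists>e. (\<forall>A. e A \<in> C) \<and> (\<forall>A\<subseteq>{1..N}. card A = i \<longrightarrow> c A - boundary e A \<in> W)"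
  using assms(1)[unfolded exact_at_def, rule_format, of c] assms(2,3) by blast

text \<open>Multiplication by \<open>f\<close> is null-homotopic, so it kills the Koszul homology of \<open>C/W\<close>, while
  vanishing for \<open>C/W'\<close> with \<open>W' = W + fC\<close> makes it injective one degree lower.\<close>

lemma exact_at_step:
  assumes C: "submod C" and W: "submod W" and W': "submod W'" and WC: "W \<subseteq> C"
    and WW': "W \<subseteq> W'" and fW': "\<And>u. u \<in> C \<Longrightarrow> scale f u \<in> W'"
    and split: "\<And>w. w \<in> W' \<Longrightarrow> \<exists>v\<in>W. \<exists>u\<in>C. w = v + scale f u"
    and regular: "\<And>u. u \<in> C \<Longrightarrow> scale f u \<in> W \<Longrightarrow> u \<in> W"
    and f: "f = (\<Sum>j\<in>{1..N}. g j * x j)" and g: "\<And>j. j \<in> {1..N} \<Longrightarrow> g j \<in> R"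
    and ex: "exact_at C W' (Suc i)"
  shows "exact_at C W i"
  unfolding exact_at_def
proof (intro allI impI)
  fix c assume c: "\<forall>A. c A \<in> C" and cyc: "\<forall>A\<subseteq>{1..N}. card A + 1 = i \<longrightarrow> boundary c A \<in> W"
  \<comment> \<open>Cut off outside \<open>{1..N}\<close>, where nothing is known about
    \<open>g\<close>, so that all values lie in \<open>C\<close>.\<close>
  define b where "b A = (if A \<subseteq> {1..N} then homotopy g c A else 0)" for A
  have bC: "b A \<in> C" for A
    unfolding b_def using homotopy_in[OF C, of A c g] c g submod_closed(1)[OF C]
    by (auto simp del: atLeastAtMost_iff)
  have h: "boundary b A = scale f (c A) - homotopy g (boundary c) A" if "A \<subseteq> {1..N}" for A
  proof -
    have "boundary b A = boundary (homotopy g c) A"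
      using that by (intro boundary_cong) (auto simp: b_def)
    then show ?thesis using boundary_homotopy[OF that, of g c] f by (simp add: algebra_simps)
  qed
  have hW: "homotopy g (boundary c) A \<in> W" if A: "A \<subseteq> {1..N}" "card A = i" for A
  proof (rule homotopy_in[OF W])
    fix j assume j: "j \<in> A"
    have "card (A - {j}) + 1 = i"
      using A j card_Suc_Diff1[of A j] finite_subset[OF A(1)] by simp
    moreover have "A - {j} \<subseteq> {1..N}" using A by blast
    ultimately show "boundary c (A - {j}) \<in> W" using cyc by blast
    show "g j \<in> R" using A j g by blast
  qed
  \<comment> \<open>Modulo \<open>W'\<close> the chain \<open>b\<close> is a cycle: its boundary is
    \<open>f c\<close>, which lies in \<open>W'\<close>, minus the homotopy of
    \<open>boundary c\<close>, which lies in \<open>W\<close>.\<close>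
  have bW: "\<forall>A\<subseteq>{1..N}. card A + 1 = Suc i \<longrightarrow> boundary b A \<in> W'"
  proof (intro allI impI)
    fix A assume A: "A \<subseteq> {1..N}" "card A + 1 = Suc i"
    have "homotopy g (boundary c) A \<in> W'" using A hW WW' by auto
    then show "boundary b A \<in> W'" unfolding h[OF A(1)] using fW' c submod_closed(5)[OF W'] by blast
  qed
  obtain e where e: "\<forall>A. e A \<in> C"
      "\<forall>A\<subseteq>{1..N}. card A = Suc i \<longrightarrow> b A - boundary e A \<in> W'"
    using exact_atD[OF ex allI[OF bC] bW] by (elim exE conjE)
  have "\<exists>v u. v \<in> W \<and> u \<in> C \<and> (A \<subseteq> {1..N} \<longrightarrow> card A = Suc i \<longrightarrow> b A - boundary e A = v + scale f u)" for A
  proof (cases "A \<subseteq> {1..N} \<and> card A = Suc i")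
    case True
    obtain v u where "v \<in> W" "u \<in> C" "b A - boundary e A = v + scale f u"
      using split[of "b A - boundary e A"] e(2) True by auto
    then show ?thesis by (intro exI conjI impI)
  next
    case False
    then show ?thesis using submod_closed(1)[OF W] submod_closed(1)[OF C] by blast
  qed
  then have "\<forall>A. \<exists>v u. v \<in> W \<and> u \<in> C \<and> (A \<subseteq> {1..N} \<longrightarrow> card A = Suc i \<longrightarrow> b A - boundary e A = v + scale f u)"
    by (rule allI)
  from choice[OF this] obtain v where
    "\<forall>A. \<exists>u. v A \<in> W \<and> u \<in> C \<and> (A \<subseteq> {1..N} \<longrightarrow> card A = Suc i \<longrightarrow> b A - boundary e A = v A + scale f u)"
    by (elim exE)
  from choice[OF this] obtain u where
    "\<forall>A. v A \<in> W \<and> u A \<in> C \<and> (A \<subseteq> {1..N} \<longrightarrow> card A = Suc i \<longrightarrow> b A - boundary e A = v A + scale f (u A))"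
    by (elim exE)
  then have v: "\<And>A. v A \<in> W" and u: "\<And>A. u A \<in> C"
    and vu: "\<And>A. A \<subseteq> {1..N} \<Longrightarrow> card A = Suc i \<Longrightarrow> b A - boundary e A = v A + scale f (u A)"
    by simp_all
  \<comment> \<open>The boundary of \<open>b = boundary e + v + f u\<close> shows that
    \<open>f (c - boundary u)\<close> equals \<open>homotopy g (boundary c) + boundary v\<close>.
    This lies in \<open>W\<close>, and \<open>f\<close> is a nonzerodivisor on
    \<open>C/W\<close>.\<close>
  have "c A - boundary u A \<in> W" if A: "A \<subseteq> {1..N}" "card A = i" for A
  proof (rule regular)
    have fA: "finite A" using A finite_subset by blast
    have "boundary b A = boundary (\<lambda>A. boundary e A + (v A + scale f (u A))) A"
    proof (rule boundary_cong)
      fix j assume "j \<in> {1..N} - A"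
      then have "b (insert j A) - boundary e (insert j A) = v (insert j A) + scale f (u (insert j A))"
        using A fA by (intro vu) auto
      then show "b (insert j A) = boundary e (insert j A) + (v (insert j A) + scale f (u (insert j A)))"
        by (simp add: algebra_simps)
    qed
    then have "scale f (c A - boundary u A) = homotopy g (boundary c) A + boundary v A"
      using h[OF A(1)] boundary_boundary[OF fA, of e]
      by (simp add: boundary_add boundary_scale scale_right_diff_distrib algebra_simps)
    then show "scale f (c A - boundary u A) \<in> W"
      using submod_closed(2)[OF W hW[OF A] boundary_in[OF W v]] by simp
    show "c A - boundary u A \<in> C"
      by (rule submod_closed(5)[OF C spec[OF c] boundary_in[OF C u]])
  qed
  then show "\<exists>e. (\<forall>A. e A \<in> C) \<and> (\<forall>A\<subseteq>{1..N}. card A = i \<longrightarrow> c A - boundary e A \<in> W)"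
    using u by (intro exI[of _ u]) simp
qed

text \<open>With no element of the sequence left, the claim concerns degree \<open>N + 1\<close>,
  where \<open>{1..N}\<close> has no subsets and hence there are no chains. Every regular element
  lowers the degree by one.\<close>

lemma exact_at_regular_sequence:
  assumes C: "submod C"
    and W: "\<And>k. k \<le> d \<Longrightarrow> submod (W k) \<and> W k \<subseteq> C"
    and WW': "\<And>k. k < d \<Longrightarrow> W k \<subseteq> W (Suc k)"
    and fW': "\<And>k u. k < d \<Longrightarrow> u \<in> C \<Longrightarrow> scale (f k) u \<in> W (Suc k)"
    and split: "\<And>k w. k < d \<Longrightarrow> w \<in> W (Suc k) \<Longrightarrow> \<exists>v\<in>W k. \<exists>u\<in>C. w = v + scale (f k) u"
    and regular: "\<And>k u. k < d \<Longrightarrow> u \<in> C \<Longrightarrow> scale (f k) u \<in> W k \<Longrightarrow> u \<in> W k"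
    and f: "\<And>k. k < d \<Longrightarrow> \<exists>g. f k = (\<Sum>j\<in>{1..N}. g j * x j) \<and> (\<forall>j\<in>{1..N}. g j \<in> R)"
    and i: "i + d = Suc N"
  shows "exact_at C (W 0) i"
  using W WW' fW' split regular f i
proof (induction d arbitrary: W f i)
  case 0
  have "card A \<noteq> i" if "A \<subseteq> {1..N}" for A
    using card_mono[OF _ that] 0(7) by simp
  then show ?case using submod_closed(1)[OF C] unfolding exact_at_def by blast
next
  case (Suc d)
  obtain g where g: "f 0 = (\<Sum>j\<in>{1..N}. g j * x j)" "\<And>j. j \<in> {1..N} \<Longrightarrow> g j \<in> R"
    using Suc.prems(6)[of 0] by auto
  have "exact_at C (W (Suc 0)) (Suc i)"
    using Suc.prems by (intro Suc.IH[of "\<lambda>k. W (Suc k)" "\<lambda>k. f (Suc k)"]) auto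
  then show ?case
    using Suc.prems(1)[of 0] Suc.prems(1)[of "Suc 0"] Suc.prems(2-5)[of 0] C g
    by (intro exact_at_step[of C "W 0" "W (Suc 0)" "f 0" g]) auto
qed

end

section \<open>Dimensions of quotients\<close>

context vector_space
begin

lemma independent_family:
  assumes J: "finite J"
    and z: "\<And>c. (\<Sum>j\<in>J. c j *s v j) = 0 \<Longrightarrow> \<forall>j\<in>J. c j = 0"
  shows "inj_on v J" "independent (v ` J)"
proof -
  show inj: "inj_on v J"
  proof (rule inj_onI, rule ccontr)
    fix j l assume jl: "j \<in> J" "l \<in> J" "v j = v l" "j \<noteq> l"
    define c :: "_ \<Rightarrow> 'a" where "c i = (if i = j then 1 else if i = l then - 1 else 0)" for i
    have "(\<Sum>i\<in>J. c i *s v i) = (\<Sum>i\<in>{j, l}. c i *s v i)"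
      using jl J by (intro sum.mono_neutral_right) (auto simp: c_def)
    also have "\<dots> = 0" using jl by (simp add: c_def)
    finally have "c j = 0" using z jl(1) by blast
    then show False by (simp add: c_def)
  qed
  show "independent (v ` J)"
  proof (rule independent_if_scalars_zero)
    fix f x assume "(\<Sum>x\<in>v ` J. f x *s x) = 0" "x \<in> v ` J"
    then show "f x = 0"
      using z[of "\<lambda>j. f (v j)"] by (auto simp: sum.reindex[OF inj])
  qed (use J in simp)
qed

lemma span_disjoint_coeffs_0:
  assumes B: "finite B" "independent B" "B1 \<subseteq> B"
    and s: "(\<Sum>v\<in>B - B1. c v *s v) \<in> span B1" and v: "v \<in> B - B1"
  shows "c v = 0"
proof -
  have fB1: "finite B1" using B finite_subset by blast
  then obtain u where u: "(\<Sum>v\<in>B - B1. c v *s v) = (\<Sum>v\<in>B1. u v *s v)"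
    using s unfolding span_finite[OF fB1] by blast
  define w where "w v = (if v \<in> B1 then - u v else c v)" for v
  have "(\<Sum>v\<in>B. w v *s v) = (\<Sum>v\<in>B - B1. w v *s v) + (\<Sum>v\<in>B1. w v *s v)"
    by (rule sum.subset_diff) (use B in auto)
  also have "(\<Sum>v\<in>B - B1. w v *s v) = (\<Sum>v\<in>B - B1. c v *s v)"
    by (intro sum.cong) (auto simp: w_def)
  also have "(\<Sum>v\<in>B1. w v *s v) = - (\<Sum>v\<in>B1. u v *s v)"
    unfolding sum_negf[symmetric] by (intro sum.cong) (auto simp: w_def)
  finally have "(\<Sum>v\<in>B. w v *s v) = 0" using u by simp
  then have "w v = 0" using independentD[OF B(2,1) order_refl] v by blast
  then show ?thesis using v by (simp add: w_def)
qed

text \<open>The bridge from linear algebra on a type to the record spaces in which Hilbert functions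
  are defined: the images of \<open>B - B1\<close> form a basis of \<open>W\<close>. All Hilbert
  functions below are computed through it, with \<open>T\<close> an inclusion, a coset map or a
  presentation.\<close>

lemma dim_quotient:
  assumes W: "vectorspace (field_ring :: 'a ring) W"
    and B: "finite B" "independent B" "B1 \<subseteq> B"
    and Tc: "\<And>v. v \<in> span B \<Longrightarrow> T v \<in> carrier W"
    and Tadd: "\<And>v w. v \<in> span B \<Longrightarrow> w \<in> span B \<Longrightarrow> T (v + w) = T v \<oplus>\<^bsub>W\<^esub> T w"
    and Tscale: "\<And>c v. v \<in> span B \<Longrightarrow> T (c *s v) = c \<odot>\<^bsub>W\<^esub> T v"
    and surj: "carrier W \<subseteq> T ` span B"
    and ker: "\<And>v. v \<in> span B \<Longrightarrow> T v = \<zero>\<^bsub>W\<^esub> \<longleftrightarrow> v \<in> span B1"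
  shows "VectorSpace.vectorspace.dim field_ring W = card B - card B1"
proof -
  interpret W: VectorSpace.vectorspace "field_ring :: 'a ring" W by (rule W)
  let ?D = "B - B1"
  have T0: "T 0 = \<zero>\<^bsub>W\<^esub>" using ker[of 0] by (simp add: span_zero)
  have Tsum: "T (\<Sum>v\<in>A. a v *s v) = (\<Oplus>\<^bsub>W\<^esub>v\<in>A. a v \<odot>\<^bsub>W\<^esub> T v)" if "finite A" "A \<subseteq> B" for a A
    using that
  proof (induction A rule: finite_induct)
    case (insert x A)
    have x: "x \<in> span B" and A: "A \<subseteq> B" and s: "(\<Sum>v\<in>A. a v *s v) \<in> span B"
      using insert.prems by (auto intro!: span_base span_sum span_scale)
    have "(\<lambda>v. a v \<odot>\<^bsub>W\<^esub> T v) \<in> A \<rightarrow> carrier W" "a x \<odot>\<^bsub>W\<^esub> T x \<in> carrier W"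
      using A x Tc by (auto intro!: W.smult_closed span_base)
    then show ?case
      using insert.hyps insert.IH[OF A] Tadd[OF span_scale[OF x] s] Tscale[OF x] by simp
  qed (simp add: T0)
  have fD: "finite ?D" using B by simp
  have TD: "T ` ?D \<subseteq> carrier W" using Tc by (auto intro: span_base)
  have coeffs0: "c v = 0" if "(\<Oplus>\<^bsub>W\<^esub>v\<in>?D. c v \<odot>\<^bsub>W\<^esub> T v) = \<zero>\<^bsub>W\<^esub>" "v \<in> ?D" for c v
  proof -
    have "(\<Sum>v\<in>?D. c v *s v) \<in> span B"
      by (auto intro!: span_base span_sum span_scale)
    then have "(\<Sum>v\<in>?D. c v *s v) \<in> span B1"
      using that(1) Tsum[OF fD, of c] ker by auto
    then show ?thesis using span_disjoint_coeffs_0[OF B] that(2) by blast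
  qed
  have inj: "inj_on T ?D"
  proof (rule inj_onI, rule ccontr)
    fix v w assume vw: "v \<in> ?D" "w \<in> ?D" "T v = T w" "v \<noteq> w"
    define c :: "_ \<Rightarrow> 'a" where "c i = (if i = v then 1 else if i = w then - 1 else 0)" for i
    have "(\<Sum>i\<in>?D. c i *s i) = (\<Sum>i\<in>{v, w}. c i *s i)"
      using vw fD by (intro sum.mono_neutral_right) (auto simp: c_def)
    also have "\<dots> = v - w" using vw by (simp add: c_def)
    also have "v - w \<in> span B1"
    proof -
      have s: "v \<in> span B" "w \<in> span B" using vw by (auto intro: span_base)
      then have d: "v - w \<in> span B" by (rule span_diff)
      have "T v = T (v - w) \<oplus>\<^bsub>W\<^esub> T w" using Tadd[OF d s(2)] by simp
      then have "T (v - w) \<oplus>\<^bsub>W\<^esub> T w = \<zero>\<^bsub>W\<^esub> \<oplus>\<^bsub>W\<^esub> T w" using vw Tc[OF s(2)] by simp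
      then have "T (v - w) = \<zero>\<^bsub>W\<^esub>"
        using Tc[OF d] Tc[OF s(2)] W.M.add.right_cancel[of "T w" "T (v - w)" "\<zero>\<^bsub>W\<^esub>"] by simp
      then show ?thesis using ker[OF d] by blast
    qed
    finally have "c v = 0" using span_disjoint_coeffs_0[OF B] vw(1) by blast
    then show False by (simp add: c_def)
  qed
  have lin: "W.lincomb a (T ` ?D) = (\<Oplus>\<^bsub>W\<^esub>v\<in>?D. a (T v) \<odot>\<^bsub>W\<^esub> T v)" for a
    unfolding W.lincomb_def
    by (rule W.M.finsum_reindex[OF _ inj]) (use TD in \<open>auto intro!: W.smult_closed\<close>)
  have "W.lin_indpt (T ` ?D)"
  proof (rule W.finite_lin_indpt2)
    fix a assume "W.lincomb a (T ` ?D) = \<zero>\<^bsub>W\<^esub>"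
    then have "a (T v) = 0" if "v \<in> ?D" for v
      by (intro coeffs0[of "\<lambda>v. a (T v)" v, OF _ that]) (simp only: lin)
    then show "\<forall>v\<in>T ` ?D. a v = \<zero>\<^bsub>field_ring\<^esub>" by simp
  qed (use fD TD in auto)
  moreover have "W.span (T ` ?D) = carrier W"
  proof (intro equalityI subsetI)
    fix y assume "y \<in> carrier W"
    then obtain x where x: "x \<in> span B" "y = T x" using surj by blast
    then obtain u where u: "x = (\<Sum>v\<in>B. u v *s v)" using span_finite[OF B(1)] by auto
    have "x = (\<Sum>v\<in>?D. u v *s v) + (\<Sum>v\<in>B1. u v *s v)"
      unfolding u by (rule sum.subset_diff) (use B in auto)
    moreover have s: "(\<Sum>v\<in>?D. u v *s v) \<in> span B" "(\<Sum>v\<in>B1. u v *s v) \<in> span B1"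
      by (auto intro!: span_base span_sum span_scale)
    moreover have s': "(\<Sum>v\<in>B1. u v *s v) \<in> span B" using s(2) span_mono[OF B(3)] by blast
    ultimately have "y = T (\<Sum>v\<in>?D. u v *s v)"
      using Tadd[OF s(1) s'] ker[OF s'] x(2) Tc[OF s(1)] by simp
    also have "\<dots> = (\<Oplus>\<^bsub>W\<^esub>v\<in>?D. u v \<odot>\<^bsub>W\<^esub> T v)"
      by (rule Tsum) (use fD in auto)
    also have "\<dots> = (\<Oplus>\<^bsub>W\<^esub>v\<in>?D. u (inv_into ?D T (T v)) \<odot>\<^bsub>W\<^esub> T v)"
      by (rule W.M.finsum_cong')
         (use TD in \<open>auto intro!: W.smult_closed simp: inv_into_f_f[OF inj] simp del: Diff_iff\<close>)
    also have "\<dots> = W.lincomb (\<lambda>v. u (inv_into ?D T v)) (T ` ?D)"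
      by (rule lin[symmetric])
    finally show "y \<in> W.span (T ` ?D)"
      unfolding W.span_def using fD by (intro CollectI exI conjI) auto
  qed (use W.span_is_subset2[OF TD] in blast)
  ultimately have "W.basis (T ` ?D)" using TD by (simp add: W.basis_def)
  then have "W.dim = card (T ` ?D)" using fD by (intro W.dim_basis) auto
  also have "\<dots> = card B - card B1"
    using card_image[OF inj] B finite_subset[OF B(3,1)] by (simp add: card_Diff_subset)
  finally show ?thesis .
qed

end

section \<open>Direct sums of shifted polynomial rings\<close>

lemma sum_fun_apply: "(\<Sum>a\<in>A. f a) i = (\<Sum>a\<in>A. f a i)"
  by (induction A rule: infinite_finite_induct) auto

definition fscale :: "'k::field mpoly \<Rightarrow> ('i \<Rightarrow> 'k mpoly) \<Rightarrow> 'i \<Rightarrow> 'k mpoly" where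
  "fscale s f = (\<lambda>i. s * f i)"

interpretation fmod: Modules.module "fscale :: 'k::field mpoly \<Rightarrow> ('i \<Rightarrow> 'k mpoly) \<Rightarrow> 'i \<Rightarrow> 'k mpoly"
  by unfold_locales (auto simp: fscale_def fun_eq_iff algebra_simps)

interpretation fvec: vector_space "\<lambda>c. fscale (Const c) :: ('i \<Rightarrow> 'k::field mpoly) \<Rightarrow> 'i \<Rightarrow> 'k mpoly"
  by unfold_locales (auto simp: fscale_def fun_eq_iff algebra_simps Const_add Const_mult)

text \<open>The module \<open>\<Oplus>\<^sub>i\<^sub>\<in>\<^sub>I K[x\<^sub>1,\<dots>,x\<^sub>\<nu>\<^sub>i](-\<delta>\<^sub>i)\<close> and its homogeneous components.\<close>

definition free_part :: "('i \<Rightarrow> nat) \<Rightarrow> 'i set \<Rightarrow> ('i \<Rightarrow> 'k::field mpoly) set" where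
  "free_part \<nu> I = {f. \<forall>i. f i \<in> polys (\<nu> i) \<and> (i \<notin> I \<longrightarrow> f i = 0)}"

definition free_comp :: "('i \<Rightarrow> nat) \<Rightarrow> 'i set \<Rightarrow> ('i \<Rightarrow> int) \<Rightarrow> int \<Rightarrow> ('i \<Rightarrow> 'k::field mpoly) set" where
  "free_comp \<nu> I \<delta> k =
     {f \<in> free_part \<nu> I. \<forall>i. \<forall>m\<in>keys (f i). int (mono_deg m) + \<delta> i = k}"

definition unit_fun :: "'i \<times> (nat \<Rightarrow>\<^sub>0 nat) \<Rightarrow> 'i \<Rightarrow> 'k::field mpoly" where
  "unit_fun = (\<lambda>(i, m) j. if j = i then single m 1 else 0)"

text \<open>The index set of the monomial \<open>K\<close>-basis of the component of degree
  \<open>k\<close>: a summand together with a monomial of the degree left over after the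
  shift.\<close>

definition free_index :: "('i \<Rightarrow> nat) \<Rightarrow> 'i set \<Rightarrow> ('i \<Rightarrow> int) \<Rightarrow> int \<Rightarrow> ('i \<times> (nat \<Rightarrow>\<^sub>0 nat)) set" where
  "free_index \<nu> I \<delta> k = (SIGMA i:I. mons (\<nu> i) (k - \<delta> i))"

lemma finite_free_index [simp]: "finite I \<Longrightarrow> finite (free_index \<nu> I \<delta> k)"
  by (simp add: free_index_def)

lemma card_free_index: "finite I \<Longrightarrow> card (free_index \<nu> I \<delta> k) = (\<Sum>i\<in>I. card (mons (\<nu> i) (k - \<delta> i)))"
  by (simp add: free_index_def card_SigmaI)

lemma lookup_unit_fun: "lookup (unit_fun j i) m = (if j = (i, m) then 1 else 0)"
  by (cases j) (simp add: unit_fun_def lookup_single when_def)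

lemma lookup_sum_unit_fun:
  assumes J: "finite J"
  shows "lookup ((\<Sum>j\<in>J. fscale (Const (c j)) (unit_fun j)) i) m =
    (if (i, m) \<in> J then c (i, m) else 0)"
proof -
  have "lookup ((\<Sum>j\<in>J. fscale (Const (c j)) (unit_fun j)) i) m =
      (\<Sum>j\<in>J. if j = (i, m) then c j else 0)"
    unfolding sum_fun_apply lookup_sum
    by (intro sum.cong refl) (simp add: fscale_def lookup_unit_fun)
  also have "\<dots> = (if (i, m) \<in> J then c (i, m) else 0)"
    using J by simp
  finally show ?thesis .
qed

lemma unit_fun_independent:
  assumes J: "finite J"
  shows "inj_on (unit_fun :: _ \<Rightarrow> 'i \<Rightarrow> 'k::field mpoly) J"
    "fvec.independent ((unit_fun :: _ \<Rightarrow> 'i \<Rightarrow> 'k mpoly) ` J)"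
proof -
  have z: "\<forall>j\<in>J. c j = 0" if "(\<Sum>j\<in>J. fscale (Const (c j)) (unit_fun j :: 'i \<Rightarrow> 'k mpoly)) = 0" for c
  proof
    fix j assume "j \<in> J"
    then show "c j = 0"
      using lookup_sum_unit_fun[OF J, of c "fst j" "snd j"] that by (simp add: zero_fun_def)
  qed
  show "inj_on (unit_fun :: _ \<Rightarrow> 'i \<Rightarrow> 'k mpoly) J"
    using fvec.independent_family(1)[OF J, of unit_fun] z by blast
  show "fvec.independent ((unit_fun :: _ \<Rightarrow> 'i \<Rightarrow> 'k mpoly) ` J)"
    using fvec.independent_family(2)[OF J, of unit_fun] z by blast
qed

lemma in_span_unit_fun:
  assumes J: "finite J"
  shows "f \<in> fvec.span (unit_fun ` J) \<longleftrightarrow> (\<forall>i. \<forall>m\<in>keys (f i). (i, m) \<in> J)"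
proof
  assume "f \<in> fvec.span (unit_fun ` J)"
  then obtain u where "f = (\<Sum>v\<in>unit_fun ` J. fscale (Const (u v)) v)"
    using fvec.span_finite[of "unit_fun ` J"] J by auto
  then have "f = (\<Sum>j\<in>J. fscale (Const (u (unit_fun j))) (unit_fun j))"
    using sum.reindex[OF unit_fun_independent(1)[OF J]] by simp
  then show "\<forall>i. \<forall>m\<in>keys (f i). (i, m) \<in> J"
    using lookup_sum_unit_fun[OF J, of "\<lambda>j. u (unit_fun j)"] by (auto simp: in_keys_iff split: if_splits)
next
  assume k: "\<forall>i. \<forall>m\<in>keys (f i). (i, m) \<in> J"
  have "f = (\<Sum>j\<in>J. fscale (Const (lookup (f (fst j)) (snd j))) (unit_fun j))"
  proof (rule ext, rule poly_mapping_eqI)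
    fix i m
    show "lookup (f i) m = lookup
        ((\<Sum>j\<in>J. fscale (Const (lookup (f (fst j)) (snd j))) (unit_fun j)) i) m"
      using k[rule_format, of m i] by (auto simp: lookup_sum_unit_fun[OF J] in_keys_iff)
  qed
  also have "\<dots> \<in> fvec.span (unit_fun ` J)"
    by (intro fvec.span_sum fvec.span_scale fvec.span_base imageI)
  finally show "f \<in> fvec.span (unit_fun ` J)" .
qed

lemma span_free_comp:
  fixes \<nu> :: "'i \<Rightarrow> nat"
  assumes "finite I"
  shows "fvec.span (unit_fun ` free_index \<nu> I \<delta> k) = (free_comp \<nu> I \<delta> k :: ('i \<Rightarrow> 'k::field mpoly) set)"
proof (intro equalityI subsetI)
  fix f :: "'i \<Rightarrow> 'k mpoly"
  assume "f \<in> fvec.span (unit_fun ` free_index \<nu> I \<delta> k)"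
  then have *: "\<And>i m. m \<in> keys (f i) \<Longrightarrow> i \<in> I \<and> m \<in> mons (\<nu> i) (k - \<delta> i)"
    by (subst (asm) in_span_unit_fun) (use assms in \<open>auto simp: free_index_def\<close>)
  have "f i = 0" if "i \<notin> I" for i
    using *[of _ i] that by (metis keys_eq_empty ex_in_conv)
  then show "f \<in> free_comp \<nu> I \<delta> k"
    using * by (fastforce simp: free_comp_def free_part_def mem_poly_ring mons_def)
next
  fix f :: "'i \<Rightarrow> 'k mpoly"
  assume f: "f \<in> free_comp \<nu> I \<delta> k"
  have "(i, m) \<in> free_index \<nu> I \<delta> k" if m: "m \<in> keys (f i)" for i m
  proof -
    have "i \<in> I" using f m by (force simp: free_comp_def free_part_def)
    moreover have "keys m \<subseteq> {1..\<nu> i}" "int (mono_deg m) + \<delta> i = k"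
      using f m by (auto simp: free_comp_def free_part_def mem_poly_ring)
    ultimately show ?thesis by (auto simp: free_index_def mons_def)
  qed
  then show "f \<in> fvec.span (unit_fun ` free_index \<nu> I \<delta> k)"
    using assms by (subst in_span_unit_fun) auto
qed

definition hom_part :: "('i \<Rightarrow> int) \<Rightarrow> int \<Rightarrow> ('i \<Rightarrow> 'k::field mpoly) \<Rightarrow> 'i \<Rightarrow> 'k mpoly" where
  "hom_part \<delta> k f = (\<lambda>i. restr (\<lambda>m. int (mono_deg m) + \<delta> i = k) (f i))"

lemma free_comp_subset: "free_comp \<nu> I \<delta> k \<subseteq> free_part \<nu> I"
  by (auto simp: free_comp_def)

lemma hom_part_in_free_comp: "f \<in> free_part \<nu> I \<Longrightarrow> hom_part \<delta> k f \<in> free_comp \<nu> I \<delta> k"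
  by (auto simp: free_comp_def free_part_def hom_part_def mem_poly_ring)

lemma hom_part_sum: "hom_part \<delta> k (\<Sum>i\<in>A. f i) = (\<Sum>i\<in>A. hom_part \<delta> k (f i))"
  unfolding hom_part_def by (intro ext) (simp add: sum_fun_apply restr_sum)

lemma hom_part_Const: "hom_part \<delta> k (fscale (Const c) f) = fscale (Const c) (hom_part \<delta> k f)"
  unfolding hom_part_def fscale_def
  by (intro ext poly_mapping_eqI) simp

lemma hom_part_Var: "hom_part \<delta> k (fscale (Var j) f) = fscale (Var j) (hom_part \<delta> (k - 1) f)"
proof -
  have "(1 + int (mono_deg m) + \<delta> i = k) = (int (mono_deg m) + \<delta> i = k - 1)" for i m
    by linarith
  then show ?thesis
    by (simp add: hom_part_def fscale_def Var_def restr_single_mult)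
qed

lemma hom_part_uminus: "hom_part \<delta> k (- f) = - hom_part \<delta> k f"
  using hom_part_Const[of \<delta> k "- 1" f] by (simp add: fscale_def fun_eq_iff Const_uminus hom_part_def)

lemma hom_part_id: "f \<in> free_comp \<nu> I \<delta> k \<Longrightarrow> hom_part \<delta> k f = f"
  by (auto simp: hom_part_def free_comp_def restr_idem)

lemma hom_part_other: "f \<in> free_comp \<nu> I \<delta> k \<Longrightarrow> k \<noteq> l \<Longrightarrow> hom_part \<delta> l f = 0"
  unfolding hom_part_def free_comp_def
  by (intro ext poly_mapping_eqI) (force simp: in_keys_iff)

lemma hom_part_decomp:
  assumes I: "finite I" and f: "f \<in> free_part \<nu> I"
  obtains K where "finite K" "f = (\<Sum>k\<in>K. hom_part \<delta> k f)" "\<And>k. k \<notin> K \<Longrightarrow> hom_part \<delta> k f = 0"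
proof
  let ?K = "\<Union>i\<in>I. (\<lambda>m. int (mono_deg m) + \<delta> i) ` keys (f i)"
  show K: "finite ?K" using I by auto
  have i: "i \<in> I" if "m \<in> keys (f i)" for i m
    using f that by (force simp: free_part_def)
  show "f = (\<Sum>k\<in>?K. hom_part \<delta> k f)"
  proof (rule ext, rule poly_mapping_eqI)
    fix i m
    have "lookup ((\<Sum>k\<in>?K. hom_part \<delta> k f) i) m =
        (\<Sum>k\<in>?K. if k = int (mono_deg m) + \<delta> i then lookup (f i) m else 0)"
      unfolding sum_fun_apply lookup_sum hom_part_def by (intro sum.cong) auto
    also have "\<dots> = lookup (f i) m"
      unfolding sum.delta[OF K] using i by (force simp: in_keys_iff)
    finally show "lookup (f i) m = lookup ((\<Sum>k\<in>?K. hom_part \<delta> k f) i) m"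
      by simp
  qed
  show "hom_part \<delta> k f = 0" if "k \<notin> ?K" for k
    unfolding hom_part_def
    using that i by (intro ext poly_mapping_eqI) (force simp: in_keys_iff)
qed

lemma free_part_closed:
  "0 \<in> free_part \<nu> I" "f \<in> free_part \<nu> I \<Longrightarrow> g \<in> free_part \<nu> I \<Longrightarrow> f + g \<in> free_part \<nu> I"
  "f \<in> free_part \<nu> I \<Longrightarrow> (\<And>i. i \<in> I \<Longrightarrow> s \<in> polys (\<nu> i)) \<Longrightarrow> fscale s f \<in> free_part \<nu> I"
proof -
  assume f: "f \<in> free_part \<nu> I" and s: "\<And>i. i \<in> I \<Longrightarrow> s \<in> polys (\<nu> i)"
  show "fscale s f \<in> free_part \<nu> I"
    unfolding free_part_def fscale_def
  proof (intro CollectI allI conjI impI)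
    fix i show "s * f i \<in> polys (\<nu> i)"
      using f s[of i] by (cases "i \<in> I") (auto simp: free_part_def)
  qed (use f in \<open>auto simp: free_part_def\<close>)
qed (auto simp: free_part_def)

text \<open>The submodule generated by \<open>x\<^sub>1, \<dots>, x\<^sub>k\<close>.\<close>

definition var_sub :: "('i \<Rightarrow> nat) \<Rightarrow> 'i set \<Rightarrow> nat \<Rightarrow> ('i \<Rightarrow> 'k::field mpoly) set" where
  "var_sub \<nu> I k = {f \<in> free_part \<nu> I. \<forall>i. \<forall>m\<in>keys (f i). keys m \<inter> {1..k} \<noteq> {}}"

lemma var_sub_0: "var_sub \<nu> I 0 = {0}"
proof (intro equalityI subsetI)
  fix f assume "f \<in> var_sub \<nu> I 0"
  then have "keys (f i) = {}" for i by (auto simp: var_sub_def)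
  then show "f \<in> {0}" by (auto simp: fun_eq_iff)
qed (auto simp: var_sub_def free_part_closed)

lemma var_sub_subset: "var_sub \<nu> I k \<subseteq> free_part \<nu> I"
  by (auto simp: var_sub_def)

lemma var_sub_Suc: "var_sub \<nu> I k \<subseteq> var_sub \<nu> I (Suc k)"
  by (fastforce simp: var_sub_def)

lemma var_sub_closed:
  "0 \<in> var_sub \<nu> I k" "f \<in> var_sub \<nu> I k \<Longrightarrow> g \<in> var_sub \<nu> I k \<Longrightarrow> f + g \<in> var_sub \<nu> I k"
proof -
  assume "f \<in> var_sub \<nu> I k" "g \<in> var_sub \<nu> I k"
  then show "f + g \<in> var_sub \<nu> I k"
    using keys_add[of "f i" "g i" for i] by (fastforce simp: var_sub_def free_part_closed)
qed (simp add: var_sub_def free_part_closed)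

lemma keys_mult_inter:
  fixes s p :: "'k::field mpoly"
  assumes "\<forall>m\<in>keys p. keys m \<inter> A \<noteq> {}"
  shows "\<forall>m\<in>keys (s * p). keys m \<inter> A \<noteq> {}"
proof
  fix m assume "m \<in> keys (s * p)"
  then obtain a b where "m = a + b" "b \<in> keys p"
    using keys_mult[of s p] by blast
  then show "keys m \<inter> A \<noteq> {}"
    using assms by (fastforce simp: keys_add_nat)
qed

lemma var_sub_scale:
  assumes f: "f \<in> var_sub \<nu> I k" and s: "\<And>i. i \<in> I \<Longrightarrow> s \<in> polys (\<nu> i)"
  shows "fscale s f \<in> var_sub \<nu> I k"
  unfolding var_sub_def
proof (intro CollectI conjI allI)
  show "fscale s f \<in> free_part \<nu> I"
    using f s by (auto simp: var_sub_def intro: free_part_closed)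
  show "\<forall>m\<in>keys (fscale s f i). keys m \<inter> {1..k} \<noteq> {}" for i
    unfolding fscale_def using f by (intro keys_mult_inter) (auto simp: var_sub_def)
qed

lemma Var_scale_var_sub:
  assumes f: "f \<in> free_part \<nu> I" and s: "\<And>i. i \<in> I \<Longrightarrow> Suc k \<le> \<nu> i"
  shows "fscale (Var (Suc k)) f \<in> var_sub \<nu> I (Suc k)"
  unfolding var_sub_def
proof (intro CollectI conjI allI ballI)
  show "fscale (Var (Suc k)) f \<in> free_part \<nu> I"
    using f s by (intro free_part_closed) auto
  fix i m assume "m \<in> keys (fscale (Var (Suc k)) f i)"
  then have "m \<in> (+) (single (Suc k) 1) ` keys (f i)"
    unfolding fscale_def Var_def using keys_single_mult by blast
  then show "keys m \<inter> {1..Suc k} \<noteq> {}" by (auto simp: keys_add_nat)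
qed

text \<open>Multiplying a monomial by \<open>Var (Suc k)\<close> does not change which of the
  variables \<open>1..k\<close> occur in it.\<close>

lemma var_sub_regular:
  assumes f: "f \<in> free_part \<nu> I" and x: "fscale (Var (Suc k)) f \<in> var_sub \<nu> I k"
  shows "f \<in> var_sub \<nu> I k"
  unfolding var_sub_def
proof (intro CollectI conjI allI ballI f)
  fix i m assume m: "m \<in> keys (f i)"
  let ?x = "single (Suc k) (1::nat)"
  have "?x + m \<in> keys (fscale (Var (Suc k)) f i)"
    using m by (simp add: fscale_def Var_def in_keys_iff lookup_single_mult_add)
  then have "keys (?x + m) \<inter> {1..k} \<noteq> {}" using x unfolding var_sub_def by blast
  then show "keys m \<inter> {1..k} \<noteq> {}" by (auto simp: keys_add_nat)
qed

text \<open>The terms containing one of the first \<open>k\<close> variables form \<open>v\<close>;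
  every other term must contain variable \<open>Suc k\<close>, which can be divided out.\<close>

lemma var_sub_split:
  fixes f :: "'i \<Rightarrow> 'k::field mpoly"
  assumes f: "f \<in> var_sub \<nu> I (Suc k)"
  shows "\<exists>v\<in>var_sub \<nu> I k. \<exists>u\<in>free_part \<nu> I. f = v + fscale (Var (Suc k)) u"
proof -
  define P where "P m \<longleftrightarrow> keys m \<inter> {1..k} \<noteq> {}" for m :: "nat \<Rightarrow>\<^sub>0 nat"
  have "\<exists>q. restr (\<lambda>m. \<not> P m) (f i) = Var (Suc k) * q \<and> q \<in> polys (\<nu> i) \<and> (i \<notin> I \<longrightarrow> q = 0)" for i
  proof (cases "i \<in> I")
    case True
    have "Suc k \<in> keys m" if "m \<in> keys (restr (\<lambda>m. \<not> P m) (f i))" for m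
    proof -
      have "keys m \<inter> {1..Suc k} \<noteq> {}" "keys m \<inter> {1..k} = {}"
        using that f by (auto simp: var_sub_def P_def)
      then show ?thesis by (auto simp: atLeastAtMostSuc_conv)
    qed
    then obtain q where q: "restr (\<lambda>m. \<not> P m) (f i) = Var (Suc k) * q"
      "\<And>m. m \<in> keys q \<Longrightarrow>
        single (Suc k) 1 + m \<in> keys (restr (\<lambda>m. \<not> P m) (f i))"
      using divide_Var by blast
    have "keys m \<subseteq> {1..\<nu> i}" if "m \<in> keys q" for m
    proof -
      have "keys (single (Suc k) 1 + m) \<subseteq> {1..\<nu> i}"
        using q(2)[OF that] f unfolding var_sub_def free_part_def mem_poly_ring by simp
      then show ?thesis by (simp add: keys_add_nat)
    qed
    then show ?thesis using q(1) True by (auto simp: mem_poly_ring)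
  next
    case False
    then have "f i = 0" using f by (simp add: var_sub_def free_part_def)
    then show ?thesis by (intro exI[of _ 0]) simp
  qed
  then have "\<forall>i. \<exists>q. restr (\<lambda>m. \<not> P m) (f i) = Var (Suc k) * q \<and> q \<in> polys (\<nu> i) \<and> (i \<notin> I \<longrightarrow> q = 0)"
    by (rule allI)
  from choice[OF this] obtain u where
    u': "\<forall>i. restr (\<lambda>m. \<not> P m) (f i) = Var (Suc k) * u i \<and> u i \<in> polys (\<nu> i) \<and> (i \<notin> I \<longrightarrow> u i = 0)"
    by (elim exE)
  then have u: "\<And>i. restr (\<lambda>m. \<not> P m) (f i) = Var (Suc k) * u i" "u \<in> free_part \<nu> I"
    by (simp_all add: free_part_def)
  define v where "v i = restr P (f i)" for i
  have "f = v + fscale (Var (Suc k)) u"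
    using restr_split[of "f i" P for i] by (simp add: fun_eq_iff v_def fscale_def u(1)[symmetric])
  moreover have "v \<in> var_sub \<nu> I k"
    using f by (auto simp: v_def var_sub_def free_part_def mem_poly_ring P_def)
  ultimately show ?thesis using u(2) by blast
qed

section \<open>Koszul exactness of free modules\<close>

interpretation kos: koszul "fscale :: 'k::field mpoly \<Rightarrow> ('i \<Rightarrow> 'k mpoly) \<Rightarrow> 'i \<Rightarrow> 'k mpoly"
    Var N "polys N" for N
  by unfold_locales auto

lemma free_part_submod: "kos.submod N (free_part (\<lambda>_. N) I)"
  by (intro kos.submodI) (auto intro: free_part_closed)

text \<open>On a free module the variables themselves form a regular sequence of length
  \<open>N\<close>, long enough to bring the vanishing down from degree \<open>N + 1\<close> to
  degree \<open>1\<close>.\<close>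

lemma free_part_exact:
  "kos.exact_at N (free_part (\<lambda>_. N) I :: ('i \<Rightarrow> 'k::field mpoly) set) {0} 1"
proof -
  have g: "\<exists>g. (Var (Suc k) :: 'k mpoly) = (\<Sum>j = 1..N. g j * Var j) \<and> (\<forall>j\<in>{1..N}. g j \<in> polys N)"
    if "k < N" for k :: nat
  proof (intro exI conjI)
    show "(Var (Suc k) :: 'k mpoly) = (\<Sum>j = 1..N. (if j = Suc k then 1 else 0) * Var j)"
      using that by (simp add: if_distrib[of "\<lambda>a. a * _"] cong: if_cong)
  qed auto
  have "kos.exact_at N (free_part (\<lambda>_. N) I :: ('i \<Rightarrow> 'k mpoly) set) (var_sub (\<lambda>_. N) I 0) 1"
  proof (rule kos.exact_at_regular_sequence[where d = N and f = "\<lambda>k. Var (Suc k)"])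
    fix k
    show "kos.submod N (var_sub (\<lambda>_. N) I k) \<and> var_sub (\<lambda>_. N) I k \<subseteq> free_part (\<lambda>_. N) I"
      by (intro conjI kos.submodI var_sub_closed var_sub_scale var_sub_subset)
  qed (use g in \<open>auto intro: free_part_submod var_sub_split var_sub_regular Var_scale_var_sub
         subsetD[OF var_sub_Suc]\<close>)
  then show ?thesis by (simp add: var_sub_0)
qed

section \<open>Direct sums as graded modules over \<open>S\<close>: generators, dimensions,
  depth\<close>

lemma finsum_eq_sum:
  assumes "abelian_monoid U" "add U = (+)" "zero U = (0::'a::comm_monoid_add)"
    and "finite A" "\<And>a. a \<in> A \<Longrightarrow> g a \<in> carrier U"
  shows "finsum U g A = (\<Sum>a\<in>A. g a)"
  using assms(4,5)
proof (induction A rule: finite_induct)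
  case empty
  then show ?case using abelian_monoid.finsum_empty[OF assms(1)] assms(3) by simp
next
  case (insert x F)
  then show ?case
    using abelian_monoid.finsum_insert[OF assms(1), of F x g] assms(2) by (simp add: Pi_def)
qed

text \<open>A variable beyond the \<open>\<nu>\<^sub>i\<close>-th one acts as zero on the \<open>i\<close>-th summand.\<close>

definition project :: "nat \<Rightarrow> 'k::field mpoly \<Rightarrow> 'k mpoly" where
  "project d = restr (\<lambda>m. keys m \<subseteq> {1..d})"

lemma project_add: "project d (s + t) = project d s + project d t"
  by (simp add: project_def restr_add)

lemma project_mult: "project d (s * t) = project d s * project d t"
  unfolding project_def by (rule restr_mult) (auto simp: keys_add_nat)

lemma project_in [simp]: "project d s \<in> polys d"
  by (simp add: project_def mem_poly_ring)

lemma project_id [simp]: "s \<in> polys d \<Longrightarrow> project d s = s"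
  by (simp add: project_def mem_poly_ring restr_idem)

definition free_module :: "('i \<Rightarrow> nat) \<Rightarrow> 'i set \<Rightarrow> ('k::field mpoly, 'i \<Rightarrow> 'k mpoly) module" where
  "free_module \<nu> I = \<lparr>carrier = free_part \<nu> I, mult = (\<lambda>_ _. 0), one = 0, zero = 0, add = (+),
     smult = (\<lambda>s f i. project (\<nu> i) s * f i)\<rparr>"

lemma free_module_simps [simp]:
  "carrier (free_module \<nu> I) = free_part \<nu> I" "zero (free_module \<nu> I) = 0"
  "add (free_module \<nu> I) = (+)"
  "smult (free_module \<nu> I) = (\<lambda>s f i. project (\<nu> i) s * f i)"
  by (simp_all add: free_module_def)

lemma free_part_uminus: "f \<in> free_part \<nu> I \<Longrightarrow> - f \<in> free_part \<nu> I"
  by (simp add: free_part_def)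

lemma module_free_module: "module (poly_ring N) (free_module \<nu> I :: ('k::field mpoly, 'i \<Rightarrow> 'k mpoly) module)"
proof (rule moduleI[OF cring_poly_ring])
  show "abelian_group (free_module \<nu> I :: ('k mpoly, 'i \<Rightarrow> 'k mpoly) module)"
  proof (rule abelian_groupI)
    fix x :: "'i \<Rightarrow> 'k mpoly" assume "x \<in> carrier (free_module \<nu> I)"
    then show "\<exists>y\<in>carrier (free_module \<nu> I). y \<oplus>\<^bsub>free_module \<nu> I\<^esub> x = \<zero>\<^bsub>free_module \<nu> I\<^esub>"
      by (intro bexI[of _ "- x"]) (simp_all add: free_part_uminus)
  qed (simp_all add: free_part_closed add_ac)
qed (auto simp: free_part_def project_add project_mult algebra_simps fun_eq_iff)

lemma free_comp_closed:
  "0 \<in> free_comp \<nu> I \<delta> k"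
  "f \<in> free_comp \<nu> I \<delta> k \<Longrightarrow> g \<in> free_comp \<nu> I \<delta> k \<Longrightarrow> f + g \<in> free_comp \<nu> I \<delta> k"
  "f \<in> free_comp \<nu> I \<delta> k \<Longrightarrow> - f \<in> free_comp \<nu> I \<delta> k"
proof -
  assume "f \<in> free_comp \<nu> I \<delta> k" "g \<in> free_comp \<nu> I \<delta> k"
  then show "f + g \<in> free_comp \<nu> I \<delta> k"
    using keys_add[of "f i" "g i" for i] by (fastforce simp: free_comp_def free_part_closed)
qed (auto simp: free_comp_def free_part_closed free_part_uminus)

lemma free_module_uminus:
  fixes f :: "'i \<Rightarrow> 'k::field mpoly"
  assumes f: "f \<in> free_part \<nu> I"
  shows "\<ominus>\<^bsub>free_module \<nu> I\<^esub> f = - f"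
proof -
  interpret module "poly_ring 0" "free_module \<nu> I :: ('k mpoly, 'i \<Rightarrow> 'k mpoly) module"
    by (rule module_free_module)
  show ?thesis using f M.minus_equality[of "- f" f] by (simp add: free_part_uminus)
qed

lemma finsum_free_module:
  assumes "finite A" "\<And>a. a \<in> A \<Longrightarrow> g a \<in> free_part \<nu> I"
  shows "finsum (free_module \<nu> I) g A = (\<Sum>a\<in>A. g a)"
proof -
  interpret module "poly_ring 0" "free_module \<nu> I" by (rule module_free_module)
  show ?thesis using assms by (intro finsum_eq_sum M.abelian_monoid_axioms) auto
qed

lemma graded_free_module:
  assumes I: "finite I"
  shows "graded_module N (free_module \<nu> I) (free_comp \<nu> I \<delta> :: int \<Rightarrow> ('i \<Rightarrow> 'k::field mpoly) set)"
  unfolding graded_module_def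
proof (intro conjI allI ballI)
  let ?U = "free_module \<nu> I :: ('k mpoly, 'i \<Rightarrow> 'k mpoly) module"
  interpret module "poly_ring N" ?U by (rule module_free_module)
  show "module (poly_ring N) ?U" by (rule module_free_module)
  show "subgroup (free_comp \<nu> I \<delta> k) (add_monoid ?U)" for k
  proof
    fix f :: "'i \<Rightarrow> 'k mpoly" assume f: "f \<in> free_comp \<nu> I \<delta> k"
    then have "f \<in> free_part \<nu> I" using free_comp_subset by blast
    then show "inv\<^bsub>add_monoid ?U\<^esub> f \<in> free_comp \<nu> I \<delta> k"
      using free_module_uminus[of f \<nu> I] f by (simp add: a_inv_def free_comp_closed)
  qed (auto simp: free_comp_closed dest: subsetD[OF free_comp_subset])
  fix d k and s :: "'k mpoly" and f :: "'i \<Rightarrow> 'k mpoly"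
  assume s: "s \<in> homog_part N d" and f: "f \<in> free_comp \<nu> I \<delta> k"
  show "s \<odot>\<^bsub>?U\<^esub> f \<in> free_comp \<nu> I \<delta> (d + k)"
    unfolding free_comp_def
  proof (intro CollectI conjI allI ballI)
    show "s \<odot>\<^bsub>?U\<^esub> f \<in> free_part \<nu> I"
      using smult_closed[of s f] s f by (simp add: homog_part_def free_comp_def)
    fix i m assume "m \<in> keys ((s \<odot>\<^bsub>?U\<^esub> f) i)"
    then obtain a b where "a \<in> keys s" "b \<in> keys (f i)" "m = a + b"
      using keys_mult[of "project (\<nu> i) s" "f i"] by (auto simp: project_def)
    moreover from this have "int (mono_deg a) = d" "int (mono_deg b) + \<delta> i = k"
      using s f by (auto simp: homog_part_def free_comp_def)
    ultimately show "int (mono_deg m) + \<delta> i = d + k" by simp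
  qed
next
  let ?U = "free_module \<nu> I :: ('k mpoly, 'i \<Rightarrow> 'k mpoly) module"
  fix u :: "'i \<Rightarrow> 'k mpoly" assume "u \<in> carrier ?U"
  then have u: "u \<in> free_part \<nu> I" by simp
  obtain K where K: "finite K" "u = (\<Sum>k\<in>K. hom_part \<delta> k u)" "\<And>k. k \<notin> K \<Longrightarrow> hom_part \<delta> k u = 0"
    using hom_part_decomp[OF I u] by blast
  have fsum: "(\<Oplus>\<^bsub>?U\<^esub>i\<in>{i. f i \<noteq> \<zero>\<^bsub>?U\<^esub>}. f i) = (\<Sum>i\<in>{i. f i \<noteq> 0}. f i)"
    if "\<And>i. f i \<in> free_comp \<nu> I \<delta> i" "finite {i. f i \<noteq> 0}" for f :: "int \<Rightarrow> 'i \<Rightarrow> 'k mpoly"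
    using that by (subst finsum_free_module) (auto dest: subsetD[OF free_comp_subset])
  have hc: "hom_part \<delta> k u \<in> free_comp \<nu> I \<delta> k" for k by (rule hom_part_in_free_comp[OF u])
  have sub: "{k. hom_part \<delta> k u \<noteq> 0} \<subseteq> K" using K(3) by auto
  then have fin: "finite {k. hom_part \<delta> k u \<noteq> 0}" using K(1) finite_subset by blast
  show "\<exists>!f. (\<forall>i. f i \<in> free_comp \<nu> I \<delta> i) \<and> finite {i. f i \<noteq> \<zero>\<^bsub>?U\<^esub>} \<and>
      u = (\<Oplus>\<^bsub>?U\<^esub>i\<in>{i. f i \<noteq> \<zero>\<^bsub>?U\<^esub>}. f i)"
  proof (rule ex1I[of _ "\<lambda>k. hom_part \<delta> k u"])
    have "(\<Sum>k\<in>K. hom_part \<delta> k u) = (\<Sum>k\<in>{k. hom_part \<delta> k u \<noteq> 0}. hom_part \<delta> k u)"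
      by (rule sum.mono_neutral_right[OF K(1) sub]) auto
    then have "u = (\<Oplus>\<^bsub>?U\<^esub>k\<in>{k. hom_part \<delta> k u \<noteq> \<zero>\<^bsub>?U\<^esub>}. hom_part \<delta> k u)"
      using fsum[OF hc fin] K(2) by simp
    then show "(\<forall>i. hom_part \<delta> i u \<in> free_comp \<nu> I \<delta> i) \<and> finite {i. hom_part \<delta> i u \<noteq> \<zero>\<^bsub>?U\<^esub>} \<and>
        u = (\<Oplus>\<^bsub>?U\<^esub>i\<in>{i. hom_part \<delta> i u \<noteq> \<zero>\<^bsub>?U\<^esub>}. hom_part \<delta> i u)"
      using hc fin by simp
  next
    fix f assume f: "(\<forall>i. f i \<in> free_comp \<nu> I \<delta> i) \<and> finite {i. f i \<noteq> \<zero>\<^bsub>?U\<^esub>} \<and>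
        u = (\<Oplus>\<^bsub>?U\<^esub>i\<in>{i. f i \<noteq> \<zero>\<^bsub>?U\<^esub>}. f i)"
    then have fc: "\<And>i. f i \<in> free_comp \<nu> I \<delta> i" and ff: "finite {i. f i \<noteq> 0}" by simp_all
    have us: "u = (\<Sum>i\<in>{i. f i \<noteq> 0}. f i)" using f fsum[OF fc ff] by simp
    show "f = (\<lambda>k. hom_part \<delta> k u)"
    proof
      fix k
      have "hom_part \<delta> k u = (\<Sum>i\<in>{i. f i \<noteq> 0}. hom_part \<delta> k (f i))"
        by (subst us) (rule hom_part_sum)
      also have "\<dots> = (\<Sum>i\<in>{i. f i \<noteq> 0}. if i = k then f k else 0)"
        by (intro sum.cong refl) (auto simp: hom_part_id[OF fc] hom_part_other[OF fc])
      also have "\<dots> = f k" using ff by simp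
      finally show "f k = hom_part \<delta> k u" by simp
    qed
  qed
qed

lemma submodule_sum_closed:
  assumes S: "submodule R S U" and "add U = (+)" "zero U = (0::'a::comm_monoid_add)"
    and "\<And>i. i \<in> A \<Longrightarrow> g i \<in> S"
  shows "(\<Sum>i\<in>A. g i) \<in> S"
  using assms(4) submodule.m_closed[OF S] submodule.zero_closed[OF S] assms(2,3)
  by (induction A rule: infinite_finite_induct) auto

text \<open>Since \<open>\<nu> i \<le> N\<close>, each coordinate of an element is itself a scalar
  in \<open>S\<close>, so an element is the combination of the unit vectors with its own coordinates
  as coefficients.\<close>

lemma fin_gen_free_module:
  assumes I: "finite I" and \<nu>: "\<And>i. i \<in> I \<Longrightarrow> \<nu> i \<le> N"
  shows "fin_gen N (free_module \<nu> I :: ('k::field mpoly, 'i \<Rightarrow> 'k mpoly) module)"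
proof -
  let ?U = "free_module \<nu> I :: ('k mpoly, 'i \<Rightarrow> 'k mpoly) module"
  interpret module "poly_ring N" ?U by (rule module_free_module)
  let ?e = "\<lambda>i j. if j = i then 1 else (0 :: 'k mpoly)"
  have A: "?e ` I \<subseteq> carrier ?U" by (auto simp: free_part_def)
  have "f \<in> span (?e ` I)" if f: "f \<in> free_part \<nu> I" for f
  proof -
    have "f = (\<Sum>i\<in>I. f i \<odot>\<^bsub>?U\<^esub> ?e i)"
    proof
      fix j
      have "(\<Sum>i\<in>I. f i \<odot>\<^bsub>?U\<^esub> ?e i) j = (\<Sum>i\<in>I. if i = j then project (\<nu> j) (f j) else 0)"
        unfolding sum_fun_apply by (intro sum.cong) auto
      also have "\<dots> = f j" using f I by (auto simp: free_part_def)
      finally show "f j = (\<Sum>i\<in>I. f i \<odot>\<^bsub>?U\<^esub> ?e i) j" by simp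
    qed
    also have "\<dots> \<in> span (?e ` I)"
    proof (rule submodule_sum_closed[OF span_is_submodule[OF A]])
      fix i assume i: "i \<in> I"
      have "f i \<in> polys N"
        using f \<nu>[OF i] by (auto simp: free_part_def intro: poly_ring_mono)
      then show "f i \<odot>\<^bsub>?U\<^esub> ?e i \<in> span (?e ` I)"
        using i in_own_span[OF A] by (intro submodule.smult_closed[OF span_is_submodule[OF A]]) auto
    qed simp_all
    finally show ?thesis .
  qed
  then have "span (?e ` I) = carrier ?U"
    using span_is_subset2[OF A] by auto
  then show ?thesis
    unfolding fin_gen_def using A I by blast
qed

lemma vectorspace_component_space:
  fixes U :: "('k::field mpoly, 'u) module"
  assumes "graded_module N U G"
  shows "vectorspace field_ring (component_space U (G k))"
proof -
  have "Const c \<odot>\<^bsub>U\<^esub> v \<in> G k" if "v \<in> G k" for c :: 'k and v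
    using assms that Const_homog[of c N] unfolding graded_module_def by (metis add_0)
  then have "module field_ring (component_space U (G k))"
    using assms by (intro module_component_space) (auto simp: graded_module_def)
  then show ?thesis by (simp add: vectorspace_def field_field_ring)
qed

lemma dim_free_comp:
  assumes I: "finite I"
  shows "comp_dim (free_module \<nu> I) (free_comp \<nu> I \<delta> k :: ('i \<Rightarrow> 'k::field mpoly) set) =
    (\<Sum>i\<in>I. card (mons (\<nu> i) (k - \<delta> i)))"
proof -
  let ?J = "free_index \<nu> I \<delta> k"
  let ?B = "unit_fun ` ?J :: ('i \<Rightarrow> 'k mpoly) set"
  have fJ: "finite ?J" using I by simp
  have sp: "fvec.span ?B = free_comp \<nu> I \<delta> k" by (rule span_free_comp[OF I])
  have "comp_dim (free_module \<nu> I) (free_comp \<nu> I \<delta> k :: ('i \<Rightarrow> 'k mpoly) set) =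
      card ?B - card ({} :: ('i \<Rightarrow> 'k mpoly) set)"
  proof (rule fvec.dim_quotient[where T = "\<lambda>f. f"])
    show "vectorspace field_ring (component_space (free_module \<nu> I) (free_comp \<nu> I \<delta> k :: ('i \<Rightarrow> 'k mpoly) set))"
      by (rule vectorspace_component_space[OF graded_free_module[OF I, where N = 0]])
    show "fvec.independent ?B" by (rule unit_fun_independent(2)[OF fJ])
  qed (use fJ in \<open>auto simp: sp component_space_def fscale_def\<close>)
  also have "\<dots> = card ?J"
    using card_image[OF unit_fun_independent(1)[OF fJ]] by simp
  finally show ?thesis using I by (simp add: card_free_index)
qed

text \<open>One inclusion holds because \<open>var_sub\<close> is a submodule containing the
  multiples of the variables; the other peels off the last variable with
  \<open>var_sub_split\<close>.\<close>

lemma ideal_times_Var: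
  assumes \<nu>: "\<And>i. i \<in> I \<Longrightarrow> k \<le> \<nu> i" and kN: "k \<le> N"
  shows "ideal_times N (Var ` {1..k}) (free_module \<nu> I :: ('k::field mpoly, 'i \<Rightarrow> 'k mpoly) module) = var_sub \<nu> I k"
proof -
  let ?U = "free_module \<nu> I :: ('k mpoly, 'i \<Rightarrow> 'k mpoly) module"
  interpret module "poly_ring N" ?U by (rule module_free_module)
  let ?S = "\<lambda>k. {f \<odot>\<^bsub>?U\<^esub> u |f u. f \<in> Var ` {1..k} \<and> u \<in> carrier ?U}"
  \<comment> \<open>Here \<open>k \<le> \<nu> i\<close> matters: the projection fixes these
    variables, so on every summand they act by ordinary multiplication.\<close>
  have sm: "(Var j \<odot>\<^bsub>?U\<^esub> u) = fscale (Var j) u" if "j \<in> {1..k}" "u \<in> free_part \<nu> I" for j u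
  proof
    fix i show "(Var j \<odot>\<^bsub>?U\<^esub> u) i = fscale (Var j) u i"
      using that \<nu>[of i] by (cases "i \<in> I") (auto simp: fscale_def free_part_def)
  qed
  have cl: "fscale (Var j) u \<in> free_part \<nu> I" if "j \<in> {1..k}" "u \<in> free_part \<nu> I" for j u
    using that \<nu> by (intro free_part_closed) (auto intro!: Var_in_poly_ring dest!: \<nu>)
  have SC: "?S k' \<subseteq> carrier ?U" if "k' \<le> k" for k'
  proof safe
    fix j u assume "j \<in> {1..k'}" "u \<in> carrier ?U"
    then have "j \<in> {1..k}" "u \<in> free_part \<nu> I" using that by auto
    then show "Var j \<odot>\<^bsub>?U\<^esub> u \<in> carrier ?U" using sm cl by simp
  qed
  have "span (?S k) \<subseteq> var_sub \<nu> I k"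
  proof (rule span_is_subset)
    have "(\<lambda>i. project (\<nu> i) c * v i) \<in> var_sub \<nu> I k"
      if "c \<in> polys N" "v \<in> var_sub \<nu> I k" for c :: "'k mpoly" and v
      unfolding var_sub_def
    proof (intro CollectI conjI allI)
      show "(\<lambda>i. project (\<nu> i) c * v i) \<in> free_part \<nu> I"
        using smult_closed[of c v] that by (simp add: var_sub_def)
      show "\<forall>m\<in>keys (project (\<nu> i) c * v i). keys m \<inter> {1..k} \<noteq> {}" for i
        using that by (intro keys_mult_inter) (simp add: var_sub_def)
    qed
    then show "submodule (poly_ring N) (var_sub \<nu> I k) ?U"
      by (intro submodule.intro module_free_module) (auto simp: var_sub_closed var_sub_subset)
    show "?S k \<subseteq> var_sub \<nu> I k"
    proof safe
      fix j u assume j: "j \<in> {1..k}" and u: "u \<in> carrier ?U"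
      then have u: "u \<in> free_part \<nu> I" by simp
      obtain l where l: "j = Suc l" using j by (cases j) auto
      have "fscale (Var j) u \<in> var_sub \<nu> I j"
        unfolding l using j l \<nu> by (intro Var_scale_var_sub[OF u]) (auto dest!: \<nu>)
      moreover have "var_sub \<nu> I j \<subseteq> var_sub \<nu> I k"
        using j by (fastforce simp: var_sub_def)
      ultimately have "fscale (Var j) u \<in> var_sub \<nu> I k" by (rule rev_subsetD)
      then show "Var j \<odot>\<^bsub>?U\<^esub> u \<in> var_sub \<nu> I k" by (simp only: sm[OF j u])
    qed
  qed
  moreover have "var_sub \<nu> I k' \<subseteq> span (?S k')" if "k' \<le> k" for k'
    using that
  proof (induction k')
    case 0
    then show ?case
      using submodule.zero_closed[OF span_is_submodule[OF SC[of 0]]] by (simp add: var_sub_0)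
  next
    case (Suc l)
    have S: "submodule (poly_ring N) (span (?S (Suc l))) ?U"
      by (rule span_is_submodule[OF SC[OF Suc.prems]])
    show ?case
    proof
      fix f :: "'i \<Rightarrow> 'k mpoly" assume "f \<in> var_sub \<nu> I (Suc l)"
      then obtain v u where vu: "v \<in> var_sub \<nu> I l" "u \<in> free_part \<nu> I" "f = v + fscale (Var (Suc l)) u"
        using var_sub_split by blast
      have "?S l \<subseteq> ?S (Suc l)" by force
      then have "v \<in> span (?S (Suc l))"
        using Suc vu(1) span_is_monotone by (meson Suc_leD subsetD)
      moreover have "Var (Suc l) \<odot>\<^bsub>?U\<^esub> u \<in> ?S (Suc l)" using vu(2) by force
      then have "fscale (Var (Suc l)) u \<in> span (?S (Suc l))"
        using in_own_span[OF SC[OF Suc.prems]] sm[of "Suc l" u] vu(2) Suc.prems by auto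
      ultimately show "f \<in> span (?S (Suc l))"
        using submodule.m_closed[OF S] vu(3) by simp
    qed
  qed
  ultimately show ?thesis unfolding ideal_times_def by blast
qed

lemma depth_free_module:
  assumes \<nu>: "\<And>i. i \<in> I \<Longrightarrow> d \<le> \<nu> i" and dN: "d \<le> N" and I: "I \<noteq> {}"
  shows "enat d \<le> depth N (free_module \<nu> I :: ('k::field mpoly, 'i \<Rightarrow> 'k mpoly) module)"
proof -
  let ?U = "free_module \<nu> I :: ('k mpoly, 'i \<Rightarrow> 'k mpoly) module"
  let ?fs = "map Var [1..<Suc d] :: 'k mpoly list"
  interpret R: cring "poly_ring N :: 'k mpoly ring" by (rule cring_poly_ring)
  have tk: "set (take k ?fs) = Var ` {1..k}" if "k \<le> d" for k
    using that by (auto simp: take_map take_upt simp del: upt_Suc)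
  have it: "ideal_times N (set (take k ?fs)) ?U = var_sub \<nu> I k" if "k \<le> d" for k
    unfolding tk[OF that] by (rule ideal_times_Var) (use that \<nu> dN in \<open>auto dest!: \<nu>\<close>)
  have sf: "set ?fs = Var ` {1..d}" using tk[of d] by simp
  have sV: "Var ` {1..N} \<subseteq> carrier (poly_ring N :: 'k mpoly ring)" by auto
  have "set ?fs \<subseteq> max_ideal N"
    unfolding sf max_ideal_def using R.genideal_self[OF sV] dN by force
  moreover have "regular_sequence N ?U ?fs"
    unfolding regular_sequence_def
  proof (intro conjI allI impI ballI)
    show "set ?fs \<subseteq> polys N" unfolding sf using dN by auto
    fix k u assume k: "k < length ?fs" and u: "u \<in> carrier ?U"
      and x: "?fs ! k \<odot>\<^bsub>?U\<^esub> u \<in> ideal_times N (set (take k ?fs)) ?U"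
    have kd: "k < d" using k by (simp del: upt_Suc)
    have fk: "?fs ! k = Var (Suc k)" using kd by (simp del: upt_Suc add: Suc_eq_plus1_left)
    have "?fs ! k \<odot>\<^bsub>?U\<^esub> u = fscale (Var (Suc k)) u"
    proof
      fix i show "(?fs ! k \<odot>\<^bsub>?U\<^esub> u) i = fscale (Var (Suc k)) u i"
        using u \<nu>[of i] kd unfolding fk by (cases "i \<in> I") (auto simp: fscale_def free_part_def)
    qed
    then show "u \<in> ideal_times N (set (take k ?fs)) ?U"
      using var_sub_regular[of u \<nu> I k] x u it[of k] kd by simp
  next
    \<comment> \<open>A unit vector has the monomial \<open>0\<close> in its support, in which no
      variable occurs, so it lies outside the submodule generated by the variables.\<close>
    obtain i where i: "i \<in> I" using I by blast
    have "(\<lambda>j. if j = i then 1 else 0) \<in> free_part \<nu> I" using i by (auto simp: free_part_def)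
    moreover have "(\<lambda>j. if j = i then 1 else 0) \<notin> var_sub \<nu> I d"
      by (auto simp: var_sub_def)
    ultimately show "ideal_times N (set ?fs) ?U \<noteq> carrier ?U"
      using it[of d] by auto
  qed
  ultimately have "enat (length ?fs) \<le> depth N ?U"
    unfolding depth_def by (intro Sup_upper) blast
  then show ?thesis by (simp del: upt_Suc)
qed

section \<open>The Hilbert function of a monomial quotient\<close>

lemma quotient_module_simps [simp]:
  "carrier (quotient_module N I) = carrier (poly_ring N Quot I)"
  "zero (quotient_module N I) = \<zero>\<^bsub>poly_ring N Quot I\<^esub>"
  "add (quotient_module N I) = add (poly_ring N Quot I)"
  "smult (quotient_module N I) s X = (I +>\<^bsub>poly_ring N\<^esub> s) \<otimes>\<^bsub>poly_ring N Quot I\<^esub> X"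
  by (simp_all add: quotient_module_def Let_def)

lemma module_quotient_module:
  fixes I :: "'k::field mpoly set"
  assumes I: "ideal I (poly_ring N)"
  shows "module (poly_ring N) (quotient_module N I)"
proof -
  interpret I: ideal I "poly_ring N" by (rule I)
  interpret Q: cring "poly_ring N Quot I" by (rule I.quotient_is_cring[OF cring_poly_ring])
  interpret h: ring_hom_ring "poly_ring N" "poly_ring N Quot I" "(+>\<^bsub>poly_ring N\<^esub>) I"
    by (rule I.rcos_ring_hom_ring)
  show ?thesis
  proof (rule moduleI[OF cring_poly_ring])
    show "abelian_group (quotient_module N I)"
    proof (rule abelian_groupI)
      fix x assume "x \<in> carrier (quotient_module N I)"
      then show "\<exists>y\<in>carrier (quotient_module N I). y \<oplus>\<^bsub>quotient_module N I\<^esub> x = \<zero>\<^bsub>quotient_module N I\<^esub>"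
        by (intro bexI[of _ "\<ominus>\<^bsub>poly_ring N Quot I\<^esub> x"]) (simp_all add: Q.l_neg)
    qed (simp_all add: Q.a_ac)
  qed (use h.hom_add h.hom_mult h.hom_one in \<open>simp_all add: Q.l_distr Q.r_distr Q.m_assoc\<close>)
qed

lemma poly_ring_a_inv:
  fixes p :: "'k::field mpoly"
  assumes "p \<in> polys N"
  shows "inv\<^bsub>add_monoid (poly_ring N)\<^esub> p = - p"
proof -
  interpret cring "poly_ring N :: 'k mpoly ring" by (rule cring_poly_ring)
  show ?thesis using minus_equality[of "- p" p] assms by (simp add: a_inv_def)
qed

lemma homog_part_subgroup: "subgroup (homog_part N k) (add_monoid (poly_ring N :: 'k::field mpoly ring))"
proof
  fix p q :: "'k mpoly"
  assume pq: "p \<in> homog_part N k" "q \<in> homog_part N k"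
  then show "p \<otimes>\<^bsub>add_monoid (poly_ring N)\<^esub> q \<in> homog_part N k"
    using keys_add[of p q] by (auto simp: homog_part_def)
  show "inv\<^bsub>add_monoid (poly_ring N)\<^esub> p \<in> homog_part N k"
    using pq poly_ring_a_inv[of p N] by (simp add: homog_part_def)
qed (auto simp: homog_part_def)

text \<open>In each degree the ideal is spanned by its monomials, so the remaining monomials give a
  basis of the quotient. The polynomial ring enters as the free module over the one-element index
  type, which makes \<open>dim_quotient\<close> applicable.\<close>

lemma dim_monomial_quotient:
  fixes I :: "'k::field mpoly set"
  assumes I: "ideal I (poly_ring N)"
    and mem: "\<And>p. p \<in> polys N \<Longrightarrow> p \<in> I \<longleftrightarrow> (\<forall>m\<in>keys p. Q m)"
  shows "comp_dim (quotient_module N I) (quotient_grading N I k) =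
    card (mons N k) - card {m \<in> mons N k. Q m}"
proof -
  let ?U = "quotient_module N I" and ?R = "poly_ring N :: 'k mpoly ring"
  interpret I: ideal I ?R by (rule I)
  interpret h: ring_hom_ring ?R "?R Quot I" "(+>\<^bsub>?R\<^esub>) I"
    by (rule I.rcos_ring_hom_ring)
  interpret M: module ?R ?U by (rule module_quotient_module[OF I])
  interpret H: subgroup "homog_part N k" "add_monoid ?R" by (rule homog_part_subgroup)
  let ?W = "component_space ?U (quotient_grading N I k)"
  let ?J = "free_index (\<lambda>_. N) {()} (\<lambda>_. 0) k"
  let ?J1 = "{j \<in> ?J. Q (snd j)}"
  let ?e = "unit_fun :: _ \<Rightarrow> unit \<Rightarrow> 'k mpoly"
  have fJ: "finite ?J" by simp
  have hR: "p \<in> carrier ?R" if "p \<in> homog_part N k" for p :: "'k mpoly"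
    using that by (simp add: homog_part_def)
  have sp: "f \<in> fvec.span (?e ` ?J) \<longleftrightarrow> f () \<in> homog_part N k" for f
    by (subst span_free_comp) (auto simp: free_comp_def free_part_def homog_part_def)
  have sub: "subgroup (quotient_grading N I k) (add_monoid ?U)"
  proof
    have qg: "x \<in> quotient_grading N I k \<longleftrightarrow> (\<exists>p\<in>homog_part N k. x = I +>\<^bsub>?R\<^esub> p)" for x
      by (auto simp: quotient_grading_def)
    show "quotient_grading N I k \<subseteq> carrier (add_monoid ?U)"
      using hR by (auto simp: quotient_grading_def)
    show "\<one>\<^bsub>add_monoid ?U\<^esub> \<in> quotient_grading N I k"
      using h.hom_zero H.one_closed unfolding qg by force
    fix x assume "x \<in> quotient_grading N I k"
    then obtain p where p: "p \<in> homog_part N k" "x = I +>\<^bsub>?R\<^esub> p" unfolding qg by blast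
    show "inv\<^bsub>add_monoid ?U\<^esub> x \<in> quotient_grading N I k"
    proof -
      have m: "- p \<in> homog_part N k"
        using H.m_inv_closed[OF p(1)] poly_ring_a_inv[OF hR[OF p(1)]] by simp
      have "(I +>\<^bsub>?R\<^esub> (- p)) \<oplus>\<^bsub>?U\<^esub> x = \<zero>\<^bsub>?U\<^esub>"
        using h.hom_add[of "- p" p] h.hom_zero hR[OF p(1)] hR[OF m] by (simp add: p(2))
      then have "\<ominus>\<^bsub>?U\<^esub> x = I +>\<^bsub>?R\<^esub> (- p)"
        using hR[OF p(1)] hR[OF m] by (intro M.minus_equality) (simp_all add: p(2))
      then show ?thesis unfolding qg a_inv_def using m by blast
    qed
    fix y assume "y \<in> quotient_grading N I k"
    then obtain q where q: "q \<in> homog_part N k" "y = I +>\<^bsub>?R\<^esub> q" unfolding qg by blast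
    show "x \<otimes>\<^bsub>add_monoid ?U\<^esub> y \<in> quotient_grading N I k"
      unfolding qg using H.m_closed[OF p(1) q(1)] h.hom_add[OF hR[OF p(1)] hR[OF q(1)]] p(2) q(2)
      by (intro bexI[of _ "p + q"]) simp_all
  qed
  have smult: "Const c \<odot>\<^bsub>?U\<^esub> (I +>\<^bsub>?R\<^esub> p) = I +>\<^bsub>?R\<^esub> (Const c * p)" if "p \<in> carrier ?R" for c p
    using h.hom_mult[of "Const c" p] that by simp
  have chom: "Const c * p \<in> homog_part N k" if "p \<in> homog_part N k" for c and p :: "'k mpoly"
  proof -
    have "keys (Const c * p) \<subseteq> keys p" by (auto simp: in_keys_iff)
    then show ?thesis using that by (auto simp: homog_part_def)
  qed
  have W: "vectorspace field_ring ?W"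
    unfolding vectorspace_def
  proof (intro conjI field_field_ring module_component_space[OF module_quotient_module[OF I] sub])
    show "Const c \<odot>\<^bsub>?U\<^esub> v \<in> quotient_grading N I k" if v: "v \<in> quotient_grading N I k" for c v
    proof -
      obtain p where p: "p \<in> homog_part N k" "v = I +>\<^bsub>?R\<^esub> p"
        using v by (auto simp: quotient_grading_def)
      show ?thesis
        unfolding p(2) smult[OF hR[OF p(1)]] quotient_grading_def using chom[OF p(1)] by blast
    qed
  qed
  have J1: "?J1 \<subseteq> ?J" by blast
  have "VectorSpace.vectorspace.dim field_ring ?W = card (?e ` ?J) - card (?e ` ?J1)"
  proof (rule fvec.dim_quotient[where T = "\<lambda>f. I +>\<^bsub>?R\<^esub> f ()", OF W])
    show "finite (?e ` ?J)" "fvec.independent (?e ` ?J)" "?e ` ?J1 \<subseteq> ?e ` ?J"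
      using fJ unit_fun_independent(2)[OF fJ] by auto
    fix f assume "f \<in> fvec.span (?e ` ?J)"
    then have f: "f () \<in> homog_part N k" by (simp add: sp)
    show "I +>\<^bsub>?R\<^esub> f () \<in> carrier ?W"
      using f by (simp add: component_space_def quotient_grading_def)
    show "I +>\<^bsub>?R\<^esub> fscale (Const c) f () = c \<odot>\<^bsub>?W\<^esub> (I +>\<^bsub>?R\<^esub> f ())" for c
      using smult[OF hR[OF f]] by (simp add: component_space_def fscale_def)
    show "(I +>\<^bsub>?R\<^esub> f () = \<zero>\<^bsub>?W\<^esub>) = (f \<in> fvec.span (?e ` ?J1))"
    proof -
      have "(I +>\<^bsub>?R\<^esub> f () = \<zero>\<^bsub>?W\<^esub>) \<longleftrightarrow> f () \<in> I"
        using I.rcos_const_imp_mem[OF hR[OF f]] I.a_rcos_zero[OF I]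
        by (auto simp: component_space_def FactRing_def)
      also have "\<dots> \<longleftrightarrow> (\<forall>m\<in>keys (f ()). Q m)" by (rule mem[OF hR[OF f]])
      also have "\<dots> \<longleftrightarrow> f \<in> fvec.span (?e ` ?J1)"
        using f finite_subset[OF J1 fJ]
        by (subst in_span_unit_fun)
           (auto simp: homog_part_def free_index_def mons_def mem_poly_ring)
      finally show ?thesis .
    qed
    fix g assume "g \<in> fvec.span (?e ` ?J)"
    then have g: "g () \<in> homog_part N k" by (simp add: sp)
    show "I +>\<^bsub>?R\<^esub> (f + g) () = (I +>\<^bsub>?R\<^esub> f ()) \<oplus>\<^bsub>?W\<^esub> (I +>\<^bsub>?R\<^esub> g ())"
      using h.hom_add[OF hR[OF f] hR[OF g]] by (simp add: component_space_def)
  next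
    show "carrier ?W \<subseteq> (\<lambda>f. I +>\<^bsub>?R\<^esub> f ()) ` fvec.span (?e ` ?J)"
    proof
      fix x assume "x \<in> carrier ?W"
      then obtain p where "p \<in> homog_part N k" "x = I +>\<^bsub>?R\<^esub> p"
        by (auto simp: component_space_def quotient_grading_def)
      then show "x \<in> (\<lambda>f. I +>\<^bsub>?R\<^esub> f ()) ` fvec.span (?e ` ?J)"
        by (intro image_eqI[of _ _ "\<lambda>_. p"]) (simp_all add: sp)
    qed
  qed
  also have "card (?e ` ?J) = card ?J"
    by (rule card_image[OF unit_fun_independent(1)[OF fJ]])
  also have "card (?e ` ?J1) = card ?J1"
    by (rule card_image[OF unit_fun_independent(1)[OF finite_subset[OF J1 fJ]]])
  also have "?J = Pair () ` mons N k" by (auto simp: free_index_def)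
  also have "{j \<in> Pair () ` mons N k. Q (snd j)} = Pair () ` {m \<in> mons N k. Q m}" by auto
  finally show ?thesis by (simp add: card_image inj_on_def)
qed

section \<open>The ideal \<open>I_nr\<close> and the Hilbert series of its quotient\<close>

definition sqfree_mon :: "nat set \<Rightarrow> nat \<Rightarrow>\<^sub>0 nat" where
  "sqfree_mon A = (\<Sum>j\<in>A. single j 1)"

lemma lookup_sqfree_mon: "finite A \<Longrightarrow> lookup (sqfree_mon A) i = (if i \<in> A then 1 else 0)"
  by (simp add: sqfree_mon_def lookup_sum lookup_single when_def)

lemma keys_sqfree_mon: "finite A \<Longrightarrow> keys (sqfree_mon A) = A"
  by (auto simp: in_keys_iff lookup_sqfree_mon split: if_splits)

lemma mono_deg_sqfree_mon: "finite A \<Longrightarrow> mono_deg (sqfree_mon A) = card A"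
  by (simp add: mono_deg_def keys_sqfree_mon lookup_sqfree_mon)

lemma prod_Var: "finite A \<Longrightarrow> (\<Prod>j\<in>A. Var j) = single (sqfree_mon A) (1 :: 'k::field)"
  by (induction A rule: finite_induct) (simp_all add: sqfree_mon_def Var_def mult_single)

lemma sqfree_mon_diff:
  assumes "finite A" "A \<subseteq> keys m"
  shows "sqfree_mon A + (m - sqfree_mon A) = m"
proof (rule poly_mapping_eqI)
  fix i
  show "lookup (sqfree_mon A + (m - sqfree_mon A)) i = lookup m i"
    using assms by (auto simp: lookup_add lookup_minus lookup_sqfree_mon in_keys_iff subset_iff Suc_le_eq)
qed

text \<open>The polynomials all of whose monomials satisfy the condition form an ideal containing
  the generators, hence containing \<open>I_nr\<close>. Conversely, a monomial satisfying it is a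
  generator times another monomial.\<close>

lemma mem_I_nr:
  assumes r: "1 \<le> r" and n: "1 \<le> n" and N: "N = n + r - 1"
  shows "ideal (I_nr n r) (poly_ring N :: 'k::field mpoly ring)"
    "p \<in> carrier (poly_ring N :: 'k mpoly ring) \<Longrightarrow> p \<in> I_nr n r \<longleftrightarrow>
      (\<forall>m\<in>keys p. {1..r - 1} \<subseteq> keys m \<and> keys m \<inter> {r..N} \<noteq> {})"
proof -
  let ?R = "poly_ring N :: 'k mpoly ring"
  let ?g = "\<lambda>i. (\<Prod>j\<in>{1..r - 1}. Var j) * Var i :: 'k mpoly"
  define Q where "Q m \<longleftrightarrow> {1..r - 1} \<subseteq> keys m \<and> keys m \<inter> {r..N} \<noteq> {}"
    for m :: "nat \<Rightarrow>\<^sub>0 nat"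
  interpret R: cring ?R by (rule cring_poly_ring)
  have Idef: "I_nr n r = Idl\<^bsub>?R\<^esub> (?g ` {r..N})"
    using r N by (simp add: I_nr_def add.commute)
  have g: "?g i = single (sqfree_mon (insert i {1..r - 1})) 1" if "i \<in> {r..N}" for i
  proof -
    have "i \<notin> {1..r - 1}" using that r by auto
    then show ?thesis by (simp add: prod_Var[symmetric] mult.commute)
  qed
  have gR: "?g ` {r..N} \<subseteq> carrier ?R"
  proof
    fix q assume "q \<in> ?g ` {r..N}"
    then obtain i where i: "i \<in> {r..N}" "q = ?g i" by blast
    show "q \<in> carrier ?R"
      unfolding i(2) g[OF i(1)] using i(1) r N by (auto simp: mem_poly_ring keys_sqfree_mon)
  qed
  show I: "ideal (I_nr n r) ?R"
    unfolding Idef by (rule R.genideal_ideal[OF gR])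
  then interpret I: ideal "I_nr n r" ?R .
  have Qadd: "Q (a + b)" if "Q b" for a b
    using that by (auto simp: Q_def keys_add_nat)
  let ?S = "{p \<in> carrier ?R. \<forall>m\<in>keys p. Q m}"
  have S: "ideal ?S ?R"
  proof (rule idealI[OF R.ring_axioms])
    show "subgroup ?S (add_monoid ?R)"
    proof
      fix p q assume pq: "p \<in> ?S" "q \<in> ?S"
      then show "p \<otimes>\<^bsub>add_monoid ?R\<^esub> q \<in> ?S"
        using keys_add[of p q] by auto
      show "inv\<^bsub>add_monoid ?R\<^esub> p \<in> ?S"
        using pq poly_ring_a_inv[of p N] by simp
    qed auto
    have *: "x * a \<in> ?S" if "a \<in> ?S" "x \<in> carrier ?R" for a x
    proof -
      have "Q m" if m: "m \<in> keys (x * a)" for m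
      proof -
        obtain u v where "v \<in> keys a" "m = u + v"
          using subsetD[OF keys_mult m] by blast
        then show ?thesis using Qadd \<open>a \<in> ?S\<close> by blast
      qed
      then show ?thesis using that by auto
    qed
    then show "x \<otimes>\<^bsub>?R\<^esub> a \<in> ?S" "a \<otimes>\<^bsub>?R\<^esub> x \<in> ?S" if "a \<in> ?S" "x \<in> carrier ?R" for a x
      using that by (simp_all add: mult.commute)
  qed
  have "?g ` {r..N} \<subseteq> ?S"
  proof
    fix q assume "q \<in> ?g ` {r..N}"
    moreover from this have "q \<in> carrier ?R" using gR by blast
    ultimately show "q \<in> ?S"
      using g by (auto simp: Q_def keys_sqfree_mon)
  qed
  then have 1: "I_nr n r \<subseteq> ?S" unfolding Idef by (rule R.genideal_minimal[OF S])
  have 2: "p \<in> I_nr n r" if p: "p \<in> ?S" for p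
  proof -
    have m: "single m c \<in> I_nr n r" if mk: "m \<in> keys p" for m and c :: 'k
    proof -
      obtain i where i: "i \<in> {r..N}" "i \<in> keys m" "{1..r - 1} \<subseteq> keys m"
        using p mk unfolding Q_def by blast
      let ?w = "sqfree_mon (insert i {1..r - 1})"
      have wm: "?w + (m - ?w) = m" by (rule sqfree_mon_diff) (use i in auto)
      have "keys m = keys ?w \<union> keys (m - ?w)"
        by (metis wm keys_add_nat)
      moreover have "keys m \<subseteq> {1..N}" using p mk by (auto simp: mem_poly_ring)
      ultimately have "single (m - ?w) c \<in> carrier ?R" by (simp add: mem_poly_ring)
      moreover have "?g i \<in> I_nr n r"
        unfolding Idef using R.genideal_self[OF gR] i(1) by blast
      ultimately have "?g i * single (m - ?w) c \<in> I_nr n r"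
        using I.I_r_closed by force
      then show ?thesis unfolding g[OF i(1)] mult_single wm by simp
    qed
    have "(\<Sum>m\<in>A. single m (lookup p m)) \<in> I_nr n r"
      if "A \<subseteq> keys p" for A
      using finite_subset[OF that finite_keys] that
    proof (induction A rule: finite_induct)
      case empty
      then show ?case using I.zero_closed by simp
    next
      case (insert x F)
      then show ?case using m[of x "lookup p x"] I.a_closed by force
    qed
    from this[OF order_refl] show ?thesis by (simp only: poly_sum_monomials[symmetric])
  qed
  show "p \<in> carrier ?R \<Longrightarrow> p \<in> I_nr n r \<longleftrightarrow>
      (\<forall>m\<in>keys p. {1..r - 1} \<subseteq> keys m \<and> keys m \<inter> {r..N} \<noteq> {})"
    using 1 2 unfolding Q_def by blast
qed

text \<open>Dividing by the product of the first \<open>r - 1\<close> variables maps the monomials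
  of the ideal bijectively to those of degree \<open>k - (r - 1)\<close> in which a later variable
  occurs; the ones missed are those in the first \<open>r - 1\<close> variables alone.\<close>

lemma card_I_nr_monomials:
  assumes r: "1 \<le> r" "r - 1 \<le> N"
  shows "card {m \<in> mons N k. {1..r - 1} \<subseteq> keys m \<and> keys m \<inter> {r..N} \<noteq> {}} +
      card (mons (r - 1) (k - int (r - 1))) = card (mons N (k - int (r - 1)))"
proof -
  let ?w = "sqfree_mon {1..r - 1}" and ?k = "k - int (r - 1)"
  have deg: "mono_deg ?w = r - 1" by (simp add: mono_deg_sqfree_mon)
  have keys: "keys ?w = {1..r - 1}" by (simp add: keys_sqfree_mon)
  have sub: "mons (r - 1) ?k \<subseteq> mons N ?k" using r by (auto simp: mons_def)
  have "{m \<in> mons N k. {1..r - 1} \<subseteq> keys m \<and> keys m \<inter> {r..N} \<noteq> {}} =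
      (+) ?w ` (mons N ?k - mons (r - 1) ?k)" (is "?A = ?B")
  proof (intro equalityI subsetI)
    fix m assume m: "m \<in> ?A"
    have wm: "?w + (m - ?w) = m" using m by (intro sqfree_mon_diff) auto
    have km: "keys m = {1..r - 1} \<union> keys (m - ?w)"
      by (metis wm keys_add_nat keys)
    have "mono_deg m = r - 1 + mono_deg (m - ?w)" by (metis wm mono_deg_add deg)
    then have "m - ?w \<in> mons N ?k" using m km by (auto simp: mons_def)
    moreover have "m - ?w \<notin> mons (r - 1) ?k"
    proof
      assume "m - ?w \<in> mons (r - 1) ?k"
      then have "keys m \<subseteq> {1..r - 1}" using km by (simp add: mons_def)
      moreover obtain x where "x \<in> keys m" "r \<le> x" using m by auto
      ultimately show False using r by auto
    qed
    ultimately show "m \<in> ?B" using wm by (metis DiffI imageI)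
  next
    fix m assume "m \<in> ?B"
    then obtain m' where m': "m = ?w + m'" "m' \<in> mons N ?k" "m' \<notin> mons (r - 1) ?k" by blast
    have "\<not> keys m' \<subseteq> {1..r - 1}" "keys m' \<subseteq> {1..N}"
      using m' by (auto simp: mons_def)
    then have "keys m' \<inter> {r..N} \<noteq> {}" by (fastforce simp: not_le)
    then show "m \<in> ?A" using m' r by (auto simp: mons_def keys_add_nat keys deg)
  qed
  moreover have "card ?B = card (mons N ?k - mons (r - 1) ?k)" by (simp add: card_image)
  ultimately show ?thesis
    using card_Diff_subset[OF finite_mons sub] card_mono[OF finite_mons sub] by simp
qed

text \<open>The series of \<open>S\<close> minus that of the ideal. As
  \<open>mons_fps (r - 1)\<close> is \<open>(1 - t)^n\<close> times
  \<open>mons_fps (n + r - 1)\<close>, this is the rational function with denominator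
  \<open>(1 - t)^N\<close>.\<close>

definition hilbert_fps :: "nat \<Rightarrow> nat \<Rightarrow> int fps" where
  "hilbert_fps n r = mons_fps (n + r - 1) - fps_X ^ (r - 1) * (mons_fps (n + r - 1) - mons_fps (r - 1))"

lemma dim_S_mod_I_nr:
  assumes r: "1 \<le> r" and n: "1 \<le> n" and N: "N = n + r - 1"
  shows "int (comp_dim (quotient_module N (I_nr n r :: 'k::field mpoly set)) (quotient_grading N (I_nr n r) k)) =
    (if k < 0 then 0 else fps_nth (hilbert_fps n r) (nat k))"
proof -
  let ?A = "{m \<in> mons N k. {1..r - 1} \<subseteq> keys m \<and> keys m \<inter> {r..N} \<noteq> {}}"
  have "card ?A \<le> card (mons N k)" by (intro card_mono) auto
  moreover have "comp_dim (quotient_module N (I_nr n r :: 'k mpoly set)) (quotient_grading N (I_nr n r) k) =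
      card (mons N k) - card ?A"
    by (rule dim_monomial_quotient) (rule mem_I_nr[OF r n N]; assumption)+
  moreover have "card ?A + card (mons (r - 1) (k - int (r - 1))) = card (mons N (k - int (r - 1)))"
    using card_I_nr_monomials[of r N k] r n N by simp
  ultimately have d: "int (comp_dim (quotient_module N (I_nr n r :: 'k mpoly set)) (quotient_grading N (I_nr n r) k)) =
      int (card (mons N k)) -
      (int (card (mons N (k - int (r - 1)))) - int (card (mons (r - 1) (k - int (r - 1)))))"
    by linarith
  show ?thesis
  proof (cases "k < 0")
    case True
    then show ?thesis using d by (simp add: mons_neg)
  next
    case False
    then obtain j where j: "k = int j" using nat_0_le by (metis not_less)
    have "int j - int (r - 1) = int (j - (r - 1))" if "\<not> j < r - 1" using that by linarith
    then show ?thesis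
      using d by (cases "j < r - 1")
        (simp_all add: j hilbert_fps_def N[symmetric] fps_X_power_mult_nth mons_neg)
  qed
qed

section \<open>The lower bound\<close>

text \<open>A truncation of the series of \<open>(1 - x)^(-2)\<close>; its coefficients are those of
  \<open>(1 - x^s) / (1 - x)^2\<close> below degree \<open>s\<close>.\<close>

lemma sum_Suc_power:
  fixes x :: "'a::comm_ring_1"
  shows "(1 - x) ^ 2 * (\<Sum>k<s. of_nat (Suc k) * x ^ k) = 1 - of_nat (Suc s) * x ^ s + of_nat s * x ^ Suc s"
  by (induction s) (simp_all add: algebra_simps power2_eq_square)

text \<open>The coefficients of \<open>(1 - t)\<^sup>N\<^sup>-\<^sup>2\<close> times the Hilbert series of \<open>S/I\<close>, with
  \<open>s = r - 1\<close> and \<open>m = n - 2\<close>; from degree \<open>s + m + 1\<close> on they are constantly \<open>s\<close>.\<close>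

definition hdepth_coeff :: "nat \<Rightarrow> nat \<Rightarrow> nat \<Rightarrow> int" where
  "hdepth_coeff m s k = (if k < s then int (Suc k)
     else if k < s + Suc m then int s + (- 1) ^ (k - s) * int (m choose (k - s)) else int s)"

text \<open>A negative sign can do no harm because no binomial of \<open>m\<close> exceeds the
  central one. With \<open>s = r - 1\<close> and \<open>m = n - 2\<close> the premise is the bound
  on \<open>r\<close> in the theorem.\<close>

lemma hdepth_coeff_nonneg:
  assumes "m choose (m div 2) \<le> s"
  shows "0 \<le> hdepth_coeff m s k"
proof -
  have "int (m choose (k - s)) \<le> int s"
    using binomial_maximum[of m "k - s"] assms by linarith
  then have "0 \<le> int s + (- 1) ^ (k - s) * int (m choose (k - s))"
    by (cases "even (k - s)") auto
  then show ?thesis by (simp add: hdepth_coeff_def)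
qed

lemma sum_lessThan_add: "(\<Sum>k<s + m. f k) = (\<Sum>k<s. f k) + (\<Sum>j<m. f (s + j))"
  for f :: "nat \<Rightarrow> 'a::comm_monoid_add"
  by (induction m) (simp_all add: add_ac)

text \<open>The right-hand side divided by \<open>(1 - x)^2\<close> has two parts:
  \<open>(1 - x^s) / (1 - x)^2\<close>, with coefficients \<open>k + 1\<close> below
  \<open>s\<close> and \<open>s\<close> from there on, and \<open>x^s (1 - x)^m\<close>, which adds
  the signed binomials. The second term on the left is the constant tail
  \<open>s x^(s+m+1) / (1 - x)\<close> after multiplication by \<open>(1 - x)^2\<close>.\<close>

lemma hdepth_coeff_sum:
  fixes x :: "'a::comm_ring_1"
  shows "(1 - x) ^ 2 * (\<Sum>k<s + Suc m. of_int (hdepth_coeff m s k) * x ^ k) +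
      (1 - x) * (of_nat s * x ^ (s + Suc m)) = 1 - x ^ s + x ^ s * (1 - x) ^ (m + 2)"
proof -
  have 1: "(\<Sum>k<s. of_int (hdepth_coeff m s k) * x ^ k) = (\<Sum>k<s. of_nat (Suc k) * x ^ k)"
    by (intro sum.cong) (simp_all add: hdepth_coeff_def)
  have "(1 - x) ^ m = (- x + 1) ^ m" by simp
  also have "\<dots> = (\<Sum>j\<le>m. of_nat (m choose j) * (- x) ^ j)"
    unfolding binomial_ring by simp
  also have "\<dots> = (\<Sum>j<Suc m. (- 1) ^ j * of_nat (m choose j) * x ^ j)"
    unfolding lessThan_Suc_atMost by (intro sum.cong refl) (subst power_minus, simp add: mult_ac)
  finally have b: "(1 - x) ^ m = (\<Sum>j<Suc m. (- 1) ^ j * of_nat (m choose j) * x ^ j)" .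
  have "(\<Sum>j<Suc m. of_int (hdepth_coeff m s (s + j)) * x ^ (s + j)) =
      (\<Sum>j<Suc m. x ^ s * (of_nat s * x ^ j + (- 1) ^ j * of_nat (m choose j) * x ^ j))"
    by (intro sum.cong) (simp_all add: hdepth_coeff_def power_add algebra_simps)
  also have "\<dots> = x ^ s * (of_nat s * (\<Sum>j<Suc m. x ^ j) + (1 - x) ^ m)"
    unfolding b by (simp only: sum_distrib_left[symmetric] sum.distrib)
  finally have 2: "(\<Sum>k<s + Suc m. of_int (hdepth_coeff m s k) * x ^ k) =
      (\<Sum>k<s. of_nat (Suc k) * x ^ k) + x ^ s * (of_nat s * (\<Sum>j<Suc m. x ^ j) + (1 - x) ^ m)"
    unfolding sum_lessThan_add 1 by simp
  have g: "(1 - x) * (\<Sum>j<Suc m. x ^ j) = 1 - x ^ Suc m"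
    by (rule one_diff_power_eq[symmetric])
  have "(1 - x) ^ 2 * (\<Sum>k<s + Suc m. of_int (hdepth_coeff m s k) * x ^ k) =
      (1 - x) ^ 2 * (\<Sum>k<s. of_nat (Suc k) * x ^ k) +
      x ^ s * (of_nat s * (1 - x) * ((1 - x) * (\<Sum>j<Suc m. x ^ j)) + (1 - x) ^ (m + 2))"
    unfolding 2 by (simp add: algebra_simps power_add power2_eq_square del: sum.lessThan_Suc)
  then show ?thesis
    unfolding g sum_Suc_power by (simp add: algebra_simps power_add)
qed

text \<open>The summand of top shift has \<open>N - 1\<close> variables because the constant tail of
  the coefficients contributes one more factor \<open>1 / (1 - t)\<close>.\<close>

lemma hilbert_fps_decomposition:
  assumes N: "N = m + s + 2"
  shows "(\<Sum>k\<le>s + Suc m. fps_const (hdepth_coeff m s k) * (fps_X ^ k * mons_fps (if k < s + Suc m then N - 2 else N - 1))) =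
    hilbert_fps (m + 2) (Suc s)"
proof -
  let ?X = "fps_X :: int fps" and ?A = "mons_fps N" and ?M = "s + Suc m"
  have A2: "mons_fps (N - 2) = ?A * (1 - ?X) ^ 2" using mons_fps_power[of "N - 2" 2] N by simp
  have A1: "mons_fps (N - 1) = ?A * (1 - ?X)" using mons_fps_Suc[of "N - 1"] N by simp
  have As: "mons_fps s = ?A * (1 - ?X) ^ (m + 2)"
    using mons_fps_power[of s "m + 2"] N by (simp add: add_ac)
  have c: "fps_const (hdepth_coeff m s k) = of_int (hdepth_coeff m s k)" for k
    using fps_of_int[of "hdepth_coeff m s k", where ?'a = int] by simp
  have "(\<Sum>k\<le>?M. fps_const (hdepth_coeff m s k) * (?X ^ k * mons_fps (if k < ?M then N - 2 else N - 1))) =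
      (\<Sum>k<?M. ?A * (1 - ?X) ^ 2 * (of_int (hdepth_coeff m s k) * ?X ^ k)) + of_nat s * ?X ^ ?M * mons_fps (N - 1)"
  proof -
    have "(\<Sum>k<?M. fps_const (hdepth_coeff m s k) * (?X ^ k * mons_fps (if k < ?M then N - 2 else N - 1))) =
        (\<Sum>k<?M. ?A * (1 - ?X) ^ 2 * (of_int (hdepth_coeff m s k) * ?X ^ k))"
      by (intro sum.cong) (simp_all add: A2 c mult_ac)
    moreover have "fps_const (hdepth_coeff m s ?M) = of_nat s" unfolding c by (simp add: hdepth_coeff_def)
    ultimately show ?thesis unfolding lessThan_Suc_atMost[symmetric] sum.lessThan_Suc by (simp add: mult_ac)
  qed
  also have "\<dots> = ?A * ((1 - ?X) ^ 2 * (\<Sum>k<?M. of_int (hdepth_coeff m s k) * ?X ^ k) +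
      (1 - ?X) * (of_nat s * ?X ^ ?M))"
    unfolding A1 sum_distrib_left[symmetric] by (simp only: distrib_left mult_ac)
  also have "\<dots> = ?A * (1 - ?X ^ s + ?X ^ s * (1 - ?X) ^ (m + 2))"
    unfolding hdepth_coeff_sum ..
  also have "\<dots> = hilbert_fps (m + 2) (Suc s)"
  proof -
    have "?A * (1 - a + a * y) = ?A - a * (?A - ?A * y)" for a y
      by (simp add: algebra_simps)
    moreover have "m + 2 + Suc s - 1 = N" "Suc s - 1 = s" using N by simp_all
    ultimately show ?thesis unfolding hilbert_fps_def As[symmetric] by (simp only: As)
  qed
  finally show ?thesis .
qed

lemma hdepth_lower_bound:
  assumes n: "n \<ge> 2" and r: "r \<ge> 1 + ((n - 2) choose ((n - 2) div 2))" and N: "N = n + r - 1"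
  shows "enat (n + r - 3) \<le>
    hdepth N (quotient_module N (I_nr n r :: 'k::field mpoly set)) (quotient_grading N (I_nr n r))"
proof -
  let ?Q = "quotient_module N (I_nr n r :: 'k mpoly set)" and ?H = "quotient_grading N (I_nr n r :: 'k mpoly set)"
  define m where "m = n - 2"
  define s where "s = r - 1"
  have nm: "n = m + 2" using n by (simp add: m_def)
  have ms: "m choose (m div 2) \<le> s" using r by (simp add: m_def s_def)
  moreover have "0 < m choose (m div 2)" by simp
  ultimately have s: "0 < s" by linarith
  then have rs: "r = Suc s" by (simp add: s_def)
  have Nms: "N = m + s + 2" using N nm rs by simp
  let ?M = "s + Suc m"
  define c where "c k = nat (hdepth_coeff m s k)" for k
  have c: "int (c k) = hdepth_coeff m s k" for k
    unfolding c_def using hdepth_coeff_nonneg[OF ms] by simp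
  \<comment> \<open>Each shift \<open>k\<close> up to \<open>s + m + 1\<close> is taken with
    multiplicity \<open>c k\<close>; nonnegativity of the coefficients makes these honest
    multiplicities.\<close>
  define J where "J = (SIGMA k:{..?M}. {..<c k})"
  define \<nu> :: "nat \<times> nat \<Rightarrow> nat" where "\<nu> i = (if fst i < ?M then N - 2 else N - 1)" for i
  define \<delta> :: "nat \<times> nat \<Rightarrow> int" where "\<delta> i = int (fst i)" for i
  let ?U = "free_module \<nu> J :: ('k mpoly, nat \<times> nat \<Rightarrow> 'k mpoly) module"
  have fJ: "finite J" by (simp add: J_def)
  \<comment> \<open>This needs \<open>s > 0\<close> and ensures that the direct sum is nonzero; the
    zero module would have depth \<open>0\<close>.\<close>
  have "c 0 = 1" using s by (simp add: c_def hdepth_coeff_def)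
  then have "(0, 0) \<in> J" by (simp add: J_def)
  then have J0: "J \<noteq> {}" by blast
  have "int (comp_dim ?U (free_comp \<nu> J \<delta> k)) =
      int (comp_dim ?Q (?H k))" for k
  proof -
    have "int (comp_dim ?U (free_comp \<nu> J \<delta> k)) =
        (\<Sum>(j, l)\<in>J. int (card (mons (\<nu> (j, l)) (k - \<delta> (j, l)))))"
      unfolding dim_free_comp[OF fJ] by (simp add: split_def)
    also have "\<dots> = (\<Sum>j\<le>?M. \<Sum>l<c j. int (card (mons (\<nu> (j, l)) (k - \<delta> (j, l)))))"
      unfolding J_def by (subst sum.Sigma) auto
    also have "\<dots> = (\<Sum>j\<le>?M. hdepth_coeff m s j * int (card (mons (if j < ?M then N - 2 else N - 1) (k - int j))))"
      by (simp add: \<nu>_def \<delta>_def c)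
    also have "\<dots> = (if k < 0 then 0 else fps_nth (hilbert_fps n r) (nat k))"
    proof (cases "k < 0")
      case True
      then show ?thesis by (simp add: mons_neg)
    next
      case False
      then obtain d where d: "k = int d" using nat_0_le by (metis not_less)
      have "fps_nth (hilbert_fps n r) d = (\<Sum>j\<le>?M. hdepth_coeff m s j *
          fps_nth (fps_X ^ j * mons_fps (if j < ?M then N - 2 else N - 1)) d)"
        unfolding nm rs hilbert_fps_decomposition[OF Nms, symmetric] fps_sum_nth
        by (simp only: fps_mult_left_const_nth)
      also have "\<dots> = (\<Sum>j\<le>?M. hdepth_coeff m s j * int (card (mons (if j < ?M then N - 2 else N - 1) (k - int j))))"
      proof (intro sum.cong refl arg_cong2[where f = "(*)"])
        fix j
        show "fps_nth (fps_X ^ j * mons_fps (if j < ?M then N - 2 else N - 1)) d =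
            int (card (mons (if j < ?M then N - 2 else N - 1) (k - int j)))"
          by (cases "d < j") (simp_all add: fps_X_power_mult_nth d mons_neg of_nat_diff)
      qed
      finally show ?thesis using False by (simp add: d)
    qed
    also have "\<dots> = int (comp_dim ?Q (?H k))"
      by (rule dim_S_mod_I_nr[symmetric]) (use n rs N in auto)
    finally show ?thesis .
  qed
  then have "hilbert_series ?U (free_comp \<nu> J \<delta>) =
      hilbert_series ?Q ?H"
    unfolding hilbert_series_def by presburger
  moreover have "fin_gen N ?U" by (rule fin_gen_free_module[OF fJ]) (simp add: \<nu>_def)
  ultimately have "depth N ?U \<le>
      hdepth N ?Q ?H"
    using graded_free_module[OF fJ] by (intro depth_le_hdepth)
  moreover have "enat (N - 2) \<le> depth N ?U"
    by (rule depth_free_module[OF _ _ J0]) (auto simp: \<nu>_def)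
  moreover have "N - 2 = n + r - 3" using N by simp
  ultimately show ?thesis by simp
qed

section \<open>Freeness from Koszul homology\<close>

context vector_space
begin

text \<open>A basis of \<open>A\<close> is extended to one of \<open>V\<close>, and the added
  vectors represent a basis of \<open>V/A\<close>. Stating this through coefficients avoids forming
  the quotient.\<close>

lemma complement_basis:
  assumes A: "subspace A" and V: "subspace V" and AV: "A \<subseteq> V" and T: "V \<subseteq> span T" "finite T"
  shows "\<exists>B. finite B \<and> B \<subseteq> V \<and> (\<forall>z\<in>V. \<exists>c. z - (\<Sum>b\<in>B. c b *s b) \<in> A) \<and>
    (\<forall>c. (\<Sum>b\<in>B. c b *s b) \<in> A \<longrightarrow> (\<forall>b\<in>B. c b = 0))"
proof -
  obtain B1 where B1: "B1 \<subseteq> A" "independent B1" "A \<subseteq> span B1"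
    using maximal_independent_subset by blast
  have sB1: "span B1 = A" using B1 span_minimal[OF B1(1) A] by blast
  obtain B2 where B2: "B1 \<subseteq> B2" "B2 \<subseteq> V" "independent B2" "V \<subseteq> span B2"
    using maximal_independent_subset_extend[of B1 V] B1 AV by blast
  have fB2: "finite B2" using independent_span_bound[OF T(2) B2(3)] B2(2) T(1) by blast
  have "\<exists>c. z - (\<Sum>b\<in>B2 - B1. c b *s b) \<in> A" if z: "z \<in> V" for z
  proof -
    obtain u where u: "z = (\<Sum>v\<in>B2. u v *s v)"
      using z B2(4) span_finite[OF fB2] by auto
    have "z - (\<Sum>b\<in>B2 - B1. u b *s b) = (\<Sum>v\<in>B1. u v *s v)"
      unfolding u sum.subset_diff[OF B2(1) fB2] by simp
    also have "\<dots> \<in> span B1" by (intro span_sum span_scale span_base)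
    finally show ?thesis using sB1 by blast
  qed
  moreover have "\<forall>b\<in>B2 - B1. c b = 0" if "(\<Sum>b\<in>B2 - B1. c b *s b) \<in> A" for c
    using span_disjoint_coeffs_0[OF fB2 B2(3,1), of c] that sB1 by blast
  ultimately show ?thesis
    using fB2 B2(2) by (intro exI[of _ "B2 - B1"]) auto
qed

end

section \<open>Homogeneous components of free modules\<close>

lemma free_comp_neg:
  fixes f :: "'i \<Rightarrow> 'k::field mpoly"
  assumes "\<And>i. i \<in> I \<Longrightarrow> 0 \<le> \<delta> i" "k < 0" "f \<in> free_comp \<nu> I \<delta> k"
  shows "f = 0"
proof
  fix i
  have "keys (f i) = {}"
  proof (cases "i \<in> I")
    case True
    then show ?thesis using assms by (fastforce simp: free_comp_def)
  qed (use assms(3) in \<open>auto simp: free_comp_def free_part_def\<close>)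
  then show "f i = 0 i" by simp
qed

lemma free_comp_subspace: "fvec.subspace (free_comp \<nu> I \<delta> k :: ('i \<Rightarrow> 'k::field mpoly) set)"
proof (rule fvec.subspaceI)
  fix c and f :: "'i \<Rightarrow> 'k mpoly" assume f: "f \<in> free_comp \<nu> I \<delta> k"
  have "fscale (Const c) f \<in> free_part \<nu> I"
    using f by (intro free_part_closed) (auto simp: free_comp_def)
  then have "hom_part \<delta> k (fscale (Const c) f) \<in> free_comp \<nu> I \<delta> k" by (rule hom_part_in_free_comp)
  then show "fscale (Const c) f \<in> free_comp \<nu> I \<delta> k"
    using hom_part_id[OF f] by (simp add: hom_part_Const)
qed (auto intro: free_comp_closed)

lemma scale_free_comp:
  assumes p: "p \<in> polys N" "\<And>m. m \<in> keys p \<Longrightarrow> int (mono_deg m) = e"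
    and y: "y \<in> free_comp (\<lambda>_. N) I \<delta> k"
  shows "fscale p y \<in> free_comp (\<lambda>_. N) I \<delta> (e + k)"
  unfolding free_comp_def
proof (intro CollectI conjI allI ballI)
  show "fscale p y \<in> free_part (\<lambda>_. N) I"
    using p y by (intro free_part_closed) (auto simp: free_comp_def)
  fix i m assume "m \<in> keys (fscale p y i)"
  then obtain a b where "a \<in> keys p" "b \<in> keys (y i)" "m = a + b"
    using keys_mult[of p "y i"] unfolding fscale_def by blast
  moreover from this have "int (mono_deg b) + \<delta> i = k" using y by (auto simp: free_comp_def)
  ultimately show "int (mono_deg m) + \<delta> i = e + k" using p(2) by fastforce
qed

lemma Var_free_comp:
  assumes "y \<in> free_comp (\<lambda>_. N) I \<delta> (k - 1)" "j \<in> {1..N}"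
  shows "fscale (Var j) y \<in> free_comp (\<lambda>_. N) I \<delta> k"
  using scale_free_comp[of "Var j" N 1 y I \<delta> "k - 1"] assms by (simp add: Var_def mem_poly_ring)

lemma koszul_sign_mult_cases: "koszul_sign j A * x = x \<or> koszul_sign j A * x = - x"
  by (simp add: koszul_sign_def minus_one_power_iff)

lemma fscale_uminus_left: "fscale (- s) f = - fscale s f"
  by (rule fmod.scale_minus_left)

lemma sign_Var_free_comp:
  fixes y :: "'i \<Rightarrow> 'k::field mpoly"
  assumes "y \<in> free_comp (\<lambda>_. N) I \<delta> (k - 1)" "l \<in> {1..N}"
  shows "fscale (koszul_sign j A * Var l) y \<in> free_comp (\<lambda>_. N) I \<delta> k"
  using koszul_sign_mult_cases[of j A "Var l :: 'k mpoly"] Var_free_comp[OF assms]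
  by (elim disjE ssubst) (simp_all only: fscale_uminus_left free_comp_closed)

lemma hom_part_sign_Var:
  "hom_part \<delta> k (fscale (koszul_sign j A * Var l) f) = fscale (koszul_sign j A * Var l) (hom_part \<delta> (k - 1) f)"
  for f :: "'i \<Rightarrow> 'k::field mpoly"
  using koszul_sign_mult_cases[of j A "Var l :: 'k mpoly"]
  by (elim disjE ssubst) (simp_all only: fscale_uminus_left hom_part_uminus hom_part_Var)

lemma var_sub_decomp:
  "f \<in> var_sub \<nu> I k \<Longrightarrow>
    \<exists>u. (\<forall>j\<in>{1..k}. u j \<in> free_part \<nu> I) \<and> f = (\<Sum>j\<in>{1..k}. fscale (Var j) (u j))"
  for f :: "'i \<Rightarrow> 'k::field mpoly"
proof (induction k arbitrary: f)
  case 0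
  then show ?case by (simp add: var_sub_0)
next
  case (Suc k)
  obtain v w where vw: "v \<in> var_sub \<nu> I k" "w \<in> free_part \<nu> I" "f = v + fscale (Var (Suc k)) w"
    using var_sub_split[OF Suc.prems] by blast
  obtain u where u: "\<forall>j\<in>{1..k}. u j \<in> free_part \<nu> I" "v = (\<Sum>j\<in>{1..k}. fscale (Var j) (u j))"
    using Suc.IH[OF vw(1)] by blast
  let ?u = "u(Suc k := w)"
  have "(\<Sum>j\<in>{1..k}. fscale (Var j) (?u j)) = v"
    unfolding u(2) by (intro sum.cong) auto
  then have "(\<Sum>j\<in>{1..Suc k}. fscale (Var j) (?u j)) = f"
    by (simp add: vw(3))
  moreover have "\<forall>j\<in>{1..Suc k}. ?u j \<in> free_part \<nu> I" using u(1) vw(2) by auto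
  ultimately show ?case by blast
qed

text \<open>A constant term can only sit at an index of shift exactly \<open>k\<close>; every other
  monomial contains a variable. Replacing the cofactors by their homogeneous parts puts them in
  degree \<open>k - 1\<close>.\<close>

lemma free_comp_split:
  fixes f :: "'i \<Rightarrow> 'k::field mpoly"
  assumes f: "f \<in> free_comp (\<lambda>_. N) I \<delta> k"
  shows "\<exists>c t. (\<forall>j\<in>{1..N}. t j \<in> free_comp (\<lambda>_. N) I \<delta> (k - 1)) \<and>
    f = (\<lambda>i. if i \<in> I \<and> \<delta> i = k then Const (c i) else 0) + (\<Sum>j\<in>{1..N}. fscale (Var j) (t j))"
proof -
  define c where "c i = lookup (f i) 0" for i
  define w where "w i = restr (\<lambda>m. m \<noteq> 0) (f i)" for i
  have wc: "w \<in> free_comp (\<lambda>_. N) I \<delta> k"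
    using f by (auto simp: w_def free_comp_def free_part_def mem_poly_ring)
  have "w \<in> var_sub (\<lambda>_. N) I N"
    unfolding var_sub_def
  proof (intro CollectI conjI allI ballI)
    show "w \<in> free_part (\<lambda>_. N) I" using wc by (simp add: free_comp_def)
    fix i m assume m: "m \<in> keys (w i)"
    then have "m \<noteq> 0" "keys m \<subseteq> {1..N}"
      using f by (auto simp: w_def free_comp_def free_part_def mem_poly_ring)
    then show "keys m \<inter> {1..N} \<noteq> {}"
      using keys_eq_empty[of m] by blast
  qed
  then obtain u where u: "\<forall>j\<in>{1..N}. u j \<in> free_part (\<lambda>_. N) I" "w = (\<Sum>j\<in>{1..N}. fscale (Var j) (u j))"
    using var_sub_decomp by blast
  have "w = hom_part \<delta> k w" using hom_part_id[OF wc] by simp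
  also have "\<dots> = (\<Sum>j\<in>{1..N}. fscale (Var j) (hom_part \<delta> (k - 1) (u j)))"
    by (subst u(2)) (simp only: hom_part_sum hom_part_Var)
  finally have w: "w = (\<Sum>j\<in>{1..N}. fscale (Var j) (hom_part \<delta> (k - 1) (u j)))" .
  have "f = (\<lambda>i. if i \<in> I \<and> \<delta> i = k then Const (c i) else 0) + w"
  proof (rule ext, rule poly_mapping_eqI)
    fix i m
    have "c i = 0" if "\<not> (i \<in> I \<and> \<delta> i = k)"
    proof (rule ccontr)
      assume "c i \<noteq> 0"
      then have "0 \<in> keys (f i)" by (simp add: c_def in_keys_iff)
      then show False using f that by (force simp: free_comp_def free_part_def)
    qed
    then show "lookup (f i) m =
        lookup (((\<lambda>i. if i \<in> I \<and> \<delta> i = k then Const (c i) else 0) + w) i) m"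
      by (auto simp: w_def lookup_add Const_def lookup_single c_def when_def)
  qed
  moreover have "\<forall>j\<in>{1..N}. hom_part \<delta> (k - 1) (u j) \<in> free_comp (\<lambda>_. N) I \<delta> (k - 1)"
    using u(1) hom_part_in_free_comp by blast
  ultimately show ?thesis
    by (intro exI[of _ c] exI[of _ "\<lambda>j. hom_part \<delta> (k - 1) (u j)"] conjI) (simp_all only: w[symmetric])
qed

definition const_fun :: "'i set \<Rightarrow> ('i \<Rightarrow> int) \<Rightarrow> int \<Rightarrow> ('i \<Rightarrow> 'k::field) \<Rightarrow> 'i \<Rightarrow> 'k mpoly" where
  "const_fun I \<delta> k c = (\<lambda>i. if i \<in> I \<and> \<delta> i = k then Const (c i) else 0)"

lemma const_fun_in:
  fixes c :: "'a \<Rightarrow> 'b::field"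
  shows "const_fun I \<delta> k c \<in> free_comp \<nu> I \<delta> k"
proof -
  have *: "m = 0" if "m \<in> keys (Const a)" for m and a :: 'b
    using that by (simp add: Const_def split: if_splits)
  show ?thesis by (auto simp: const_fun_def free_comp_def free_part_def dest!: *)
qed

text \<open>A homogeneous submodule \<open>Z\<close> of a free module whose first Koszul homology vanishes is free:
  lifts of \<open>K\<close>-bases of the components of \<open>Z/\<mm>Z\<close> form a basis of \<open>Z\<close>.\<close>

locale koszul_acyclic =
  fixes N :: nat and I :: "'i set" and \<delta> :: "'i \<Rightarrow> int" and Z :: "('i \<Rightarrow> 'k::field mpoly) set"
  assumes finI: "finite I" and \<delta>_nonneg: "\<And>i. i \<in> I \<Longrightarrow> 0 \<le> \<delta> i"
    and Z_submod: "kos.submod N Z" and Z_sub: "Z \<subseteq> free_part (\<lambda>_. N) I"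
    and Z_hom: "\<And>z k. z \<in> Z \<Longrightarrow> hom_part \<delta> k z \<in> Z"
    and Z_exact: "kos.exact_at N Z {0} 1"
begin

abbreviation F_comp :: "int \<Rightarrow> ('i \<Rightarrow> 'k mpoly) set" where "F_comp \<equiv> free_comp (\<lambda>_. N) I \<delta>"

definition comp :: "int \<Rightarrow> ('i \<Rightarrow> 'k mpoly) set" where
  "comp k = Z \<inter> F_comp k"

text \<open>The component of degree \<open>k\<close> of the maximal ideal times \<open>Z\<close>: as
  \<open>Z\<close> is homogeneous, cofactors of degree \<open>k - 1\<close> suffice.\<close>

definition mcomp :: "int \<Rightarrow> ('i \<Rightarrow> 'k mpoly) set" where
  "mcomp k = {z. \<exists>y. (\<forall>j\<in>{1..N}. y j \<in> comp (k - 1)) \<and> z = (\<Sum>j\<in>{1..N}. fscale (Var j) (y j))}"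

lemma comp_subspace: "fvec.subspace (comp k)"
proof (rule fvec.subspaceI)
  show "0 \<in> comp k" using kos.submod_closed(1)[OF Z_submod] by (simp add: comp_def free_comp_closed)
  show "x + y \<in> comp k" if "x \<in> comp k" "y \<in> comp k" for x y
    using kos.submod_closed(2)[OF Z_submod] that by (simp add: comp_def free_comp_closed)
  show "fscale (Const c) x \<in> comp k" if "x \<in> comp k" for c x
    using kos.submod_closed(3)[OF Z_submod, of "Const c" x] that
      fvec.subspace_scale[OF free_comp_subspace] by (auto simp: comp_def)
qed

lemma Var_comp: "y \<in> comp (k - 1) \<Longrightarrow> j \<in> {1..N} \<Longrightarrow> fscale (Var j) y \<in> comp k"
  using kos.submod_closed(3)[OF Z_submod, of "Var j" y] Var_free_comp[of y N I \<delta> k j] by (auto simp: comp_def)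

lemma mcomp_subset: "mcomp k \<subseteq> comp k"
  by (auto simp: mcomp_def simp del: atLeastAtMost_iff intro!: fvec.subspace_sum[OF comp_subspace] Var_comp)

lemma mcomp_subspace: "fvec.subspace (mcomp k)"
proof (rule fvec.subspaceI)
  show "0 \<in> mcomp k"
    unfolding mcomp_def
    by (intro CollectI exI[of _ "\<lambda>_. 0"]) (simp add: fvec.subspace_0[OF comp_subspace])
  show "x + y \<in> mcomp k" if xy: "x \<in> mcomp k" "y \<in> mcomp k" for x y
  proof -
    obtain a where "\<forall>j\<in>{1..N}. a j \<in> comp (k - 1)" "x = (\<Sum>j\<in>{1..N}. fscale (Var j) (a j))"
      using xy(1) by (auto simp: mcomp_def)
    moreover obtain b where "\<forall>j\<in>{1..N}. b j \<in> comp (k - 1)" "y = (\<Sum>j\<in>{1..N}. fscale (Var j) (b j))"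
      using xy(2) by (auto simp: mcomp_def)
    ultimately show ?thesis
      unfolding mcomp_def
      by (intro CollectI exI[of _ "\<lambda>j. a j + b j"])
         (simp add: fmod.scale_right_distrib sum.distrib fvec.subspace_add[OF comp_subspace])
  qed
  show "fscale (Const c) x \<in> mcomp k" if x: "x \<in> mcomp k" for c x
  proof -
    obtain a where "\<forall>j\<in>{1..N}. a j \<in> comp (k - 1)" "x = (\<Sum>j\<in>{1..N}. fscale (Var j) (a j))"
      using x by (auto simp: mcomp_def)
    then show ?thesis
      unfolding mcomp_def
      by (intro CollectI exI[of _ "\<lambda>j. fscale (Const c) (a j)"])
         (simp add: fmod.scale_sum_right mult.commute fvec.subspace_scale[OF comp_subspace])
  qed
qed

definition complement :: "int \<Rightarrow> ('i \<Rightarrow> 'k mpoly) set \<Rightarrow> bool" where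
  "complement k B \<longleftrightarrow> finite B \<and> B \<subseteq> comp k \<and>
     (\<forall>z\<in>comp k. \<exists>c. z - (\<Sum>b\<in>B. fscale (Const (c b)) b) \<in> mcomp k) \<and>
     (\<forall>c. (\<Sum>b\<in>B. fscale (Const (c b)) b) \<in> mcomp k \<longrightarrow> (\<forall>b\<in>B. c b = 0))"

definition gens :: "int \<Rightarrow> ('i \<Rightarrow> 'k mpoly) set" where
  "gens k = (SOME B. complement k B)"

lemma gens:
  "finite (gens k)" "gens k \<subseteq> comp k"
  "z \<in> comp k \<Longrightarrow> \<exists>c. z - (\<Sum>b\<in>gens k. fscale (Const (c b)) b) \<in> mcomp k"
  "(\<Sum>b\<in>gens k. fscale (Const (c b)) b) \<in> mcomp k \<Longrightarrow> b \<in> gens k \<Longrightarrow> c b = 0"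
proof -
  have "comp k \<subseteq> fvec.span (unit_fun ` free_index (\<lambda>_. N) I \<delta> k)"
    unfolding span_free_comp[OF finI] by (auto simp: comp_def)
  then have "\<exists>B. complement k B"
    unfolding complement_def
    by (rule fvec.complement_basis[OF mcomp_subspace comp_subspace mcomp_subset]) (simp add: finI)
  from someI_ex[OF this] have "complement k (gens k)" unfolding gens_def .
  note * = this[unfolded complement_def]
  show "finite (gens k)" "gens k \<subseteq> comp k" using * by blast+
  show "\<exists>c. z - (\<Sum>b\<in>gens k. fscale (Const (c b)) b) \<in> mcomp k" if "z \<in> comp k"
    using * that by blast
  show "c b = 0" if "(\<Sum>b\<in>gens k. fscale (Const (c b)) b) \<in> mcomp k" "b \<in> gens k"
    using * that by blast
qed

text \<open>Cutting off at degree \<open>D\<close> makes the index set finite without appeal to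
  Hilbert's basis theorem, and components of degree at most \<open>D\<close> involve no later
  generators. The first entry records the degree and becomes the shift in the free module of
  coefficients.\<close>

definition ind :: "int \<Rightarrow> (int \<times> ('i \<Rightarrow> 'k mpoly)) set" where
  "ind D = (SIGMA j:{0..D}. gens j)"

text \<open>The map to \<open>Z\<close> from the free module on the truncated generators. Freeness
  of \<open>Z\<close> is expressed by its being bijective in all degrees up to
  \<open>D\<close>.\<close>

definition ev :: "int \<Rightarrow> (int \<times> ('i \<Rightarrow> 'k mpoly) \<Rightarrow> 'k mpoly) \<Rightarrow> 'i \<Rightarrow> 'k mpoly" where
  "ev D s = (\<Sum>i\<in>ind D. fscale (s i) (snd i))"

abbreviation coeff_comp :: "int \<Rightarrow> int \<Rightarrow> (int \<times> ('i \<Rightarrow> 'k mpoly) \<Rightarrow> 'k mpoly) set" where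
  "coeff_comp D \<equiv> free_comp (\<lambda>_. N) (ind D) fst"

lemma finite_ind [simp]: "finite (ind D)"
  by (simp add: ind_def gens(1))

lemma ev_add: "ev D (s + t) = ev D s + ev D t"
  by (simp add: ev_def fmod.scale_left_distrib sum.distrib)

lemma ev_diff: "ev D (s - t) = ev D s - ev D t"
  by (simp add: ev_def fmod.scale_left_diff_distrib sum_subtractf)

lemma ev_0 [simp]: "ev D 0 = 0"
  by (simp add: ev_def)

lemma ev_scale: "ev D (fscale x s) = fscale x (ev D s)"
  unfolding ev_def fmod.scale_sum_right by (intro sum.cong refl) (simp add: fscale_def mult.assoc)

lemma ev_sum: "ev D (\<Sum>a\<in>A. s a) = (\<Sum>a\<in>A. ev D (s a))"
  unfolding ev_def
  by (subst sum.swap) (intro sum.cong refl, simp add: sum_fun_apply fmod.scale_sum_left)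

lemma ev_boundary: "ev D (kos.boundary N q A) = kos.boundary N (\<lambda>A. ev D (q A)) A"
  by (simp add: kos.boundary_def ev_sum ev_scale)

lemma ev_comp:
  assumes s: "s \<in> coeff_comp D k"
  shows "ev D s \<in> comp k"
  unfolding ev_def
proof (rule fvec.subspace_sum[OF comp_subspace])
  fix i assume i: "i \<in> ind D"
  have b: "snd i \<in> comp (fst i)" using i gens(2)[of "fst i"] by (auto simp: ind_def)
  have p: "s i \<in> polys N" "\<And>m. m \<in> keys (s i) \<Longrightarrow> int (mono_deg m) = k - fst i"
  proof -
    show "s i \<in> polys N" using s unfolding free_comp_def free_part_def by blast
    fix m assume "m \<in> keys (s i)"
    then have "int (mono_deg m) + fst i = k" using s unfolding free_comp_def by blast
    then show "int (mono_deg m) = k - fst i" by simp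
  qed
  show "fscale (s i) (snd i) \<in> comp k"
    using scale_free_comp[of "s i" N "k - fst i" "snd i" I \<delta> "fst i"] p b
      kos.submod_closed(3)[OF Z_submod, of "s i" "snd i"] by (simp add: comp_def)
qed

lemma ev_const_fun:
  assumes "0 \<le> k" "k \<le> D"
  shows "ev D (const_fun (ind D) fst k c) = (\<Sum>b\<in>gens k. fscale (Const (c (k, b))) b)"
proof -
  have "ev D (const_fun (ind D) fst k c) = (\<Sum>i\<in>Pair k ` gens k. fscale (Const (c i)) (snd i))"
    unfolding ev_def
  proof (rule sum.mono_neutral_cong_right)
    show "Pair k ` gens k \<subseteq> ind D" using assms by (auto simp: ind_def)
    show "\<forall>i\<in>ind D - Pair k ` gens k. fscale (const_fun (ind D) fst k c i) (snd i) = 0"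
      by (auto simp: const_fun_def ind_def)
    show "fscale (const_fun (ind D) fst k c i) (snd i) = fscale (Const (c i)) (snd i)"
      if "i \<in> Pair k ` gens k" for i
      using that assms by (auto simp: const_fun_def ind_def)
  qed simp
  then show ?thesis by (simp add: sum.reindex inj_on_def)
qed

lemma ind_nonneg: "i \<in> ind D \<Longrightarrow> 0 \<le> fst i"
  by (auto simp: ind_def)

lemma comp_neg: "k < 0 \<Longrightarrow> z \<in> comp k \<Longrightarrow> z = 0"
  using free_comp_neg[OF \<delta>_nonneg] by (auto simp: comp_def)

text \<open>Nakayama's lemma in graded form, by induction on the degree: modulo a combination of
  \<open>gens k\<close>, an element of degree \<open>k\<close> is a sum of variables times elements
  of degree \<open>k - 1\<close>. The induction starts in negative degrees, where \<open>Z\<close>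
  vanishes.\<close>

lemma ev_surj_aux: "\<forall>k. k < int n \<longrightarrow> k \<le> D \<longrightarrow> comp k \<subseteq> ev D ` coeff_comp D k"
proof (induction n)
  case 0
  show ?case
  proof (intro allI impI subsetI)
    fix k z assume "k < int 0" "z \<in> comp k"
    then have "z = ev D 0" using comp_neg by simp
    then show "z \<in> ev D ` coeff_comp D k" by (rule image_eqI[of z "ev D" 0]) (rule free_comp_closed)
  qed
next
  case (Suc n)
  show ?case
  proof (intro allI impI subsetI)
    fix k z assume k: "k < int (Suc n)" "k \<le> D" and z: "z \<in> comp k"
    show "z \<in> ev D ` coeff_comp D k"
    proof (cases "k < 0")
      case True
      then have "z = ev D 0" using comp_neg z by simp
      then show ?thesis by (rule image_eqI[of z "ev D" 0]) (rule free_comp_closed)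
    next
      case False
      obtain c where "z - (\<Sum>b\<in>gens k. fscale (Const (c b)) b) \<in> mcomp k"
        using gens(3)[OF z] by blast
      then obtain y where y: "\<forall>j\<in>{1..N}. y j \<in> comp (k - 1)"
        "z - (\<Sum>b\<in>gens k. fscale (Const (c b)) b) = (\<Sum>j\<in>{1..N}. fscale (Var j) (y j))"
        unfolding mcomp_def by blast
      have "\<forall>j\<in>{1..N}. \<exists>t. t \<in> coeff_comp D (k - 1) \<and> y j = ev D t"
        using y(1) Suc.IH k by (simp add: image_def subset_iff Bex_def)
      from bchoice[OF this] obtain t where
        t: "\<forall>j\<in>{1..N}. t j \<in> coeff_comp D (k - 1) \<and> y j = ev D (t j)" ..
      let ?s = "const_fun (ind D) fst k (\<lambda>i. c (snd i)) + (\<Sum>j\<in>{1..N}. fscale (Var j) (t j))"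
      have "?s \<in> coeff_comp D k"
        using t by (intro free_comp_closed const_fun_in fvec.subspace_sum[OF free_comp_subspace] Var_free_comp) auto
      moreover have "(\<Sum>j\<in>{1..N}. fscale (Var j) (ev D (t j))) = (\<Sum>j\<in>{1..N}. fscale (Var j) (y j))"
        using t by (intro sum.cong) auto
      then have "z = ev D ?s"
        using y(2) False k(2) by (simp add: ev_add ev_sum ev_scale ev_const_fun algebra_simps)
      ultimately show ?thesis by blast
    qed
  qed
qed

lemma ev_surj: "k \<le> D \<Longrightarrow> ev D ` coeff_comp D k = comp k"
proof -
  assume "k \<le> D"
  moreover have "k < int (Suc (nat k))" by linarith
  ultimately have "comp k \<subseteq> ev D ` coeff_comp D k"
    using ev_surj_aux[of "Suc (nat k)" D] by blast
  then show ?thesis using ev_comp by auto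
qed

text \<open>A relation among the variables with coefficients in \<open>Z\<close> is a Koszul 1-cycle
  of \<open>Z\<close>, so vanishing of the first homology makes it a boundary.\<close>

lemma relation_boundary:
  assumes y: "\<forall>j\<in>{1..N}. y j \<in> comp k" and 0: "(\<Sum>j\<in>{1..N}. fscale (Var j) (y j)) = 0"
  shows "\<exists>e. (\<forall>A. e A \<in> comp (k - 1)) \<and> (\<forall>j\<in>{1..N}. y j = kos.boundary N e {j})"
proof -
  define c where "c A = (if A \<in> (\<lambda>j. {j}) ` {1..N} then y (the_elem A) else 0)" for A :: "nat set"
  have cj: "c {j} = y j" if "j \<in> {1..N}" for j using that by (auto simp: c_def)
  have cZ: "\<forall>A. c A \<in> Z"
    using y kos.submod_closed(1)[OF Z_submod] by (auto simp: c_def comp_def)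
  have cyc: "\<forall>A\<subseteq>{1..N}. card A + 1 = 1 \<longrightarrow> kos.boundary N c A \<in> {0}"
  proof (intro allI impI)
    fix A :: "nat set" assume "A \<subseteq> {1..N}" "card A + 1 = 1"
    then have A: "A = {}" using finite_subset[of A "{1..N}"] by simp
    have "kos.boundary N c {} = (\<Sum>j\<in>{1..N}. fscale (Var j) (y j))"
      unfolding kos.boundary_def by (intro sum.cong) (simp_all add: cj koszul_sign_def del: atLeastAtMost_iff)
    then show "kos.boundary N c A \<in> {0}" using 0 A by simp
  qed
  obtain e where e: "\<forall>A. e A \<in> Z"
    "\<forall>A\<subseteq>{1..N}. card A = 1 \<longrightarrow> c A - kos.boundary N e A \<in> {0}"
    using kos.exact_atD[OF Z_exact cZ cyc] by (elim exE conjE)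
  define e' where "e' A = hom_part \<delta> (k - 1) (e A)" for A
  have "e' A \<in> comp (k - 1)" for A
    using e(1) Z_hom Z_sub by (auto simp: e'_def comp_def intro: hom_part_in_free_comp)
  moreover have "y j = kos.boundary N e' {j}" if j: "j \<in> {1..N}" for j
  proof -
    have "y j = kos.boundary N e {j}" using e(2)[rule_format, of "{j}"] j cj[OF j] by simp
    moreover have "hom_part \<delta> k (y j) = y j"
      using y j by (intro hom_part_id[of _ "\<lambda>_. N" I]) (auto simp: comp_def)
    moreover have "hom_part \<delta> k (kos.boundary N e {j}) = kos.boundary N e' {j}"
      by (simp only: kos.boundary_def hom_part_sum hom_part_sign_Var e'_def)
    ultimately show ?thesis by simp
  qed
  ultimately show ?thesis by blast
qed

text \<open>By induction on the degree. The constant coefficients of a relation \<open>s\<close>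
  vanish because \<open>gens k\<close> is independent modulo the maximal ideal times
  \<open>Z\<close>. The rest, \<open>x_1 t_1 + ... + x_N t_N\<close>, maps to a Koszul relation in
  \<open>Z\<close>, hence to a boundary; lifting the bounding chain by surjectivity and applying the
  induction hypothesis shows that \<open>t\<close> itself is a boundary. So \<open>s\<close> is a
  boundary of a boundary, which is zero.\<close>

lemma ev_inj_aux: "\<forall>k s. k < int n \<longrightarrow> k \<le> D \<longrightarrow> s \<in> coeff_comp D k \<longrightarrow> ev D s = 0 \<longrightarrow> s = 0"
proof (induction n)
  case 0
  show ?case by (intro allI impI, rule free_comp_neg[OF ind_nonneg]) auto
next
  case (Suc n)
  show ?case
  proof (intro allI impI)
    fix k s assume k: "k < int (Suc n)" "k \<le> D" and s: "s \<in> coeff_comp D k" and ev0: "ev D s = 0"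
    show "s = 0"
    proof (cases "k < 0")
      case True
      then show ?thesis using free_comp_neg[OF ind_nonneg True s] by simp
    next
      case False
      obtain c t where t: "\<forall>j\<in>{1..N}. t j \<in> coeff_comp D (k - 1)"
        and st: "s = const_fun (ind D) fst k c + (\<Sum>j\<in>{1..N}. fscale (Var j) (t j))"
        using free_comp_split[OF s] unfolding const_fun_def by blast
      have y: "\<forall>j\<in>{1..N}. ev D (t j) \<in> comp (k - 1)" using t ev_comp by blast
      have rel: "(\<Sum>b\<in>gens k. fscale (Const (c (k, b))) b) + (\<Sum>j\<in>{1..N}. fscale (Var j) (ev D (t j))) = 0"
        using ev0 False k(2) by (simp add: st ev_add ev_sum ev_scale ev_const_fun)
      have "(\<Sum>j\<in>{1..N}. fscale (Var j) (ev D (t j))) \<in> mcomp k"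
        unfolding mcomp_def using y by (intro CollectI exI[of _ "\<lambda>j. ev D (t j)"]) simp
      then have "- (\<Sum>j\<in>{1..N}. fscale (Var j) (ev D (t j))) \<in> mcomp k"
        by (rule fvec.subspace_neg[OF mcomp_subspace])
      then have gm: "(\<Sum>b\<in>gens k. fscale (Const (c (k, b))) b) \<in> mcomp k"
        using rel by (simp add: eq_neg_iff_add_eq_0[symmetric])
      have "c (k, b) = 0" if "b \<in> gens k" for b
        by (rule gens(4)[OF gm that])
      then have const0: "const_fun (ind D) fst k c = 0"
        by (auto simp: const_fun_def ind_def fun_eq_iff)
      have "(\<Sum>j\<in>{1..N}. fscale (Var j) (ev D (t j))) = 0"
        using ev0 by (simp add: st const0 ev_sum ev_scale)
      from relation_boundary[OF y this] obtain e where
        e: "\<forall>A. e A \<in> comp (k - 1 - 1)" "\<forall>j\<in>{1..N}. ev D (t j) = kos.boundary N e {j}"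
        by blast
      have "\<forall>A. \<exists>q. q \<in> coeff_comp D (k - 1 - 1) \<and> e A = ev D q"
        using e(1) ev_surj[of "k - 1 - 1" D] k(2) by auto
      from choice[OF this] obtain q where
        q: "\<forall>A. q A \<in> coeff_comp D (k - 1 - 1) \<and> e A = ev D (q A)" ..
      then have eq: "e = (\<lambda>A. ev D (q A))" by auto
      have t_eq: "t j = kos.boundary N q {j}" if j: "j \<in> {1..N}" for j
      proof -
        have "kos.boundary N q {j} \<in> coeff_comp D (k - 1)"
          unfolding kos.boundary_def using q
          by (intro fvec.subspace_sum[OF free_comp_subspace] sign_Var_free_comp) auto
        then have "t j - kos.boundary N q {j} \<in> coeff_comp D (k - 1)"
          using t j by (intro fvec.subspace_diff[OF free_comp_subspace]) auto
        moreover have "ev D (t j - kos.boundary N q {j}) = 0"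
          using e(2) j by (simp add: ev_diff ev_boundary eq)
        moreover have "k - 1 < int n" "k - 1 \<le> D" using k by linarith+
        ultimately have "t j - kos.boundary N q {j} = 0" using Suc.IH by blast
        then show ?thesis by simp
      qed
      have "s = (\<Sum>j\<in>{1..N}. fscale (Var j) (t j))" using st const0 by simp
      also have "\<dots> = kos.boundary N (kos.boundary N q) {}"
        unfolding kos.boundary_def[of N "kos.boundary N q"]
        by (intro sum.cong) (simp_all add: t_eq koszul_sign_def del: atLeastAtMost_iff)
      also have "\<dots> = 0" by (rule kos.boundary_boundary) simp
      finally show ?thesis .
    qed
  qed
qed

lemma ev_inj: "k \<le> D \<Longrightarrow> s \<in> coeff_comp D k \<Longrightarrow> ev D s = 0 \<Longrightarrow> s = 0"
  using ev_inj_aux[of "Suc (nat k)" D, rule_format, of k s] by linarith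

end

text \<open>The piece of the long exact homology sequence of \<open>Z\<close>, \<open>C\<close> and
  \<open>C/Z\<close> in which the homology of \<open>Z\<close> in degree \<open>i\<close> lies
  between that of \<open>C/Z\<close> in degree \<open>i + 1\<close> and that of \<open>C\<close> in
  degree \<open>i\<close>.\<close>

lemma (in koszul) exact_at_kernel:
  assumes C: "submod C" and Z: "submod Z" and ZC: "Z \<subseteq> C"
    and ex1: "exact_at C {0} i" and ex2: "exact_at C Z (Suc i)"
  shows "exact_at Z {0} i"
  unfolding exact_at_def
proof (intro allI impI)
  fix c assume c: "\<forall>A. c A \<in> Z" and cyc: "\<forall>A\<subseteq>{1..N}. card A + 1 = i \<longrightarrow> boundary c A \<in> {0}"
  have "\<forall>A. c A \<in> C" using c ZC by blast
  from exact_atD[OF ex1 this cyc] obtain b where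
    b: "\<forall>A. b A \<in> C" "\<forall>A\<subseteq>{1..N}. card A = i \<longrightarrow> c A - boundary b A \<in> {0}"
    by (elim exE conjE)
  have "\<forall>A\<subseteq>{1..N}. card A + 1 = Suc i \<longrightarrow> boundary b A \<in> Z"
  proof (intro allI impI)
    fix A assume "A \<subseteq> {1..N}" "card A + 1 = Suc i"
    then have "boundary b A = c A" using b(2)[rule_format, of A] by simp
    then show "boundary b A \<in> Z" using c by simp
  qed
  from exact_atD[OF ex2 b(1) this] obtain e where
    e: "\<forall>A. e A \<in> C" "\<forall>A\<subseteq>{1..N}. card A = Suc i \<longrightarrow> b A - boundary e A \<in> Z"
    by (elim exE conjE)
  \<comment> \<open>Subtracting a boundary moves \<open>b\<close> into \<open>Z\<close> on sets of
    size \<open>i + 1\<close> without changing its own boundary; elsewhere \<open>0\<close> keeps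
    the values in \<open>Z\<close>.\<close>
  define b' where "b' A = (if A \<subseteq> {1..N} \<and> card A = Suc i then b A - boundary e A else 0)" for A
  have "b' A \<in> Z" for A
    using e(2) submod_closed(1)[OF Z] by (simp add: b'_def)
  moreover have "c A - boundary b' A \<in> {0}" if A: "A \<subseteq> {1..N}" "card A = i" for A
  proof -
    have fA: "finite A" using A finite_subset by blast
    have "boundary b' A = boundary (\<lambda>A. b A - boundary e A) A"
      using A fA by (intro boundary_cong) (auto simp: b'_def)
    then have "boundary b' A = boundary b A"
      using boundary_boundary[OF fA, of e] by (simp add: boundary_diff)
    then show ?thesis using b(2) A by simp
  qed
  ultimately show "\<exists>e. (\<forall>A. e A \<in> Z) \<and> (\<forall>A\<subseteq>{1..N}. card A = i \<longrightarrow> c A - boundary e A \<in> {0})"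
    by (intro exI[of _ b']) simp
qed

section \<open>Growth of Hilbert functions and comparison of numbers of generators\<close>

lemma card_mons_mono:
  assumes "1 \<le> N" "j \<le> k"
  shows "card (mons N j) \<le> card (mons N k)"
proof -
  obtain M where M: "N = Suc M" using assms(1) by (cases N) auto
  have "card (mons N j) \<le> card (mons N (j + int d))" for d
  proof (induction d)
    case (Suc d)
    then show ?case using card_mons_Suc[of M "j + int (Suc d)"] M by simp
  qed simp
  from this[of "nat (k - j)"] show ?thesis using assms(2) by simp
qed

text \<open>The ratio \<open>h(d) / h(d - r)\<close> tends to \<open>1\<close> because \<open>h\<close> grows polynomially.\<close>

lemma le_of_mons_growth:
  assumes N: "1 \<le> N" and r: "1 \<le> r"
    and le: "\<And>d. r \<le> d \<Longrightarrow> b * card (mons N (int (d - r))) \<le> a * card (mons N (int d))"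
  shows "b \<le> a"
proof (rule ccontr)
  assume "\<not> b \<le> a"
  then have ba: "Suc a \<le> b" by simp
  \<comment> \<open>If \<open>a < b\<close>, iterating the premise in steps of \<open>r\<close>
    forces growth by the factor \<open>(a + 1) / a\<close> each time. It is written without
    division, so that \<open>a = 0\<close> is covered.\<close>
  have pow: "Suc a ^ q \<le> a ^ q * card (mons N (int (q * r)))" for q
  proof (induction q)
    case 0
    then show ?case by (simp add: mons_0)
  next
    case (Suc q)
    have "Suc a * card (mons N (int (q * r))) \<le> b * card (mons N (int (q * r)))"
      using ba by (rule mult_right_mono) simp
    also have "\<dots> \<le> a * card (mons N (int (Suc q * r)))"
      using le[of "Suc q * r"] by simp
    finally have le': "Suc a * card (mons N (int (q * r))) \<le> a * card (mons N (int (Suc q * r)))" .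
    have "Suc a ^ Suc q \<le> Suc a * (a ^ q * card (mons N (int (q * r))))"
      unfolding power_Suc using Suc.IH by (rule mult_left_mono) simp
    also have "\<dots> = a ^ q * (Suc a * card (mons N (int (q * r))))" by (simp only: mult_ac)
    also have "\<dots> \<le> a ^ q * (a * card (mons N (int (Suc q * r))))"
      using le' by (rule mult_left_mono) simp
    finally show ?case by (simp only: power_Suc mult_ac)
  qed
  define x where "x = real a / real (Suc a)"
  have x: "0 \<le> x" "x < 1" by (simp_all add: x_def)
  \<comment> \<open>The \<open>N\<close>-th root reduces the comparison of \<open>x ^ q\<close> with
    the polynomial \<open>(q r + 1) ^ N\<close> to that of \<open>y ^ q\<close> with a linear
    factor.\<close>
  define y where "y = root N x"
  have y: "0 \<le> y" "y < 1" "y ^ N = x"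
    using x N by (simp_all add: y_def real_root_lt_1_iff)
  have "(\<lambda>q. real r * (real q * y ^ q) + y ^ q) \<longlonglongrightarrow> real r * 0 + 0"
    using y by (intro tendsto_intros powser_times_n_limit_0 LIMSEQ_power_zero) auto
  then have "eventually (\<lambda>q. real r * (real q * y ^ q) + y ^ q < 1) sequentially"
    by (intro order_tendstoD(2)) auto
  then obtain q where q: "real r * (real q * y ^ q) + y ^ q < 1"
    using eventually_happens'[OF sequentially_bot] by blast
  have "real (Suc a) ^ q \<le> real a ^ q * real ((q * r + 1) ^ N)"
  proof -
    have "Suc a ^ q \<le> a ^ q * (q * r + 1) ^ N"
      using pow[of q] card_mons_le[of N "q * r"] by (meson le_trans mult_le_mono2)
    then show ?thesis by (metis of_nat_le_iff of_nat_mult of_nat_power)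
  qed
  then have "1 \<le> x ^ q * real ((q * r + 1) ^ N)"
    by (simp add: x_def power_divide field_simps)
  also have "x ^ q = (y ^ q) ^ N" using y(3) by (metis power_mult mult.commute)
  also have "(y ^ q) ^ N * real ((q * r + 1) ^ N) = (real r * (real q * y ^ q) + y ^ q) ^ N"
    by (simp add: power_mult_distrib[symmetric] algebra_simps)
  also have "\<dots> < 1"
    using q y N by (intro power_less_one_iff[THEN iffD2]) auto
  finally show False by simp
qed

context koszul_acyclic
begin

text \<open>Freeness of \<open>Z\<close> in the form used for counting: in degrees up to
  \<open>D\<close>, the monomial multiples of the generators form a \<open>K\<close>-basis.\<close>

lemma ev_basis:
  assumes k: "k \<le> D"
  defines "v \<equiv> \<lambda>j. ev D (unit_fun j)" and "J \<equiv> free_index (\<lambda>_. N) (ind D) fst k"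
  shows "inj_on v J" "fvec.independent (v ` J)" "fvec.span (v ` J) = comp k"
proof -
  have fJ: "finite J" by (simp add: J_def)
  have sp: "fvec.span (unit_fun ` J) = coeff_comp D k"
    unfolding J_def by (rule span_free_comp) simp
  have lin: "(\<Sum>j\<in>J. fscale (Const (c j)) (v j)) = ev D (\<Sum>j\<in>J. fscale (Const (c j)) (unit_fun j))" for c
    by (simp add: v_def ev_sum ev_scale)
  have z: "\<forall>j\<in>J. c j = 0" if 0: "(\<Sum>j\<in>J. fscale (Const (c j)) (v j)) = 0" for c
  proof
    fix j assume j: "j \<in> J"
    have "(\<Sum>j\<in>J. fscale (Const (c j)) (unit_fun j)) \<in> fvec.span (unit_fun ` J)"
      by (intro fvec.span_sum fvec.span_scale fvec.span_base imageI)
    then have "(\<Sum>j\<in>J. fscale (Const (c j)) (unit_fun j)) = 0"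
      unfolding sp by (rule ev_inj[OF k]) (rule 0[unfolded lin])
    then show "c j = 0"
      using lookup_sum_unit_fun[OF fJ, of c "fst j" "snd j"] j by simp
  qed
  show "inj_on v J" by (rule fvec.independent_family(1)[OF fJ]) (rule z)
  show "fvec.independent (v ` J)" by (rule fvec.independent_family(2)[OF fJ]) (rule z)
  show "fvec.span (v ` J) = comp k"
  proof (intro equalityI subsetI)
    have "v ` J \<subseteq> comp k"
      unfolding v_def by (intro image_subsetI ev_comp) (simp flip: sp add: fvec.span_base)
    then show "x \<in> comp k" if "x \<in> fvec.span (v ` J)" for x
      using fvec.span_minimal[OF _ comp_subspace] that by blast
  next
    fix x assume "x \<in> comp k"
    then obtain s where s: "s \<in> fvec.span (unit_fun ` J)" "x = ev D s"
      unfolding ev_surj[OF k, symmetric] sp by (elim imageE) fast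
    obtain u where "s = (\<Sum>b\<in>unit_fun ` J. fscale (Const (u b)) b)"
      using s(1) fvec.span_finite[of "unit_fun ` J"] fJ by auto
    then have "x = (\<Sum>b\<in>unit_fun ` J. fscale (Const (u b)) (ev D b))"
      using s(2) by (simp add: ev_sum ev_scale)
    also have "\<dots> \<in> fvec.span (v ` J)"
      by (intro fvec.span_sum fvec.span_scale fvec.span_base) (auto simp: v_def)
    finally show "x \<in> fvec.span (v ` J)" .
  qed
qed

lemma ind_mono: "r \<le> D \<Longrightarrow> ind r \<subseteq> ind D"
  by (auto simp: ind_def)

text \<open>A homogeneous element of degree at most \<open>r\<close> has zero coordinates at all
  shifts above \<open>r\<close>. So the degree \<open>D\<close> monomial multiples of the generators
  up to degree \<open>r\<close>, which are independent, lie in the part of the free module generated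
  in degrees at most \<open>r\<close>.\<close>

lemma card_free_index_le:
  assumes "r \<le> D"
  shows "card (free_index (\<lambda>_. N) (ind r) fst D) \<le> card (free_index (\<lambda>_. N) {i \<in> I. \<delta> i \<le> r} \<delta> D)"
proof -
  let ?I' = "{i \<in> I. \<delta> i \<le> r}"
  let ?J = "free_index (\<lambda>_. N) (ind D) fst D" and ?J' = "free_index (\<lambda>_. N) (ind r) fst D"
  let ?v = "\<lambda>j. ev D (unit_fun j)"
  have sub: "?J' \<subseteq> ?J" using ind_mono[OF assms] by (auto simp: free_index_def)
  have ind: "fvec.independent (?v ` ?J')"
    using ev_basis(2)[OF order_refl, of D] by (rule fvec.independent_mono) (use sub in blast)
  have mem: "?v ` ?J' \<subseteq> fvec.span (unit_fun ` free_index (\<lambda>_. N) ?I' \<delta> D)"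
  proof
    fix x assume "x \<in> ?v ` ?J'"
    then obtain i m where im: "(i, m) \<in> ?J'" "x = ?v (i, m)" by auto
    have i: "i \<in> ind r" "i \<in> ind D" using im(1) ind_mono[OF assms] by (auto simp: free_index_def)
    have x: "x = fscale (single m 1) (snd i)"
    proof -
      have "x = (\<Sum>j\<in>ind D. if j = i then fscale (single m 1) (snd i) else 0)"
        unfolding im(2) ev_def by (intro sum.cong) (auto simp: unit_fun_def)
      then show ?thesis using i(2) by simp
    qed
    have "(i, m) \<in> ?J" using im(1) sub by blast
    then have "x \<in> fvec.span (?v ` ?J)"
      unfolding im(2) by (intro fvec.span_base imageI)
    then have "x \<in> comp D" unfolding ev_basis(3)[OF order_refl] .
    then have xD: "x \<in> F_comp D" by (simp add: comp_def)
    have b: "snd i \<in> F_comp (fst i)" "fst i \<le> r"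
      using i(1) gens(2)[of "fst i"] by (auto simp: ind_def comp_def)
    have "x l = 0" if "l \<notin> ?I'" for l
    proof -
      have "snd i l = 0"
      proof (rule ccontr)
        assume "snd i l \<noteq> 0"
        then obtain m where "m \<in> keys (snd i l)" by (metis keys_eq_empty all_not_in_conv)
        then have "\<delta> l \<le> fst i" using b(1) by (fastforce simp: free_comp_def)
        moreover have "l \<in> I" using \<open>snd i l \<noteq> 0\<close> b(1) by (auto simp: free_comp_def free_part_def)
        ultimately show False using that b(2) by simp
      qed
      then show ?thesis by (simp add: x fscale_def)
    qed
    then have "x \<in> free_comp (\<lambda>_. N) ?I' \<delta> D"
      using xD by (simp add: free_comp_def free_part_def)
    then show "x \<in> fvec.span (unit_fun ` free_index (\<lambda>_. N) ?I' \<delta> D)"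
      by (subst span_free_comp) (simp_all add: finI)
  qed
  have "card (?v ` ?J') \<le> card (unit_fun ` free_index (\<lambda>_. N) ?I' \<delta> D :: ('i \<Rightarrow> 'k mpoly) set)"
    using fvec.independent_span_bound[OF _ ind mem] finI by simp
  also have "\<dots> \<le> card (free_index (\<lambda>_. N) ?I' \<delta> D)"
    by (rule card_image_le) (simp add: finI)
  also have "card (?v ` ?J') = card ?J'"
    by (rule card_image[OF inj_on_subset[OF ev_basis(1)[OF order_refl] sub]])
  finally show ?thesis .
qed

text \<open>A rank inequality obtained from dimensions in large degrees \<open>d\<close> instead of
  a fraction field. With \<open>h\<close> the Hilbert function of \<open>S\<close>, every generator
  of \<open>Z\<close> up to degree \<open>r\<close> contributes at least \<open>h(d - r)\<close> and
  every generator of the ambient module at most \<open>h(d)\<close>.\<close>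

lemma card_ind_le:
  assumes N: "1 \<le> N" and r: "1 \<le> r"
  shows "card (ind (int r)) \<le> card {i \<in> I. \<delta> i \<le> int r}"
proof (rule le_of_mons_growth[OF N r])
  fix d assume d: "r \<le> d"
  have "card (ind (int r)) * card (mons N (int (d - r))) = (\<Sum>i\<in>ind (int r). card (mons N (int (d - r))))"
    by simp
  also have "\<dots> \<le> (\<Sum>i\<in>ind (int r). card (mons N (int d - fst i)))"
    using d by (intro sum_mono card_mons_mono[OF N]) (auto simp: ind_def)
  also have "\<dots> \<le> (\<Sum>i\<in>{i \<in> I. \<delta> i \<le> int r}. card (mons N (int d - \<delta> i)))"
    using card_free_index_le[of "int r" "int d"] d finI by (simp add: card_free_index)
  also have "\<dots> \<le> (\<Sum>i\<in>{i \<in> I. \<delta> i \<le> int r}. card (mons N (int d)))"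
    using \<delta>_nonneg by (intro sum_mono card_mons_mono[OF N]) auto
  also have "\<dots> = card {i \<in> I. \<delta> i \<le> int r} * card (mons N (int d))" by simp
  finally show "card (ind (int r)) * card (mons N (int (d - r))) \<le>
      card {i \<in> I. \<delta> i \<le> int r} * card (mons N (int d))" .
qed

end

section \<open>Homogeneous presentations\<close>

text \<open>Each generator carries its degree, so \<open>snd\<close> is the shift in the free cover.
  Generators are nonzero, so a degree in which \<open>U\<close> vanishes contains none.\<close>

locale graded_presentation = module "poly_ring N" U
  for N :: nat and U :: "('k::field mpoly, 'u) module" +
  fixes G :: "int \<Rightarrow> 'u set" and I :: "('u \<times> int) set"
  assumes graded: "graded_module N U G" and finI: "finite I"
    and gens: "\<And>i. i \<in> I \<Longrightarrow> fst i \<in> G (snd i) \<and> fst i \<noteq> \<zero>\<^bsub>U\<^esub>"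
    and span_gens: "span (fst ` I) = carrier U"
begin

abbreviation F :: "('u \<times> int \<Rightarrow> 'k mpoly) set" where "F \<equiv> free_part (\<lambda>_. N) I"

abbreviation F_comp :: "int \<Rightarrow> ('u \<times> int \<Rightarrow> 'k mpoly) set" where "F_comp \<equiv> free_comp (\<lambda>_. N) I snd"

abbreviation F_index :: "int \<Rightarrow> (('u \<times> int) \<times> (nat \<Rightarrow>\<^sub>0 nat)) set" where "F_index \<equiv> free_index (\<lambda>_. N) I snd"

definition present :: "('u \<times> int \<Rightarrow> 'k mpoly) \<Rightarrow> 'u" where
  "present p = (\<Oplus>\<^bsub>U\<^esub>i\<in>I. p i \<odot>\<^bsub>U\<^esub> fst i)"

lemma G_subgroup: "subgroup (G k) (add_monoid U)"
  and G_smult: "s \<in> homog_part N d \<Longrightarrow> u \<in> G k \<Longrightarrow> s \<odot>\<^bsub>U\<^esub> u \<in> G (d + k)"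
  and G_decomp: "u \<in> carrier U \<Longrightarrow> \<exists>!f. (\<forall>i. f i \<in> G i) \<and> finite {i. f i \<noteq> \<zero>\<^bsub>U\<^esub>} \<and>
        u = (\<Oplus>\<^bsub>U\<^esub> i\<in>{i. f i \<noteq> \<zero>\<^bsub>U\<^esub>}. f i)"
  using graded by (simp_all add: graded_module_def)

lemma G_closed:
  "u \<in> G k \<Longrightarrow> u \<in> carrier U" "\<zero>\<^bsub>U\<^esub> \<in> G k"
  "u \<in> G k \<Longrightarrow> v \<in> G k \<Longrightarrow> u \<oplus>\<^bsub>U\<^esub> v \<in> G k" "u \<in> G k \<Longrightarrow> \<ominus>\<^bsub>U\<^esub> u \<in> G k"
  using subgroup.subset[OF G_subgroup[of k]] subgroup.one_closed[OF G_subgroup[of k]]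
    subgroup.m_closed[OF G_subgroup[of k], of u v] subgroup.m_inv_closed[OF G_subgroup[of k], of u]
  by (auto simp: a_inv_def)

lemma G_finsum:
  assumes "finite A" "\<And>a. a \<in> A \<Longrightarrow> f a \<in> G k"
  shows "finsum U f A \<in> G k"
  using assms
proof (induction A rule: finite_induct)
  case (insert x A)
  then have "f \<in> A \<rightarrow> carrier U" "f x \<in> carrier U" using G_closed(1) by auto
  then show ?case using insert G_closed(3) by simp
qed (simp add: G_closed(2))

text \<open>Extended by zero, \<open>v\<close> is a homogeneous decomposition of the zero element,
  and so is the zero family; decompositions are unique.\<close>

lemma homogeneous_sum_0:
  assumes K: "finite K" "\<And>k. k \<in> K \<Longrightarrow> v k \<in> G k" and 0: "finsum U v K = \<zero>\<^bsub>U\<^esub>" and k: "k \<in> K"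
  shows "v k = \<zero>\<^bsub>U\<^esub>"
proof -
  define f where "f i = (if i \<in> K then v i else \<zero>\<^bsub>U\<^esub>)" for i
  let ?S = "{i. f i \<noteq> \<zero>\<^bsub>U\<^esub>}"
  have fG: "f i \<in> G i" for i using K(2) by (simp add: f_def G_closed(2))
  have S: "?S \<subseteq> K" by (auto simp: f_def)
  have "finsum U f ?S = finsum U f K"
    using S K(1) G_closed(1)[OF fG] by (intro M.add.finprod_mono_neutral_cong_left) auto
  also have "\<dots> = finsum U v K"
    using K(2) G_closed(1) by (intro M.finsum_cong') (auto simp: f_def)
  finally have "finsum U f ?S = \<zero>\<^bsub>U\<^esub>" using 0 by simp
  define P where "P g \<longleftrightarrow> (\<forall>i. g i \<in> G i) \<and> finite {i. g i \<noteq> \<zero>\<^bsub>U\<^esub>} \<and>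
      \<zero>\<^bsub>U\<^esub> = (\<Oplus>\<^bsub>U\<^esub> i\<in>{i. g i \<noteq> \<zero>\<^bsub>U\<^esub>}. g i)" for g
  have "\<exists>!g. P g" unfolding P_def by (rule G_decomp[OF M.zero_closed])
  moreover have "P f"
    using fG finite_subset[OF S K(1)] \<open>finsum U f ?S = \<zero>\<^bsub>U\<^esub>\<close> by (simp add: P_def)
  moreover have "P (\<lambda>_. \<zero>\<^bsub>U\<^esub>)" by (simp add: P_def G_closed(2))
  ultimately have "f = (\<lambda>_. \<zero>\<^bsub>U\<^esub>)" by blast
  then show ?thesis using k by (metis f_def)
qed

lemma F_coeff: "p \<in> F \<Longrightarrow> p i \<in> polys N"
  unfolding free_part_def by blast

lemma gens_carrier: "i \<in> I \<Longrightarrow> fst i \<in> carrier U"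
  using gens G_closed(1) by blast

lemma present_summands: "p \<in> F \<Longrightarrow> (\<lambda>i. p i \<odot>\<^bsub>U\<^esub> fst i) \<in> I \<rightarrow> carrier U"
  using F_coeff gens_carrier by auto

lemma present_closed: "p \<in> F \<Longrightarrow> present p \<in> carrier U"
  unfolding present_def by (intro M.finsum_closed present_summands)

lemma present_add:
  assumes "p \<in> F" "q \<in> F"
  shows "present (p + q) = present p \<oplus>\<^bsub>U\<^esub> present q"
proof -
  have "present (p + q) = (\<Oplus>\<^bsub>U\<^esub>i\<in>I. p i \<odot>\<^bsub>U\<^esub> fst i \<oplus>\<^bsub>U\<^esub> q i \<odot>\<^bsub>U\<^esub> fst i)"
    unfolding present_def
    using assms present_summands F_coeff gens_carrier smult_l_distr[of "p i" "q i" "fst i" for i]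
    by (intro M.finsum_cong') auto
  then show ?thesis
    unfolding present_def by (simp add: M.finsum_addf[OF present_summands[OF assms(1)] present_summands[OF assms(2)]])
qed

lemma F_scale: "s \<in> polys N \<Longrightarrow> p \<in> F \<Longrightarrow> fscale s p \<in> F"
  by (intro free_part_closed)

lemma present_scale:
  assumes "s \<in> polys N" "p \<in> F"
  shows "present (fscale s p) = s \<odot>\<^bsub>U\<^esub> present p"
proof -
  have "present (fscale s p) = (\<Oplus>\<^bsub>U\<^esub>i\<in>I. s \<odot>\<^bsub>U\<^esub> (p i \<odot>\<^bsub>U\<^esub> fst i))"
    unfolding present_def
    using assms F_coeff gens_carrier smult_assoc1[of s "p i" "fst i" for i]
    by (intro M.finsum_cong') (auto simp: fscale_def)
  then show ?thesis
    unfolding present_def by (simp add: finsum_smult[OF assms(1) present_summands[OF assms(2)]])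
qed

lemma present_0: "present 0 = \<zero>\<^bsub>U\<^esub>"
  using present_scale[of 0 0] smult_l_null[OF present_closed[of 0]]
  by (simp add: free_part_closed)

lemma present_sum:
  assumes "finite A" "\<And>a. a \<in> A \<Longrightarrow> p a \<in> F"
  shows "present (\<Sum>a\<in>A. p a) = (\<Oplus>\<^bsub>U\<^esub>a\<in>A. present (p a))"
  using assms
proof (induction A rule: finite_induct)
  case (insert x A)
  then have s: "(\<Sum>a\<in>A. p a) \<in> F" by (intro kos.submod_sum[OF free_part_submod]) auto
  have c: "(\<lambda>a. present (p a)) \<in> A \<rightarrow> carrier U" "present (p x) \<in> carrier U"
    using insert.prems present_closed by auto
  have "present (\<Sum>a\<in>insert x A. p a) = present (p x + (\<Sum>a\<in>A. p a))"
    by (simp only: sum.insert[OF insert.hyps])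
  also have "\<dots> = present (p x) \<oplus>\<^bsub>U\<^esub> present (\<Sum>a\<in>A. p a)"
    using s insert.prems by (intro present_add) auto
  also have "present (\<Sum>a\<in>A. p a) = (\<Oplus>\<^bsub>U\<^esub>a\<in>A. present (p a))"
    using insert.prems by (intro insert.IH) auto
  also have "present (p x) \<oplus>\<^bsub>U\<^esub> \<dots> = (\<Oplus>\<^bsub>U\<^esub>a\<in>insert x A. present (p a))"
    using M.finsum_insert[OF insert.hyps c] by simp
  finally show ?case .
qed (simp add: present_0)

lemma present_surj: "u \<in> carrier U \<Longrightarrow> \<exists>p\<in>F. u = present p"
proof -
  assume u: "u \<in> carrier U"
  have "span (fst ` I) \<subseteq> present ` F"
  proof (rule span_is_subset)
    show "fst ` I \<subseteq> present ` F"
    proof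
      fix x assume "x \<in> fst ` I"
      then obtain i where i: "i \<in> I" "x = fst i" by blast
      let ?e = "\<lambda>j. if j = i then 1 else (0 :: 'k mpoly)"
      have "present ?e = (\<Oplus>\<^bsub>U\<^esub>j\<in>I. if i = j then fst j else \<zero>\<^bsub>U\<^esub>)"
        unfolding present_def
      proof (rule M.finsum_cong')
        fix j assume "j \<in> I"
        then show "?e j \<odot>\<^bsub>U\<^esub> fst j = (if i = j then fst j else \<zero>\<^bsub>U\<^esub>)"
          using smult_one[OF gens_carrier] smult_l_null[OF gens_carrier] by auto
      qed (auto simp: gens_carrier)
      also have "\<dots> = fst i" using i(1) finI gens_carrier by (intro M.finsum_singleton) auto
      finally have "x = present ?e" using i(2) by simp
      moreover have "?e \<in> F" using i(1) by (auto simp: free_part_def)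
      ultimately show "x \<in> present ` F" by blast
    qed
    show "submodule (poly_ring N) (present ` F) U"
    proof
      show "present ` F \<subseteq> carrier U" using present_closed by blast
      show "\<zero>\<^bsub>U\<^esub> \<in> present ` F" using present_0 free_part_closed(1) by (metis imageI)
      show "v \<oplus>\<^bsub>U\<^esub> w \<in> present ` F" if "v \<in> present ` F" "w \<in> present ` F" for v w
        using that present_add free_part_closed(2) by (smt (verit) image_iff)
      show "c \<odot>\<^bsub>U\<^esub> v \<in> present ` F" if "c \<in> polys N" "v \<in> present ` F" for c v
        using that present_scale F_scale by (smt (verit) image_iff)
    qed
  qed
  then show ?thesis using u span_gens by blast
qed

lemma present_comp:
  assumes p: "p \<in> F_comp k"
  shows "present p \<in> G k"
  unfolding present_def
proof (rule G_finsum[OF finI])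
  fix i assume i: "i \<in> I"
  have "p i \<in> homog_part N (k - snd i)"
    unfolding homog_part_def
  proof (intro CollectI conjI ballI)
    show "p i \<in> polys N" using p unfolding free_comp_def by (blast intro: F_coeff)
    fix m assume "m \<in> keys (p i)"
    then have "int (mono_deg m) + snd i = k" using p unfolding free_comp_def by blast
    then show "int (mono_deg m) = k - snd i" by simp
  qed
  then show "p i \<odot>\<^bsub>U\<^esub> fst i \<in> G k"
    using G_smult[of "p i" "k - snd i" "fst i" "snd i"] gens[OF i] by simp
qed

definition Z :: "('u \<times> int \<Rightarrow> 'k mpoly) set" where
  "Z = {p \<in> F. present p = \<zero>\<^bsub>U\<^esub>}"

lemma Z_hom: "p \<in> Z \<Longrightarrow> hom_part snd k p \<in> Z"
proof -
  assume p: "p \<in> Z"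
  then have pF: "p \<in> F" by (simp add: Z_def)
  have h: "hom_part snd k p \<in> F" "present (hom_part snd k p) \<in> G k" for k
    using hom_part_in_free_comp[OF pF] present_comp free_comp_subset by blast+
  obtain K where K: "finite K" "p = (\<Sum>k\<in>K. hom_part snd k p)" "\<And>k. k \<notin> K \<Longrightarrow> hom_part snd k p = 0"
    using hom_part_decomp[OF finI pF] by blast
  have "present p = (\<Oplus>\<^bsub>U\<^esub>k\<in>K. present (hom_part snd k p))"
    by (subst K(2)) (rule present_sum[OF K(1) h(1)])
  then have "(\<Oplus>\<^bsub>U\<^esub>k\<in>K. present (hom_part snd k p)) = \<zero>\<^bsub>U\<^esub>"
    using p by (simp add: Z_def)
  then have "present (hom_part snd k p) = \<zero>\<^bsub>U\<^esub>" if "k \<in> K"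
    using homogeneous_sum_0[OF K(1) h(2)] that by blast
  then show ?thesis using h(1) K(3) present_0 by (cases "k \<in> K") (simp_all add: Z_def free_part_closed)
qed

lemma present_comp_surj: "u \<in> G k \<Longrightarrow> \<exists>p\<in>F_comp k. u = present p"
proof -
  assume u: "u \<in> G k"
  obtain p where pF: "p \<in> F" and pu: "u = present p"
    using present_surj[OF G_closed(1)[OF u]] by blast
  have h: "hom_part snd k p \<in> F" "present (hom_part snd k p) \<in> G k" for k
    using hom_part_in_free_comp[OF pF] present_comp free_comp_subset by blast+
  obtain K where K: "finite K" "p = (\<Sum>k\<in>K. hom_part snd k p)" "\<And>k. k \<notin> K \<Longrightarrow> hom_part snd k p = 0"
    using hom_part_decomp[OF finI pF] by blast
  let ?w = "present (hom_part snd k p)"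
  let ?K = "insert k K"
  \<comment> \<open>The homogeneous parts of a lift of \<open>u\<close> are mapped to
    \<open>U\<close>, and \<open>u\<close> is subtracted in degree \<open>k\<close>. This family
    sums to zero, so its member in degree \<open>k\<close> vanishes: the part of degree
    \<open>k\<close> is already a lift of \<open>u\<close>.\<close>
  let ?v = "\<lambda>j. if j = k then \<ominus>\<^bsub>U\<^esub> u \<oplus>\<^bsub>U\<^esub> ?w else present (hom_part snd j p)"
  have w: "?w \<in> carrier U" "u \<in> carrier U" using h(2) u G_closed(1) by blast+
  have c: "present (hom_part snd j p) \<in> carrier U" for j using h(2) G_closed(1) by blast
  have "(\<Sum>k\<in>?K. hom_part snd k p) = p"
    using K by (cases "k \<in> K") (simp_all add: insert_absorb)
  then have "u = (\<Oplus>\<^bsub>U\<^esub>j\<in>?K. present (hom_part snd j p))"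
    using present_sum[of ?K "\<lambda>k. hom_part snd k p"] K(1) h(1) pu by simp
  also have "?K = insert k (K - {k})" by blast
  also have "(\<Oplus>\<^bsub>U\<^esub>j\<in>insert k (K - {k}). present (hom_part snd j p)) =
      ?w \<oplus>\<^bsub>U\<^esub> (\<Oplus>\<^bsub>U\<^esub>j\<in>K - {k}. present (hom_part snd j p))"
    using K(1) c by (intro M.finsum_insert) auto
  finally have us: "u = ?w \<oplus>\<^bsub>U\<^esub> (\<Oplus>\<^bsub>U\<^esub>j\<in>K - {k}. present (hom_part snd j p))" (is "_ = _ \<oplus>\<^bsub>U\<^esub> ?s") .
  have s: "?s \<in> carrier U" using c by (intro M.finsum_closed) auto
  have "(\<Oplus>\<^bsub>U\<^esub>j\<in>K - {k}. ?v j) = ?s"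
    using c by (intro M.finsum_cong') auto
  moreover have "(\<Oplus>\<^bsub>U\<^esub>j\<in>insert k (K - {k}). ?v j) = ?v k \<oplus>\<^bsub>U\<^esub> (\<Oplus>\<^bsub>U\<^esub>j\<in>K - {k}. ?v j)"
    using K(1) c w by (intro M.finsum_insert) auto
  ultimately have "(\<Oplus>\<^bsub>U\<^esub>j\<in>insert k (K - {k}). ?v j) = (\<ominus>\<^bsub>U\<^esub> u \<oplus>\<^bsub>U\<^esub> ?w) \<oplus>\<^bsub>U\<^esub> ?s" by simp
  also have "\<dots> = \<ominus>\<^bsub>U\<^esub> u \<oplus>\<^bsub>U\<^esub> u" using us w s by (simp add: M.a_assoc)
  also have "\<dots> = \<zero>\<^bsub>U\<^esub>" using w by (simp add: M.l_neg)
  finally have "?v k = \<zero>\<^bsub>U\<^esub>"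
    using K(1) h(2) u by (intro homogeneous_sum_0[of "insert k (K - {k})" ?v k]) (auto intro: G_closed)
  then have "\<ominus>\<^bsub>U\<^esub> u \<oplus>\<^bsub>U\<^esub> ?w = \<zero>\<^bsub>U\<^esub>" by simp
  then have "\<ominus>\<^bsub>U\<^esub> (\<ominus>\<^bsub>U\<^esub> u) = ?w"
    using w by (metis M.a_inv_closed M.minus_equality M.a_comm)
  then have "u = ?w" using w by simp
  then show ?thesis using hom_part_in_free_comp[OF pF] by blast
qed

lemma Z_submod: "kos.submod N Z"
proof (rule kos.submodI)
  show "0 \<in> Z" by (simp add: Z_def free_part_closed present_0)
  show "p + q \<in> Z" if "p \<in> Z" "q \<in> Z" for p q
    using that by (simp add: Z_def free_part_closed present_add)
  show "fscale s p \<in> Z" if "s \<in> polys N" "p \<in> Z" for s p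
    using that by (simp add: Z_def F_scale present_scale)
qed

text \<open>The bound on \<open>card B1\<close> is recorded because the difference is one of natural
  numbers. The last claim turns vanishing of a component of \<open>U\<close> into the statement that
  everything of that degree is a relation.\<close>

lemma dim_component:
  assumes B1: "fvec.independent B1" "fvec.span B1 = Z \<inter> F_comp k"
  shows "comp_dim U (G k) =
      card (F_index k) - card B1"
    and "card B1 \<le> card (F_index k)" and "finite B1"
    and "card B1 = card (F_index k) \<Longrightarrow> F_comp k \<subseteq> Z"
proof -
  let ?C = "F_comp k :: ('u \<times> int \<Rightarrow> 'k mpoly) set"
  let ?J = "F_index k"
  let ?E = "unit_fun ` ?J :: ('u \<times> int \<Rightarrow> 'k mpoly) set"
  have fJ: "finite ?J" using finI by simp
  have E: "finite ?E" "fvec.independent ?E" "fvec.span ?E = ?C" "card ?E = card ?J"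
    using fJ unit_fun_independent[OF fJ] span_free_comp[OF finI, of "\<lambda>_. N" snd k]
    by (auto intro: card_image)
  have "B1 \<subseteq> ?C" using B1(2) fvec.span_superset[of B1] by blast
  then obtain B where B: "B1 \<subseteq> B" "B \<subseteq> ?C" "fvec.independent B" "?C \<subseteq> fvec.span B"
    using fvec.maximal_independent_subset_extend[OF _ B1(1)] by blast
  have spB: "fvec.span B = ?C"
    using B(2,4) fvec.span_minimal[OF B(2) free_comp_subspace] by blast
  have fB: "finite B" "card B \<le> card ?E"
    using fvec.independent_span_bound[OF E(1) B(3)] B(2) E(3) by auto
  have "card ?E \<le> card B"
    using fvec.independent_span_bound[OF fB(1) E(2)] fvec.span_superset[of ?E] E(3) spB by auto
  then have cB: "card B = card ?J" using fB(2) E(4) by simp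
  show fB1: "finite B1" using finite_subset[OF B(1) fB(1)] .
  show "card B1 \<le> card ?J" using card_mono[OF fB(1) B(1)] cB by simp
  show "?C \<subseteq> Z" if "card B1 = card ?J"
  proof -
    have "B1 = B" using card_subset_eq[OF fB(1) B(1)] that cB by simp
    then show ?thesis using B1(2) spB by blast
  qed
  have CF: "v \<in> F" if "v \<in> ?C" for v using that free_comp_subset by blast
  have "comp_dim U (G k) = card B - card B1"
  proof (rule fvec.dim_quotient[where T = present])
    show "vectorspace field_ring (component_space U (G k))"
      by (rule vectorspace_component_space[OF graded])
    show "finite B" "fvec.independent B" "B1 \<subseteq> B" by fact+
    show "carrier (component_space U (G k)) \<subseteq> present ` fvec.span B"
      using present_comp_surj unfolding spB by (auto simp: component_space_def)
    fix v assume "v \<in> fvec.span B"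
    then have v: "v \<in> ?C" by (simp add: spB)
    show "present v \<in> carrier (component_space U (G k))"
      using present_comp[OF v] by (simp add: component_space_def)
    show "present (fscale (Const c) v) = c \<odot>\<^bsub>component_space U (G k)\<^esub> present v" for c
      using present_scale[of "Const c" v] CF[OF v] by (simp add: component_space_def)
    show "(present v = \<zero>\<^bsub>component_space U (G k)\<^esub>) = (v \<in> fvec.span B1)"
      using v CF[OF v] by (simp add: component_space_def B1(2) Z_def)
    fix w assume "w \<in> fvec.span B"
    then have w: "w \<in> ?C" by (simp add: spB)
    show "present (v + w) = present v \<oplus>\<^bsub>component_space U (G k)\<^esub> present w"
      using present_add[OF CF[OF v] CF[OF w]] by (simp add: component_space_def)
  qed
  then show "comp_dim U (G k) = card ?J - card B1"
    using cB by simp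
qed

end

section \<open>Multiples by elements of the maximal ideal, and Koszul exactness of the relation
  module\<close>

lemma max_idealD:
  fixes f :: "'k::field mpoly"
  assumes "f \<in> max_ideal N"
  shows "\<exists>g. f = (\<Sum>j\<in>{1..N}. g j * Var j) \<and> (\<forall>j\<in>{1..N}. g j \<in> polys N)"
proof -
  let ?R = "poly_ring N :: 'k mpoly ring"
  interpret R: cring ?R by (rule cring_poly_ring)
  let ?S = "{f :: 'k mpoly. \<exists>g. f = (\<Sum>j\<in>{1..N}. g j * Var j) \<and> (\<forall>j\<in>{1..N}. g j \<in> carrier ?R)}"
  have SR: "?S \<subseteq> carrier ?R" by auto
  have mul: "x * a \<in> ?S" if a: "a \<in> ?S" and x: "x \<in> carrier ?R" for a x
  proof -
    obtain g where "a = (\<Sum>j\<in>{1..N}. g j * Var j)" "\<forall>j\<in>{1..N}. g j \<in> carrier ?R" using a by blast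
    then have "x * a = (\<Sum>j\<in>{1..N}. (x * g j) * Var j)" "\<forall>j\<in>{1..N}. x * g j \<in> carrier ?R"
      using x by (simp_all add: sum_distrib_left mult.assoc)
    then show ?thesis by (intro CollectI exI[of _ "\<lambda>j. x * g j"] conjI)
  qed
  have "ideal ?S ?R"
  proof (rule idealI[OF R.ring_axioms])
    show "subgroup ?S (add_monoid ?R)"
    proof
      show "?S \<subseteq> carrier (add_monoid ?R)" using SR by simp
      show "\<one>\<^bsub>add_monoid ?R\<^esub> \<in> ?S" by (auto intro!: exI[of _ "\<lambda>_. 0"])
      fix p q assume pq: "p \<in> ?S" "q \<in> ?S"
      have "p \<in> carrier ?R" by (rule subsetD[OF SR pq(1)])
      then have "inv\<^bsub>add_monoid ?R\<^esub> p = - 1 * p" by (simp only: poly_ring_a_inv mult_minus1)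
      then show "inv\<^bsub>add_monoid ?R\<^esub> p \<in> ?S"
        using mul[OF pq(1), of "- 1"] by (simp only: poly_ring_closed)
      obtain g where "p = (\<Sum>j\<in>{1..N}. g j * Var j)" "\<forall>j\<in>{1..N}. g j \<in> carrier ?R" using pq(1) by blast
      moreover obtain h where "q = (\<Sum>j\<in>{1..N}. h j * Var j)" "\<forall>j\<in>{1..N}. h j \<in> carrier ?R" using pq(2) by blast
      ultimately have "p + q = (\<Sum>j\<in>{1..N}. (g j + h j) * Var j)" "\<forall>j\<in>{1..N}. g j + h j \<in> carrier ?R"
        by (simp_all add: distrib_right sum.distrib)
      then have "p + q \<in> ?S" by (intro CollectI exI[of _ "\<lambda>j. g j + h j"] conjI)
      then show "p \<otimes>\<^bsub>add_monoid ?R\<^esub> q \<in> ?S" by simp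
    qed
    show "x \<otimes>\<^bsub>?R\<^esub> a \<in> ?S" "a \<otimes>\<^bsub>?R\<^esub> x \<in> ?S" if "a \<in> ?S" "x \<in> carrier ?R" for a x
      using mul[OF that] by (simp_all only: poly_ring_simps mult.commute[of a x])
  qed
  moreover have "Var ` {1..N} \<subseteq> ?S"
  proof
    fix v :: "'k mpoly" assume "v \<in> Var ` {1..N}"
    then obtain i where i: "i \<in> {1..N}" "v = Var i" by blast
    have "v = (\<Sum>j\<in>{1..N}. (if j = i then 1 else 0) * Var j)"
      using i by (simp add: if_distrib[of "\<lambda>a. a * _"] cong: if_cong)
    then show "v \<in> ?S" by (intro CollectI exI[of _ "\<lambda>j. if j = i then 1 else 0"]) auto
  qed
  ultimately have "max_ideal N \<subseteq> ?S" unfolding max_ideal_def by (rule R.genideal_minimal)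
  then show ?thesis using assms by blast
qed

lemma (in module) submodule_plus_multiple:
  assumes S: "submodule R S M" and f: "f \<in> carrier R"
  shows "submodule R {v \<oplus>\<^bsub>M\<^esub> f \<odot>\<^bsub>M\<^esub> u |v u. v \<in> S \<and> u \<in> carrier M} M" (is "submodule R ?T M")
proof -
  interpret S: submodule R S M by (rule S)
  have SM: "v \<in> S \<Longrightarrow> v \<in> carrier M" for v using S.subset by blast
  show ?thesis
  proof
    show "?T \<subseteq> carrier M"
      using SM f by auto
    have "\<zero>\<^bsub>M\<^esub> = \<zero>\<^bsub>M\<^esub> \<oplus>\<^bsub>M\<^esub> f \<odot>\<^bsub>M\<^esub> \<zero>\<^bsub>M\<^esub>" using f by (simp add: smult_r_null)
    then show "\<zero>\<^bsub>M\<^esub> \<in> ?T"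
      using S.zero_closed M.zero_closed by blast
  next
    fix x y assume "x \<in> ?T"
      "y \<in> ?T"
    then obtain v u v' u' where x: "x = v \<oplus>\<^bsub>M\<^esub> f \<odot>\<^bsub>M\<^esub> u" "v \<in> S" "u \<in> carrier M"
      and y: "y = v' \<oplus>\<^bsub>M\<^esub> f \<odot>\<^bsub>M\<^esub> u'" "v' \<in> S" "u' \<in> carrier M" by blast
    have "x \<oplus>\<^bsub>M\<^esub> y = (v \<oplus>\<^bsub>M\<^esub> v') \<oplus>\<^bsub>M\<^esub> f \<odot>\<^bsub>M\<^esub> (u \<oplus>\<^bsub>M\<^esub> u')"
      using x y f SM by (simp add: smult_r_distr M.a_ac)
    then show "x \<oplus>\<^bsub>M\<^esub> y \<in> ?T"
      using x y S.m_closed M.add.m_closed by blast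
  next
    fix c x assume c: "c \<in> carrier R" and "x \<in> ?T"
    then obtain v u where x: "x = v \<oplus>\<^bsub>M\<^esub> f \<odot>\<^bsub>M\<^esub> u" "v \<in> S" "u \<in> carrier M" by blast
    have "c \<odot>\<^bsub>M\<^esub> (f \<odot>\<^bsub>M\<^esub> u) = f \<odot>\<^bsub>M\<^esub> (c \<odot>\<^bsub>M\<^esub> u)"
      using c f x(3) smult_assoc1[of c f u] smult_assoc1[of f c u] by (simp add: m_comm)
    then have "c \<odot>\<^bsub>M\<^esub> x = c \<odot>\<^bsub>M\<^esub> v \<oplus>\<^bsub>M\<^esub> f \<odot>\<^bsub>M\<^esub> (c \<odot>\<^bsub>M\<^esub> u)"
      using x c f SM by (simp add: smult_r_distr)
    then show "c \<odot>\<^bsub>M\<^esub> x \<in> ?T"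
      using S.smult_closed[OF c x(2)] smult_closed[OF c x(3)] by blast
  qed
qed

lemma submodule_ideal_times:
  assumes m: "module (poly_ring N) U" and T: "T \<subseteq> polys N"
  shows "submodule (poly_ring N) (ideal_times N T U) U"
proof -
  interpret module "poly_ring N" U by (rule m)
  show ?thesis unfolding ideal_times_def using T by (intro span_is_submodule) auto
qed

text \<open>It supplies the premise \<open>split\<close> of the Koszul descent. The right-hand side
  is a submodule, so only the generating multiples have to be checked.\<close>

lemma ideal_times_insert:
  assumes m: "module (poly_ring N) U" and T: "T \<subseteq> polys N" and f: "f \<in> polys N"
  shows "ideal_times N (insert f T) U \<subseteq> {v \<oplus>\<^bsub>U\<^esub> f \<odot>\<^bsub>U\<^esub> u |v u. v \<in> ideal_times N T U \<and> u \<in> carrier U}"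
    (is "_ \<subseteq> ?W")
proof -
  interpret module "poly_ring N" U by (rule m)
  have S: "submodule (poly_ring N) (ideal_times N T U) U" by (rule submodule_ideal_times[OF m T])
  let ?g = "{g \<odot>\<^bsub>U\<^esub> u |g u. g \<in> T \<and> u \<in> carrier U}"
  have gU: "?g \<subseteq> carrier U" using T by auto
  have gI: "?g \<subseteq> ideal_times N T U" unfolding ideal_times_def by (rule in_own_span[OF gU])
  show ?thesis
    unfolding ideal_times_def[of N "insert f T"]
  proof (rule span_is_subset[OF _ submodule_plus_multiple[OF S f]])
    show "{g \<odot>\<^bsub>U\<^esub> u |g u. g \<in> insert f T \<and> u \<in> carrier U} \<subseteq>
        ?W"
    proof
      fix x assume "x \<in> {g \<odot>\<^bsub>U\<^esub> u |g u. g \<in> insert f T \<and> u \<in> carrier U}"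
      then obtain g u where gu: "x = g \<odot>\<^bsub>U\<^esub> u" "g \<in> insert f T" "u \<in> carrier U" by blast
      show "x \<in> ?W"
      proof (cases "g \<in> T")
        case True
        then have "x \<in> ideal_times N T U" using gu gI by blast
        moreover have "x = x \<oplus>\<^bsub>U\<^esub> f \<odot>\<^bsub>U\<^esub> \<zero>\<^bsub>U\<^esub>"
          using gu True T f by (simp add: smult_r_null subset_iff)
        ultimately show ?thesis using M.zero_closed by blast
      next
        case False
        then have "x = \<zero>\<^bsub>U\<^esub> \<oplus>\<^bsub>U\<^esub> f \<odot>\<^bsub>U\<^esub> u" using gu f by simp
        then show ?thesis using submodule.zero_closed[OF S] gu(3) by blast
      qed
    qed
  qed
qed

lemma ideal_times_mono:
  assumes "module (poly_ring N) U" "T \<subseteq> T'"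
  shows "ideal_times N T U \<subseteq> ideal_times N T' U"
  unfolding ideal_times_def
  by (rule module.span_is_monotone[OF assms(1)]) (use assms(2) in blast)

context graded_presentation
begin

lemma Z_exact:
  assumes N: "1 \<le> N" and fs: "set fs \<subseteq> max_ideal N" "regular_sequence N U fs" "N - 1 \<le> length fs"
  shows "kos.exact_at N Z {0} 1"
proof -
  have mU: "module (poly_ring N) U" by (rule module_axioms)
  have fR: "set fs \<subseteq> polys N" using fs(2) by (simp add: regular_sequence_def)
  then have tR: "set (take k fs) \<subseteq> polys N" for k using set_take_subset by fast
  define W where "W k = {p \<in> F. present p \<in> ideal_times N (set (take k fs)) U}" for k
  have sub: "submodule (poly_ring N) (ideal_times N (set (take k fs)) U) U" for k
    by (rule submodule_ideal_times[OF mU tR])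
  have "ideal_times N (set (take 0 fs)) U = {\<zero>\<^bsub>U\<^esub>}"
    by (simp add: ideal_times_def span_def lincomb_def)
  then have W0: "W 0 = Z" by (simp add: W_def Z_def)
  have fk: "fs ! k \<in> polys N" "fs ! k \<in> set (take (Suc k) fs)" "fs ! k \<in> max_ideal N"
    "set (take (Suc k) fs) = insert (fs ! k) (set (take k fs))" if "k < N - 1" for k
  proof -
    have k: "k < length fs" using that fs(3) by simp
    show "fs ! k \<in> polys N" "fs ! k \<in> max_ideal N" using nth_mem[OF k] fR fs(1) by blast+
    show "set (take (Suc k) fs) = insert (fs ! k) (set (take k fs))"
      by (simp add: take_Suc_conv_app_nth[OF k])
    then show "fs ! k \<in> set (take (Suc k) fs)" by simp
  qed
  have "kos.exact_at N F (W 0) 2"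
  proof (rule kos.exact_at_regular_sequence[where d = "N - 1" and f = "\<lambda>k. fs ! k"])
    show "kos.submod N F" by (rule free_part_submod)
    show "kos.submod N (W k) \<and> W k \<subseteq> F" for k
    proof (intro conjI kos.submodI)
      show "0 \<in> W k" using submodule.zero_closed[OF sub] by (simp add: W_def free_part_closed present_0)
      show "p + q \<in> W k" if "p \<in> W k" "q \<in> W k" for p q
        using that submodule.m_closed[OF sub] by (simp add: W_def free_part_closed present_add)
      show "fscale s p \<in> W k" if "s \<in> polys N" "p \<in> W k" for s p
        using that submodule.smult_closed[OF sub] by (simp add: W_def F_scale present_scale)
    qed (auto simp: W_def)
    fix k assume k: "k < N - 1"
    note f = fk[OF k]
    show "W k \<subseteq> W (Suc k)"
      using ideal_times_mono[OF mU, of "set (take k fs)" "set (take (Suc k) fs)"] f(4) by (auto simp: W_def)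
    show "\<exists>g. fs ! k = (\<Sum>j = 1..N. g j * Var j) \<and> (\<forall>j\<in>{1..N}. g j \<in> polys N)"
      by (rule max_idealD[OF f(3)])
    show "fscale (fs ! k) p \<in> W (Suc k)" if p: "p \<in> F" for p
    proof -
      let ?S = "{g \<odot>\<^bsub>U\<^esub> u |g u. g \<in> set (take (Suc k) fs) \<and> u \<in> carrier U}"
      have "?S \<subseteq> carrier U" using tR[of "Suc k"] by auto
      then have "?S \<subseteq> ideal_times N (set (take (Suc k) fs)) U"
        unfolding ideal_times_def by (rule in_own_span)
      then show ?thesis
        using f(1,2) present_closed[OF p] present_scale[OF f(1) p] F_scale[OF f(1) p] by (auto simp: W_def)
    qed
    show "p \<in> W k" if "p \<in> F" "fscale (fs ! k) p \<in> W k" for p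
    proof -
      have "fs ! k \<odot>\<^bsub>U\<^esub> present p \<in> ideal_times N (set (take k fs)) U"
        using that present_scale[OF f(1) that(1)] by (simp add: W_def)
      moreover have "k < length fs" using k fs(3) by simp
      ultimately have "present p \<in> ideal_times N (set (take k fs)) U"
        using fs(2) present_closed[OF that(1)] unfolding regular_sequence_def by blast
      then show ?thesis using that(1) by (simp add: W_def)
    qed
    show "\<exists>v\<in>W k. \<exists>p\<in>F. w = v + fscale (fs ! k) p" if w: "w \<in> W (Suc k)" for w
    proof -
      have wF: "w \<in> F" using w by (simp add: W_def)
      have "present w \<in> {v \<oplus>\<^bsub>U\<^esub> fs ! k \<odot>\<^bsub>U\<^esub> u |v u. v \<in> ideal_times N (set (take k fs)) U \<and> u \<in> carrier U}"
        using ideal_times_insert[OF mU tR[of k] f(1)] w unfolding f(4)[symmetric] by (auto simp: W_def)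
      then obtain v u where vu: "present w = v \<oplus>\<^bsub>U\<^esub> fs ! k \<odot>\<^bsub>U\<^esub> u"
        "v \<in> ideal_times N (set (take k fs)) U" "u \<in> carrier U" by blast
      obtain p where p: "p \<in> F" "u = present p" using present_surj[OF vu(3)] by blast
      have vU: "v \<in> carrier U" using vu(2) submodule.subset[OF sub] by blast
      let ?v = "w - fscale (fs ! k) p"
      have fp: "fscale (fs ! k) p \<in> F" by (rule F_scale[OF f(1) p(1)])
      have vF: "?v \<in> F" by (rule kos.submod_closed(5)[OF free_part_submod wF fp])
      have "present ?v \<oplus>\<^bsub>U\<^esub> fs ! k \<odot>\<^bsub>U\<^esub> u = present w"
        using present_add[OF vF fp] present_scale[OF f(1) p(1)] p(2) by simp
      then have "present ?v = v"
        using vu(1) vU present_closed[OF vF] smult_closed[OF f(1) vu(3)] by (simp add: M.add.right_cancel)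
      then have "?v \<in> W k" using vu(2) vF by (simp add: W_def)
      then show ?thesis using p(1) by (intro bexI[of _ ?v] bexI[of _ p]) simp_all
    qed
  qed (use N in simp)
  then have "kos.exact_at N F Z (Suc 1)" unfolding W0 by (simp add: numeral_2_eq_2 One_nat_def)
  then show ?thesis
    by (intro kos.exact_at_kernel[OF free_part_submod Z_submod _ free_part_exact]) (auto simp: Z_def)
qed

lemma ker_basis: "\<exists>B. fvec.independent B \<and> fvec.span B = Z \<inter> F_comp k"
proof -
  have "fvec.subspace (Z \<inter> F_comp k)"
    using kos.submod_closed(1-3)[OF Z_submod]
    by (intro fvec.subspaceI IntI) (auto intro: free_comp_closed fvec.subspace_scale[OF free_comp_subspace])
  moreover obtain B where "B \<subseteq> Z \<inter> F_comp k" "fvec.independent B"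
      "Z \<inter> F_comp k \<subseteq> fvec.span B"
    using fvec.maximal_independent_subset by blast
  ultimately show ?thesis using fvec.span_minimal by (intro exI[of _ B]) blast
qed

lemma dim_bounded_below: "\<exists>L. \<forall>k<L. comp_dim U (G k) = 0"
proof -
  obtain L where L: "\<And>i. i \<in> I \<Longrightarrow> L \<le> snd i"
    using finI by (meson bdd_below_finite bdd_below.E finite_imageI imageI)
  have "comp_dim U (G k) = 0" if "k < L" for k
  proof -
    obtain B where "fvec.independent B" "fvec.span B = Z \<inter> F_comp k"
      using ker_basis by blast
    note d = dim_component(1)[OF this]
    have "mons N (k - snd i) = {}" if "i \<in> I" for i
      using L[OF that] \<open>k < L\<close> by (intro mons_neg) simp
    then show ?thesis using d finI by (simp add: card_free_index)
  qed
  then show ?thesis by blast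
qed

lemma degree_nonneg:
  assumes "\<And>k. k < 0 \<Longrightarrow> comp_dim U (G k) = 0" "i \<in> I"
  shows "0 \<le> snd i"
proof (rule ccontr)
  assume neg: "\<not> 0 \<le> snd i"
  obtain B where B: "fvec.independent B" "fvec.span B = Z \<inter> F_comp (snd i)"
    using ker_basis by blast
  have "card B = card (F_index (snd i))"
    using dim_component(1,2)[OF B] assms(1)[of "snd i"] neg by simp
  then have "F_comp (snd i) \<subseteq> Z" by (rule dim_component(4)[OF B])
  moreover obtain p where "p \<in> F_comp (snd i)" "fst i = present p"
    using present_comp_surj[of "fst i" "snd i"] gens[OF assms(2)] by blast
  ultimately show False using gens[OF assms(2)] by (auto simp: Z_def)
qed

end

section \<open>The upper bound\<close>

lemma sum_shifted_mons_nth: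
  assumes "\<And>i. i \<in> I \<Longrightarrow> 0 \<le> \<delta> i"
  shows "fps_nth ((\<Sum>i\<in>I. fps_X ^ nat (\<delta> i)) * mons_fps M) j = (\<Sum>i\<in>I. int (card (mons M (int j - \<delta> i))))"
  unfolding sum_distrib_right fps_sum_nth
proof (intro sum.cong refl)
  fix i assume "i \<in> I"
  then have \<delta>: "\<delta> i = int (nat (\<delta> i))" using assms by simp
  show "fps_nth (fps_X ^ nat (\<delta> i) * mons_fps M) j = int (card (mons M (int j - \<delta> i)))"
    by (subst (2) \<delta>, cases "j < nat (\<delta> i)") (simp_all add: fps_X_power_mult_nth mons_neg of_nat_diff)
qed

lemma card_mons_1: "card (mons 1 k) = (if k < 0 then 0 else 1)"
proof (cases "k < 0")
  case False
  have "card (mons 1 (int j)) = 1" for j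
  proof (induction j)
    case (Suc j)
    then show ?case
      using card_mons_Suc[of 0 "int (Suc j)"] by (simp add: mons_0_left One_nat_def)
  qed (simp add: mons_0)
  from this[of "nat k"] show ?thesis using False by simp
qed (simp add: mons_neg)

text \<open>The easy half of Uliczka's formula for the Hilbert depth, in depth \<open>N - 1\<close>.\<close>

lemma (in graded_presentation) partial_sums_nonneg:
  fixes H :: "int fps"
  assumes dims: "\<And>k. int (comp_dim U (G k)) =
      (if k < 0 then 0 else fps_nth H (nat k))"
    and N: "1 \<le> N" and fs: "set fs \<subseteq> max_ideal N" "regular_sequence N U fs" "N - 1 \<le> length fs"
    and r: "1 \<le> r"
  shows "0 \<le> fps_nth (H * (1 - fps_X) ^ (N - 1)) r"
proof -
  have dim_neg: "comp_dim U (G k) = 0" if "k < 0" for k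
    using dims[of k] that by simp
  have nonneg: "0 \<le> snd i" if "i \<in> I" for i
    by (rule degree_nonneg[OF dim_neg that])
  interpret A: koszul_acyclic N I snd Z
    by unfold_locales (use finI nonneg Z_submod Z_hom Z_exact[OF N fs] in \<open>auto simp: Z_def\<close>)
  let ?J = "A.ind (int r)"
  let ?P = "(\<Sum>i\<in>I. fps_X ^ nat (snd i)) - (\<Sum>i\<in>?J. fps_X ^ nat (fst i)) :: int fps"
  have nth: "fps_nth (?P * mons_fps M) j =
      (\<Sum>i\<in>I. int (card (mons M (int j - snd i)))) - (\<Sum>i\<in>?J. int (card (mons M (int j - fst i))))" for M j
    using sum_shifted_mons_nth[of I snd M j] sum_shifted_mons_nth[of ?J fst M j] nonneg A.ind_nonneg
    by (simp add: left_diff_distrib)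
  have H: "fps_nth H j = fps_nth (?P * mons_fps N) j" if j: "j \<le> r" for j
  proof -
    have jr: "int j \<le> int r" using j by simp
    let ?B = "(\<lambda>j. A.ev (int r) (unit_fun j)) ` free_index (\<lambda>_. N) ?J fst (int j)"
    have B: "fvec.independent ?B" "fvec.span ?B = Z \<inter> free_comp (\<lambda>_. N) I snd (int j)"
      using A.ev_basis(2,3)[OF jr] by (simp_all add: A.comp_def)
    have "card ?B = card (free_index (\<lambda>_. N) ?J fst (int j))"
      by (rule card_image[OF A.ev_basis(1)[OF jr]])
    then have "int (comp_dim U (G (int j))) =
        int (card (free_index (\<lambda>_. N) I snd (int j))) - int (card (free_index (\<lambda>_. N) ?J fst (int j)))"
      using dim_component(1,2)[OF B] by simp
    then show ?thesis
      using dims[of "int j"] finI by (simp add: nth card_free_index)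
  qed
  have "fps_nth (H * (1 - fps_X) ^ (N - 1)) r = fps_nth (?P * mons_fps N * (1 - fps_X) ^ (N - 1)) r"
    unfolding fps_mult_nth[of H] fps_mult_nth[of "?P * mons_fps N"] using H by (intro sum.cong) simp_all
  also have "?P * mons_fps N * (1 - fps_X) ^ (N - 1) = ?P * mons_fps 1"
    using mons_fps_power[of 1 "N - 1"] N by (simp add: mult.assoc)
  also have "fps_nth (?P * mons_fps 1) r = int (card {i \<in> I. snd i \<le> int r}) - int (card ?J)"
  proof -
    have "(\<Sum>i\<in>I. int (card (mons 1 (int r - snd i)))) = (\<Sum>i\<in>I. if snd i \<le> int r then 1 else 0)"
      by (intro sum.cong) (auto simp: card_mons_1)
    also have "\<dots> = int (card {i \<in> I. snd i \<le> int r})"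
      using finI by (simp add: sum.If_cases Int_def)
    moreover have "(\<Sum>i\<in>?J. int (card (mons 1 (int r - fst i)))) = (\<Sum>i\<in>?J. 1)"
      by (intro sum.cong) (auto simp: card_mons_1 A.ind_def)
    ultimately show ?thesis unfolding nth by simp
  qed
  also have "0 \<le> \<dots>" using A.card_ind_le[OF N r] by simp
  finally show ?thesis .
qed

lemma ex_graded_presentation:
  fixes U :: "('k::field mpoly, 'u) module"
  assumes g: "graded_module N U G" and f: "fin_gen N U"
  shows "\<exists>I. graded_presentation N U G I"
proof -
  have m: "module (poly_ring N) U" using g by (simp add: graded_module_def)
  interpret module "poly_ring N" U by (rule m)
  obtain A where A: "finite A" "A \<subseteq> carrier U" "span A = carrier U"
    using f by (auto simp: fin_gen_def)
  have GU: "G i \<subseteq> carrier U" for i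
    using g subgroup.subset[of "G i" "add_monoid U"] by (simp add: graded_module_def)
  define Q where "Q a d \<longleftrightarrow> (\<forall>i. d i \<in> G i) \<and> finite {i. d i \<noteq> \<zero>\<^bsub>U\<^esub>} \<and>
      a = (\<Oplus>\<^bsub>U\<^esub> i\<in>{i. d i \<noteq> \<zero>\<^bsub>U\<^esub>}. d i)" for a d
  have "\<forall>a\<in>carrier U. \<exists>!d. Q a d"
    using g unfolding graded_module_def Q_def by (elim conjE)
  then have "\<forall>a\<in>A. \<exists>d. Q a d" using A(2) by blast
  then obtain d where dQ: "\<forall>a\<in>A. Q a (d a)" by (rule bchoice[THEN exE])
  have d: "\<forall>a\<in>A. (\<forall>i. d a i \<in> G i) \<and> finite {i. d a i \<noteq> \<zero>\<^bsub>U\<^esub>} \<and>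
      a = (\<Oplus>\<^bsub>U\<^esub> i\<in>{i. d a i \<noteq> \<zero>\<^bsub>U\<^esub>}. d a i)"
    using dQ unfolding Q_def .
  define I where "I = (\<lambda>(a, i). (d a i, i)) ` (SIGMA a:A. {i. d a i \<noteq> \<zero>\<^bsub>U\<^esub>})"
  have fI: "finite I" using A(1) d by (auto simp: I_def intro!: finite_imageI finite_SigmaI)
  have gens: "fst i \<in> G (snd i) \<and> fst i \<noteq> \<zero>\<^bsub>U\<^esub>" if "i \<in> I" for i
    using that d by (auto simp: I_def)
  have IU: "fst ` I \<subseteq> carrier U" using gens GU by blast
  have S: "submodule (poly_ring N) (span (fst ` I)) U" by (rule span_is_submodule[OF IU])
  have sum: "finsum U f K \<in> span (fst ` I)"
    if "finite K" "\<And>k. k \<in> K \<Longrightarrow> f k \<in> span (fst ` I)" for f and K :: "int set"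
    using that
  proof (induction K rule: finite_induct)
    case (insert x K)
    then have "f \<in> K \<rightarrow> carrier U" "f x \<in> carrier U" using submodule.subset[OF S] by auto
    then show ?case using insert submodule.m_closed[OF S] by simp
  qed (simp add: submodule.zero_closed[OF S])
  have "A \<subseteq> span (fst ` I)"
  proof
    fix a assume a: "a \<in> A"
    have "d a i \<in> fst ` I" if "d a i \<noteq> \<zero>\<^bsub>U\<^esub>" for i
      using a that unfolding I_def by force
    then have "(\<Oplus>\<^bsub>U\<^esub> i\<in>{i. d a i \<noteq> \<zero>\<^bsub>U\<^esub>}. d a i) \<in> span (fst ` I)"
      using d a in_own_span[OF IU] by (intro sum) auto
    then show "a \<in> span (fst ` I)" using d a by simp
  qed
  then have "carrier U \<subseteq> span (fst ` I)" using span_is_subset[OF _ S] A(3) by blast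
  then have "span (fst ` I) = carrier U" using span_is_subset2[OF IU] by blast
  then have "graded_presentation N U G I"
    using g fI gens m by (intro graded_presentation.intro graded_presentation_axioms.intro) auto
  then show ?thesis by blast
qed

lemma one_minus_X_power_nth:
  "fps_nth ((1 - fps_X :: int fps) ^ m) 0 = 1" "fps_nth ((1 - fps_X :: int fps) ^ m) 1 = - int m"
proof -
  show 0: "fps_nth ((1 - fps_X :: int fps) ^ m) 0 = 1" for m
    by (induction m) simp_all
  show "fps_nth ((1 - fps_X :: int fps) ^ m) 1 = - int m"
  proof (induction m)
    case (Suc m)
    have "fps_nth ((1 - fps_X :: int fps) ^ Suc m) 1 =
        fps_nth ((1 - fps_X) ^ m) 1 - fps_nth (fps_X * (1 - fps_X) ^ m) 1"
      by (simp add: left_diff_distrib)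
    then show ?case using Suc.IH 0[of m] by (simp add: fps_X_mult_nth)
  qed simp
qed

lemma hilbert_fps_partial_sum:
  assumes n: "1 \<le> n" and r: "1 \<le> r" and N: "N = n + r - 1"
  shows "fps_nth (hilbert_fps n r * (1 - fps_X) ^ (N - 1)) r = - int (n - 1)"
proof -
  let ?E = "(1 - fps_X :: int fps) ^ (N - 1)"
  have N1: "1 \<le> N" using n r N by simp
  have A: "mons_fps N * ?E = mons_fps 1" using mons_fps_power[of 1 "N - 1"] N1 by simp
  have "mons_fps (r - 1) = mons_fps N * (1 - fps_X) ^ n"
    using mons_fps_power[of "r - 1" n] n r N by (simp add: add.commute)
  then have "mons_fps (r - 1) * ?E = mons_fps 1 * (1 - fps_X) ^ n"
    using A by (metis mult.assoc mult.commute)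
  also have "\<dots> = mons_fps 1 * (1 - fps_X) * (1 - fps_X) ^ (n - 1)"
    using n by (metis Suc_pred' less_le_trans less_one mult.assoc power_Suc zero_less_one)
  also have "mons_fps 1 * (1 - fps_X) = 1"
    using mons_fps_Suc[of 0] by (simp add: One_nat_def mons_fps_0)
  finally have B: "mons_fps (r - 1) * ?E = (1 - fps_X) ^ (n - 1)" by simp
  have "hilbert_fps n r * ?E = mons_fps 1 - fps_X ^ (r - 1) * (mons_fps 1 - (1 - fps_X) ^ (n - 1))"
    unfolding hilbert_fps_def N[symmetric]
    by (simp only: left_diff_distrib mult.assoc A B)
  then show ?thesis
    using r one_minus_X_power_nth(2)[of "n - 1"] by (simp add: fps_X_power_mult_nth card_mons_1)
qed

lemma hilbert_series_eqD:
  assumes eq: "hilbert_series U G = hilbert_series M H"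
    and U: "\<exists>L. \<forall>k<L. comp_dim U (G k) = 0"
    and M: "\<exists>L. \<forall>k<L. comp_dim M (H k) = 0"
  shows "comp_dim U (G k) =
    comp_dim M (H k)"
proof -
  have "int (comp_dim U (G k)) = fls_nth (hilbert_series U G) k"
    unfolding hilbert_series_def by (subst nth_Abs_fls_ex_lower_bound) (use U in auto)
  moreover have "int (comp_dim M (H k)) = fls_nth (hilbert_series M H) k"
    unfolding hilbert_series_def by (subst nth_Abs_fls_ex_lower_bound) (use M in auto)
  ultimately show ?thesis using eq by simp
qed

lemma hdepth_upper_bound:
  assumes n: "n \<ge> 2" and r: "r \<ge> 1" and N: "N = n + r - 1"
  shows "hdepth N (quotient_module N (I_nr n r :: 'k::field mpoly set)) (quotient_grading N (I_nr n r)) \<le>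
    enat (N - 2)"
  unfolding hdepth_def
proof (rule Sup_least)
  let ?M = "quotient_module N (I_nr n r :: 'k mpoly set)" and ?H = "quotient_grading N (I_nr n r :: 'k mpoly set)"
  fix x assume "x \<in> {depth N U | (U :: ('k mpoly, (nat \<Rightarrow> 'k mpoly) set) module) G.
        graded_module N U G \<and> fin_gen N U \<and> hilbert_series U G = hilbert_series ?M ?H}"
  then obtain U :: "('k mpoly, (nat \<Rightarrow> 'k mpoly) set) module" and G where
    U: "graded_module N U G" "fin_gen N U" "hilbert_series U G = hilbert_series ?M ?H" and x: "x = depth N U"
    by blast
  obtain I where "graded_presentation N U G I" using ex_graded_presentation[OF U(1,2)] by blast
  then interpret P: graded_presentation N U G I .
  have dM: "int (comp_dim ?M (?H k)) =
      (if k < 0 then 0 else fps_nth (hilbert_fps n r) (nat k))" for k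
    using n r N by (intro dim_S_mod_I_nr) auto
  have "\<exists>L. \<forall>k<L. comp_dim ?M (?H k) = 0"
    using dM by (intro exI[of _ 0]) (metis of_nat_eq_0_iff)
  then have dims: "int (comp_dim U (G k)) =
      (if k < 0 then 0 else fps_nth (hilbert_fps n r) (nat k))" for k
    using hilbert_series_eqD[OF U(3) P.dim_bounded_below] dM by simp
  show "x \<le> enat (N - 2)"
    unfolding x depth_def
  proof (rule Sup_least)
    fix y assume "y \<in> {enat (length fs) |fs. set fs \<subseteq> max_ideal N \<and> regular_sequence N U fs}"
    then obtain fs where fs: "set fs \<subseteq> max_ideal N" "regular_sequence N U fs" and y: "y = enat (length fs)"
      by blast
    have "\<not> N - 1 \<le> length fs"
    proof
      assume "N - 1 \<le> length fs"
      then have "0 \<le> fps_nth (hilbert_fps n r * (1 - fps_X) ^ (N - 1)) r"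
        using dims fs n r N by (intro P.partial_sums_nonneg) auto
      then show False using hilbert_fps_partial_sum[of n r N] n r N by simp
    qed
    then show "y \<le> enat (N - 2)" by (simp add: y)
  qed
qed

theorem theorem2p10:
  fixes n r :: nat and I :: "'k::field mpoly set"
  assumes "n \<ge> 2"
    and "r \<ge> 1 + ((n - 2) choose ((n - 2) div 2))"
    and "I = I_nr n r"
  shows "hdepth (n + r - 1) (quotient_module (n + r - 1) I) (quotient_grading (n + r - 1) I)
           = enat (n + r - 3)"
proof (rule antisym)
  show "hdepth (n + r - 1) (quotient_module (n + r - 1) I) (quotient_grading (n + r - 1) I) \<le> enat (n + r - 3)"
    using hdepth_upper_bound[of n r, OF assms(1) _ refl] assms(2,3) by simp
  show "enat (n + r - 3) \<le> hdepth (n + r - 1) (quotient_module (n + r - 1) I) (quotient_grading (n + r - 1) I)"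
    unfolding assms(3) by (rule hdepth_lower_bound[OF assms(1,2) refl])
qed

end
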